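(* Let $G$ be a finitely generated nilpotent group, $W\subseteq G$ a finite symmetric generating set containing $e$, $\rho(g)=|g|_W$ the word length, and $D$ the degree of polynomial growth (homogeneous dimension) of $G$. Let $(K_R)_{R\ge R_0}$ be a family of centered, finitely supported probability measures on $G$, and let $\eta>0$, $\beta>0$ be such that $$\inf_{R\ge R_0}K_R(e)\ge\eta,\qquad \inf_{R\ge R_0}\min_{w\in W}K_R(w)\ge\eta,\qquad \mathfrak M_\beta:=\sup_{R\ge R_0}\sum_{g\in G}e^{\beta\rho(g)}K_R(g)<\infty.$$ Let $\kappa>0$ and define $R_q:=\max\{R_0,\kappa\log(q+1)\}$ for $q\in\mathbb N$, $q\ge1$. Then there exist constants $a>0$ and $C>0$, depending only on $(G,W,\eta,\beta,\mathfrak M_\beta,\kappa)$, such that for every integer $q\ge1$ and every $h\in W$, $$\big\|e^{a\rho/\sqrt q}K_{R_q}^{(q)}\big\|_2\le Cq^{-D/4},\qquad \big\|e^{a\rho/\sqrt q}\,\partial_hK_{R_q}^{(q)}\big\|_2\le Cq^{-1/2-D/4},$$ and consequently $$\|\partial_hK_{R_q}^{(q)}\|_1\le Cq^{-1/2},\qquad \sum_{g\in G}\rho(g)\,|\partial_hK_{R_q}^{(q)}(g)|\le C.$$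
   Context: $K^{(q)}=K*\cdots*K$ ($q$ factors) is the $q$-fold convolution. $\partial_hf(y):=f(h^{-1}y)-f(y)$. Norms $\|\cdot\|_p$ are those of $\ell^p(G)$ (counting measure). Let $\pi=(\pi_1,\dots,\pi_d):G\to\mathbb Z^d$ be the projection onto the free part of the Abelianization of $G$; a finitely supported probability measure $K$ is centered if $\sum_{g\in G}K(g)\pi_j(g)=0$ for $j=1,\dots,d$. *)

theory Defs
  imports
    "HOL-Probability.Probability_Mass_Function"
    "HOL-Library.Landau_Symbols"
    "HOL-Algebra.Generated_Groups"
    "HOL-Algebra.Elementary_Groups"
    "HOL-Algebra.Product_Groups"
begin

section \<open>Nilpotent groups and the free part of the abelianization\<close>

fun lower_central :: "('a, 'b) monoid_scheme \<Rightarrow> nat \<Rightarrow> 'a set" where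
  "lower_central G 0 = carrier G"
| "lower_central G (Suc n) = generate G
     (\<Union>x \<in> lower_central G n. \<Union>y \<in> carrier G.
        {x \<otimes>\<^bsub>G\<^esub> y \<otimes>\<^bsub>G\<^esub> inv\<^bsub>G\<^esub> x \<otimes>\<^bsub>G\<^esub> inv\<^bsub>G\<^esub> y})"

definition nilpotent_group :: "('a, 'b) monoid_scheme \<Rightarrow> bool" where
  "nilpotent_group G \<longleftrightarrow> group G \<and> (\<exists>n. lower_central G n = {\<one>\<^bsub>G\<^esub>})"

definition abelianization :: "('a, 'b) monoid_scheme \<Rightarrow> 'a set monoid" where
  "abelianization G = G Mod (derived G (carrier G))"

definition torsion_part :: "('a, 'b) monoid_scheme \<Rightarrow> 'a set" where
  "torsion_part A = {x \<in> carrier A. \<exists>n::nat. n > 0 \<and> x [^]\<^bsub>A\<^esub> n = \<one>\<^bsub>A\<^esub>}"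

abbreviation int_lattice :: "nat \<Rightarrow> (nat \<Rightarrow> int) monoid" where
  "int_lattice d \<equiv> product_group {..<d} (\<lambda>_. integer_group)"

text \<open>\<open>\<pi>\<close> is the composition of the quotient maps from \<open>G\<close> to its abelianization and on to
  the abelianization modulo torsion, followed by some identification of the latter with
  \<open>\<int>\<^sup>d\<close>. The coordinates are indexed by \<open>0, \<dots>, d - 1\<close>. A different identification
  changes \<open>\<pi>\<close> by an automorphism of \<open>\<int>\<^sup>d\<close>, which does not affect \<open>centered\<close> below.\<close>

definition free_abelian_projection ::
  "('a, 'b) monoid_scheme \<Rightarrow> nat \<Rightarrow> ('a \<Rightarrow> nat \<Rightarrow> int) \<Rightarrow> bool" where
  "free_abelian_projection G d \<pi> \<longleftrightarrow>
     (\<exists>\<phi> \<in> iso (abelianization G Mod torsion_part (abelianization G)) (int_lattice d).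
        \<forall>g \<in> carrier G.
          \<pi> g = \<phi> (torsion_part (abelianization G) #>\<^bsub>abelianization G\<^esub>
                     (derived G (carrier G) #>\<^bsub>G\<^esub> g)))"


section \<open>Word length and growth\<close>

definition word_length :: "('a, 'b) monoid_scheme \<Rightarrow> 'a set \<Rightarrow> 'a \<Rightarrow> nat" where
  "word_length G W g =
     (LEAST n. \<exists>ws. length ws = n \<and> set ws \<subseteq> W \<and> foldr (\<otimes>\<^bsub>G\<^esub>) ws \<one>\<^bsub>G\<^esub> = g)"

definition finite_symmetric_generating_set :: "('a, 'b) monoid_scheme \<Rightarrow> 'a set \<Rightarrow> bool" where
  "finite_symmetric_generating_set G W \<longleftrightarrow>
     finite W \<and> W \<subseteq> carrier G \<and> (\<forall>w \<in> W. inv\<^bsub>G\<^esub> w \<in> W) \<and> generate G W = carrier G"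

text \<open>The volume growth function is of order \<open>n\<^sup>D\<close>, from above and from below. This
  determines \<open>D\<close>. By the Bass-Guivarc'h theorem every finitely generated nilpotent group has
  such a \<open>D\<close>, and it is the homogeneous dimension.\<close>

definition has_growth_degree :: "('a, 'b) monoid_scheme \<Rightarrow> 'a set \<Rightarrow> real \<Rightarrow> bool" where
  "has_growth_degree G W D \<longleftrightarrow>
     (\<lambda>n::nat. real (card {g \<in> carrier G. word_length G W g \<le> n})) \<in> \<Theta>(\<lambda>n. real n powr D)"


section \<open>Functions and finitely supported measures on a group\<close>

text \<open>All functions considered below have finite support in \<open>carrier G\<close>, so the sums over
  the possibly infinite carrier are finite sums.\<close>

definition lp_norm :: "('a, 'b) monoid_scheme \<Rightarrow> real \<Rightarrow> ('a \<Rightarrow> real) \<Rightarrow> real" where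
  "lp_norm G p f = (\<Sum>\<^sub>\<infinity>g \<in> carrier G. \<bar>f g\<bar> powr p) powr (1 / p)"

definition conv :: "('a, 'b) monoid_scheme \<Rightarrow> ('a \<Rightarrow> real) \<Rightarrow> ('a \<Rightarrow> real) \<Rightarrow> 'a \<Rightarrow> real" where
  "conv G f f' x = (\<Sum>\<^sub>\<infinity>y \<in> carrier G. f y * f' (inv\<^bsub>G\<^esub> y \<otimes>\<^bsub>G\<^esub> x))"

text \<open>The empty convolution power is the unit mass at the identity.\<close>

fun conv_power :: "('a, 'b) monoid_scheme \<Rightarrow> ('a \<Rightarrow> real) \<Rightarrow> nat \<Rightarrow> 'a \<Rightarrow> real" where
  "conv_power G f 0 = (\<lambda>x. if x = \<one>\<^bsub>G\<^esub> then 1 else 0)"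
| "conv_power G f (Suc q) = conv G f (conv_power G f q)"

definition diff_op :: "('a, 'b) monoid_scheme \<Rightarrow> 'a \<Rightarrow> ('a \<Rightarrow> real) \<Rightarrow> 'a \<Rightarrow> real" where
  "diff_op G h f y = f (inv\<^bsub>G\<^esub> h \<otimes>\<^bsub>G\<^esub> y) - f y"

definition finitely_supported_on :: "('a, 'b) monoid_scheme \<Rightarrow> 'a pmf \<Rightarrow> bool" where
  "finitely_supported_on G K \<longleftrightarrow> finite (set_pmf K) \<and> set_pmf K \<subseteq> carrier G"

definition centered ::
  "('a, 'b) monoid_scheme \<Rightarrow> nat \<Rightarrow> ('a \<Rightarrow> nat \<Rightarrow> int) \<Rightarrow> 'a pmf \<Rightarrow> bool" where
  "centered G d \<pi> K \<longleftrightarrow>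
     (\<forall>j<d. (\<Sum>\<^sub>\<infinity>g \<in> carrier G. pmf K g * real_of_int (\<pi> g j)) = 0)"

definition exp_moment :: "('a, 'b) monoid_scheme \<Rightarrow> 'a set \<Rightarrow> real \<Rightarrow> 'a pmf \<Rightarrow> real" where
  "exp_moment G W \<beta> K =
     (\<Sum>\<^sub>\<infinity>g \<in> carrier G. exp (\<beta> * real (word_length G W g)) * pmf K g)"

end

theory Submission
  imports Defs "HOL-Real_Asymp.Real_Asymp"
begin

text \<open>
  Write \<open>\<Phi> = exp (\<theta> \<rho>)\<close> with \<open>\<theta> = O(1 / sqrt q)\<close>. The core is the one-step inequality
  \<open>\<Sum>\<Phi> (K * u)\<^sup>2 \<le> (1 + A \<theta>\<^sup>2) \<Sum>\<Phi> u\<^sup>2 - c \<Sum>\<Phi> |grad u|\<^sup>2\<close>. Its gradient term is the variance that is lost when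
  averaging with \<open>K\<close>. The drift \<open>B y = \<Sum>x. u(x)\<^sup>2 (\<Phi>(y x) - \<Phi>(x))\<close> is additive in \<open>y\<close> up to an error
  \<open>\<theta> \<Sum>\<Phi> |grad u\<^sup>2|\<close>; hence it is a linear function of \<open>\<pi> y\<close> up to such an error, centering removes
  the linear part, and the gradient term absorbs the rest.

  Iterating the inequality from the indicator of a ball of radius \<open>sqrt q\<close> bounds the moments
  \<open>\<Sum>\<Phi> K\<^sup>(\<^sup>q\<^sup>)\<close>. For \<open>\<theta> = 0\<close>, together with averaging over balls and the volume growth, it
  yields \<open>sup K\<^sup>(\<^sup>q\<^sup>) = O(q powr (- D / 2))\<close>, and the two bounds give the weighted \<open>\<ell>\<^sup>2\<close> estimate. Summing
  the inequality over \<open>q / 2 \<le> m < q\<close> gives an \<open>m\<close> at which the weighted gradient of \<open>K\<^sup>(\<^sup>m\<^sup>)\<close> is as small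
  as claimed. Right convolution with \<open>K\<^sup>(\<^sup>q\<^sup>-\<^sup>m\<^sup>)\<close> commutes with the left differences \<open>\<partial>\<^sub>h\<close> and costs only an
  exponential moment, which carries the bound from \<open>m\<close> to \<open>q\<close>.
\<close>

text \<open>The obstacle is that \<open>\<rho>\<close> is only Lipschitz: a second difference of
  \<open>exp (\<theta> \<rho>)\<close> is in general of order \<open>\<theta>\<close>, whereas an
  iteration over \<open>q\<close> steps tolerates errors of order \<open>\<theta>\<^sup>2\<close>
  only, since \<open>(1 + A \<theta>\<^sup>2) ^ q\<close> has to stay bounded for
  \<open>\<theta>\<close> of order \<open>1 / sqrt q\<close>. Pairing one first difference of the
  weight with one of \<open>u\<^sup>2\<close> costs about \<open>\<theta> |u| |grad u|\<close>. By
  Young's inequality this is a small multiple of \<open>|grad u|\<^sup>2\<close>, paid by the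
  variance, plus a multiple of \<open>\<theta>\<^sup>2 u\<^sup>2\<close>. The measures are not
  assumed symmetric, and their supports are not uniformly bounded. So no spectral calculus is at
  hand for the gradient, and the linear approximation of the drift must hold for all
  \<open>y\<close> at once, with an error that the exponential moment can pay. Uniformity in the
  family is built in: each estimate fixes its constants before the kernel, and for each
  \<open>q\<close> only one kernel is convolved with itself.\<close>

locale word_metric = group G for G :: "('a, 'b) monoid_scheme" (structure) +
  fixes W :: "'a set"
  assumes gens: "finite_symmetric_generating_set G W"
    and one_gen: "\<one> \<in> W"
begin

lemma fin_W: "finite W" and W_carrier: "w \<in> W \<Longrightarrow> w \<in> carrier G"
  and inv_W: "w \<in> W \<Longrightarrow> inv w \<in> W" and generate_W: "generate G W = carrier G"
  using gens by (auto simp: finite_symmetric_generating_set_def)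

subsection \<open>Sums of finitely supported functions\<close>

text \<open>\<open>infsum\<close> is 0 where the sum diverges, so scaling, nonnegativity, congruence
  and reindexing hold for every function; the rules that add or compare sums ask for
  \<open>fs\<close>.\<close>

definition tot :: "('a \<Rightarrow> real) \<Rightarrow> real" where
  "tot f = (\<Sum>\<^sub>\<infinity>x \<in> carrier G. f x)"

definition fs :: "('a \<Rightarrow> real) \<Rightarrow> bool" where
  "fs f \<longleftrightarrow> finite {x \<in> carrier G. f x \<noteq> 0}"

lemma tot_eq_sum:
  assumes "finite A" "A \<subseteq> carrier G" "\<And>x. x \<in> carrier G - A \<Longrightarrow> f x = 0"
  shows "tot f = sum f A"
proof -
  have "tot f = infsum f A"
    unfolding tot_def by (rule infsum_cong_neutral) (use assms in auto)
  then show ?thesis using assms by simp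
qed

lemma fs_summable: "fs f \<Longrightarrow> f summable_on carrier G"
  unfolding fs_def by (rule finite_nonzero_values_imp_summable_on) auto

lemma fs_subset: "fs f \<Longrightarrow> (\<And>x. x \<in> carrier G \<Longrightarrow> f x = 0 \<Longrightarrow> g x = 0) \<Longrightarrow> fs g"
  unfolding fs_def by (erule finite_subset[rotated]) auto

lemma fs_mult_left: "fs f \<Longrightarrow> fs (\<lambda>x. f x * g x)"
  and fs_mult_right: "fs g \<Longrightarrow> fs (\<lambda>x. f x * g x)"
  and fs_abs: "fs f \<Longrightarrow> fs (\<lambda>x. \<bar>f x\<bar>)"
  and fs_divide: "fs f \<Longrightarrow> fs (\<lambda>x. f x / g x)"
  and fs_uminus: "fs f \<Longrightarrow> fs (\<lambda>x. - f x)"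
  by (auto elim: fs_subset)

lemma fs_power2: "fs f \<Longrightarrow> fs (\<lambda>x. (f x)\<^sup>2)"
  by (auto elim: fs_subset)

lemma fs_add: "fs f \<Longrightarrow> fs g \<Longrightarrow> fs (\<lambda>x. f x + g x)"
  and fs_diff: "fs f \<Longrightarrow> fs g \<Longrightarrow> fs (\<lambda>x. f x - g x)"
  unfolding fs_def
  by (rule finite_subset[of _ "{x \<in> carrier G. f x \<noteq> 0} \<union> {x \<in> carrier G. g x \<noteq> 0}"]; auto)+

lemma fs_zero: "fs (\<lambda>x. 0)"
  by (simp add: fs_def)

lemma fs_sum: "(\<And>y. y \<in> Y \<Longrightarrow> fs (f y)) \<Longrightarrow> fs (\<lambda>x. \<Sum>y\<in>Y. f y x)"
  by (induction Y rule: infinite_finite_induct) (auto intro: fs_add fs_zero)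

lemma fs_left: "a \<in> carrier G \<Longrightarrow> fs f \<Longrightarrow> fs (\<lambda>x. f (a \<otimes> x))"
proof -
  assume a: "a \<in> carrier G" and f: "fs f"
  have "{x \<in> carrier G. f (a \<otimes> x) \<noteq> 0} \<subseteq> (\<lambda>x. inv a \<otimes> x) ` {x \<in> carrier G. f x \<noteq> 0}"
  proof
    fix x assume "x \<in> {x \<in> carrier G. f (a \<otimes> x) \<noteq> 0}"
    then show "x \<in> (\<lambda>x. inv a \<otimes> x) ` {x \<in> carrier G. f x \<noteq> 0}"
      using a by (intro image_eqI[of _ _ "a \<otimes> x"]) (auto simp: m_assoc[symmetric])
  qed
  then show ?thesis using f unfolding fs_def by (meson finite_imageI finite_subset)
qed

lemma fs_inverse: "fs f \<Longrightarrow> fs (\<lambda>x. f (inv x))"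
proof -
  assume f: "fs f"
  have "{x \<in> carrier G. f (inv x) \<noteq> 0} \<subseteq> (\<lambda>x. inv x) ` {x \<in> carrier G. f x \<noteq> 0}"
    by (auto intro!: image_eqI[of _ _ "inv _"])
  then show ?thesis using f unfolding fs_def by (meson finite_imageI finite_subset)
qed

lemmas fs_intros = fs_mult_left fs_power2 fs_abs fs_divide fs_uminus fs_add fs_diff fs_zero
  fs_sum fs_left

lemma tot_add: "fs f \<Longrightarrow> fs g \<Longrightarrow> tot (\<lambda>x. f x + g x) = tot f + tot g"
  unfolding tot_def by (intro infsum_add fs_summable)

lemma tot_cmult: "tot (\<lambda>x. c * f x) = c * tot f"
  unfolding tot_def by (rule infsum_cmult_right')

lemma tot_diff: "fs f \<Longrightarrow> fs g \<Longrightarrow> tot (\<lambda>x. f x - g x) = tot f - tot g"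
  using tot_add[of f "\<lambda>x. - g x"] tot_cmult[of "-1" g] by (simp add: fs_uminus)

lemma tot_mono: "fs f \<Longrightarrow> fs g \<Longrightarrow> (\<And>x. x \<in> carrier G \<Longrightarrow> f x \<le> g x) \<Longrightarrow> tot f \<le> tot g"
  unfolding tot_def by (intro infsum_mono fs_summable)

lemma tot_nonneg: "(\<And>x. x \<in> carrier G \<Longrightarrow> 0 \<le> f x) \<Longrightarrow> 0 \<le> tot f"
  unfolding tot_def by (rule infsum_nonneg)

lemma tot_cong: "(\<And>x. x \<in> carrier G \<Longrightarrow> f x = g x) \<Longrightarrow> tot f = tot g"
  unfolding tot_def by (rule infsum_cong)

lemma tot_zero: "tot (\<lambda>x. 0) = 0"
  by (simp add: tot_def)

lemma tot_sum:
  "finite Y \<Longrightarrow> (\<And>y. y \<in> Y \<Longrightarrow> fs (f y)) \<Longrightarrow> tot (\<lambda>x. \<Sum>y\<in>Y. f y x) = (\<Sum>y\<in>Y. tot (f y))"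
  by (induction Y rule: finite_induct) (auto simp: tot_zero tot_add fs_sum)

lemma abs_tot_le: "fs f \<Longrightarrow> \<bar>tot f\<bar> \<le> tot (\<lambda>x. \<bar>f x\<bar>)"
  using tot_mono[of f "\<lambda>x. \<bar>f x\<bar>"] tot_mono[of "\<lambda>x. - f x" "\<lambda>x. \<bar>f x\<bar>"] tot_cmult[of "-1" f]
  by (simp add: fs_intros abs_le_iff)

lemma tot_left: "a \<in> carrier G \<Longrightarrow> tot (\<lambda>x. f (a \<otimes> x)) = tot f"
proof -
  assume a: "a \<in> carrier G"
  have "bij_betw (\<lambda>x. a \<otimes> x) (carrier G) (carrier G)"
    by (rule bij_betw_byWitness[where f' = "\<lambda>x. inv a \<otimes> x"]) (use a in \<open>auto simp: m_assoc[symmetric]\<close>)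
  then show ?thesis unfolding tot_def by (rule infsum_reindex_bij_betw)
qed

lemma tot_inverse: "tot (\<lambda>x. f (inv x)) = tot f"
proof -
  have "bij_betw (\<lambda>x. inv x) (carrier G) (carrier G)"
    by (rule bij_betw_byWitness[where f' = "\<lambda>x. inv x"]) auto
  then show ?thesis unfolding tot_def by (rule infsum_reindex_bij_betw)
qed

lemma tot_Cauchy_Schwarz:
  assumes "fs f" "fs g"
  shows "(tot (\<lambda>x. f x * g x))\<^sup>2 \<le> tot (\<lambda>x. (f x)\<^sup>2) * tot (\<lambda>x. (g x)\<^sup>2)"
proof -
  let ?A = "{x \<in> carrier G. f x \<noteq> 0} \<union> {x \<in> carrier G. g x \<noteq> 0}"
  have A: "finite ?A" "?A \<subseteq> carrier G" using assms by (auto simp: fs_def)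
  have "tot (\<lambda>x. f x * g x) = (\<Sum>x\<in>?A. f x * g x)" "tot (\<lambda>x. (f x)\<^sup>2) = (\<Sum>x\<in>?A. (f x)\<^sup>2)"
    "tot (\<lambda>x. (g x)\<^sup>2) = (\<Sum>x\<in>?A. (g x)\<^sup>2)"
    by (rule tot_eq_sum[OF A]; auto)+
  then show ?thesis using Cauchy_Schwarz_ineq_sum[of f g ?A] by simp
qed

subsection \<open>Convolution\<close>

lemma conv_eq_tot: "conv G f g x = tot (\<lambda>y. f y * g (inv y \<otimes> x))"
  by (simp add: conv_def tot_def)

lemma conv_eq_sum:
  assumes "finite Y" "Y \<subseteq> carrier G" "\<And>y. y \<in> carrier G - Y \<Longrightarrow> f y = 0"
  shows "conv G f g x = (\<Sum>y\<in>Y. f y * g (inv y \<otimes> x))"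
  unfolding conv_eq_tot by (rule tot_eq_sum) (use assms in auto)

lemma fs_conv: assumes "fs f" "fs g" shows "fs (conv G f g)"
proof -
  let ?Y = "{x \<in> carrier G. f x \<noteq> 0}"
  have "conv G f g = (\<lambda>x. \<Sum>y\<in>?Y. f y * g (inv y \<otimes> x))"
    by (rule ext, rule conv_eq_sum) (use assms in \<open>auto simp: fs_def\<close>)
  then show ?thesis using assms by (auto intro!: fs_sum fs_mult_right fs_left)
qed

text \<open>Exchange of the sums, then the substitution of \<open>y \<otimes> x\<close> for
  \<open>x\<close>. A constant \<open>c\<close> gives the total mass of a convolution, a reflected
  third factor gives associativity, and the weight \<open>Phi\<close> gives the quantity from which
  the drift is split off.\<close>

lemma tot_conv_weighted:
  assumes "fs f" "fs g"
  shows "tot (\<lambda>x. c x * conv G f g x) = tot (\<lambda>y. f y * tot (\<lambda>x. c (y \<otimes> x) * g x))"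
proof -
  let ?Y = "{x \<in> carrier G. f x \<noteq> 0}"
  have Y: "finite ?Y" using assms by (simp add: fs_def)
  have "tot (\<lambda>x. c x * conv G f g x) = tot (\<lambda>x. \<Sum>y\<in>?Y. f y * (c x * g (inv y \<otimes> x)))"
  proof (rule tot_cong)
    fix x
    have "conv G f g x = (\<Sum>y\<in>?Y. f y * g (inv y \<otimes> x))"
      by (rule conv_eq_sum) (use Y in auto)
    then show "c x * conv G f g x = (\<Sum>y\<in>?Y. f y * (c x * g (inv y \<otimes> x)))"
      by (simp add: sum_distrib_left algebra_simps)
  qed
  also have "\<dots> = (\<Sum>y\<in>?Y. tot (\<lambda>x. f y * (c x * g (inv y \<otimes> x))))"
    using assms Y by (intro tot_sum) (auto intro!: fs_mult_right fs_left)
  also have "\<dots> = (\<Sum>y\<in>?Y. f y * tot (\<lambda>x. c (y \<otimes> x) * g x))"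
  proof (rule sum.cong)
    fix y assume "y \<in> ?Y"
    then have y: "y \<in> carrier G" by simp
    have "tot (\<lambda>x. c x * g (inv y \<otimes> x)) = tot (\<lambda>x. c (y \<otimes> x) * g (inv y \<otimes> (y \<otimes> x)))"
      using tot_left[OF y, of "\<lambda>x. c x * g (inv y \<otimes> x)"] by simp
    also have "\<dots> = tot (\<lambda>x. c (y \<otimes> x) * g x)"
      by (rule tot_cong) (use y in \<open>simp add: m_assoc[symmetric]\<close>)
    finally show "tot (\<lambda>x. f y * (c x * g (inv y \<otimes> x))) = f y * tot (\<lambda>x. c (y \<otimes> x) * g x)"
      by (simp add: tot_cmult)
  qed simp
  also have "\<dots> = tot (\<lambda>y. f y * tot (\<lambda>x. c (y \<otimes> x) * g x))"
    by (rule tot_eq_sum[symmetric]) (use Y in auto)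
  finally show ?thesis .
qed

lemma tot_conv: assumes "fs f" "fs g" shows "tot (conv G f g) = tot f * tot g"
proof -
  have "tot (conv G f g) = tot (\<lambda>y. f y * tot g)"
    using tot_conv_weighted[OF assms, of "\<lambda>_. 1"] by simp
  also have "\<dots> = tot (\<lambda>y. tot g * f y)" by (simp add: mult.commute)
  finally show ?thesis by (simp add: tot_cmult)
qed

lemma conv_nonneg:
  assumes "\<And>x. x \<in> carrier G \<Longrightarrow> 0 \<le> f x" "\<And>x. x \<in> carrier G \<Longrightarrow> 0 \<le> g x" "x \<in> carrier G"
  shows "0 \<le> conv G f g x"
  unfolding conv_eq_tot by (rule tot_nonneg) (use assms in auto)

lemma conv_assoc:
  assumes "fs f" "fs g" "fs h" and x: "x \<in> carrier G"
  shows "conv G (conv G f g) h x = conv G f (conv G g h) x"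
proof -
  have "conv G (conv G f g) h x = tot (\<lambda>t. h (inv t \<otimes> x) * conv G f g t)"
    by (simp add: conv_eq_tot[of "conv G f g"] mult.commute)
  also have "\<dots> = tot (\<lambda>y. f y * tot (\<lambda>t. h (inv (y \<otimes> t) \<otimes> x) * g t))"
    by (rule tot_conv_weighted[OF assms(1,2)])
  also have "\<dots> = tot (\<lambda>y. f y * conv G g h (inv y \<otimes> x))"
  proof (rule tot_cong)
    fix y assume y: "y \<in> carrier G"
    have "tot (\<lambda>t. h (inv (y \<otimes> t) \<otimes> x) * g t) = conv G g h (inv y \<otimes> x)"
      unfolding conv_eq_tot
      by (rule tot_cong) (use x y in \<open>simp add: inv_mult_group m_assoc mult.commute\<close>)
    then show "f y * tot (\<lambda>t. h (inv (y \<otimes> t) \<otimes> x) * g t) = f y * conv G g h (inv y \<otimes> x)" by simp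
  qed
  finally show ?thesis by (simp add: conv_eq_tot[of f])
qed

lemma conv_cong:
  assumes "\<And>x. x \<in> carrier G \<Longrightarrow> f x = f' x" "\<And>x. x \<in> carrier G \<Longrightarrow> g x = g' x" "x \<in> carrier G"
  shows "conv G f g x = conv G f' g' x"
  unfolding conv_eq_tot by (rule tot_cong) (use assms in auto)

lemma conv_one_left:
  assumes "x \<in> carrier G" shows "conv G (\<lambda>x. if x = \<one> then 1 else 0) g x = g x"
proof -
  have "conv G (\<lambda>x. if x = \<one> then 1 else 0) g x = (\<Sum>y\<in>{\<one>}. (if y = \<one> then 1 else 0) * g (inv y \<otimes> x))"
    by (rule conv_eq_sum) auto
  then show ?thesis using assms by simp
qed

lemma fs_conv_power: "fs k \<Longrightarrow> fs (conv_power G k m)"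
proof (induction m)
  case 0
  show ?case by (simp add: fs_def)
qed (simp add: fs_conv)

lemma conv_power_nonneg:
  assumes "\<And>x. x \<in> carrier G \<Longrightarrow> 0 \<le> k x"
  shows "x \<in> carrier G \<Longrightarrow> 0 \<le> conv_power G k m x"
  by (induction m arbitrary: x) (use assms in \<open>auto intro!: conv_nonneg\<close>)

lemma tot_conv_power: assumes "fs k" "tot k = 1" shows "tot (conv_power G k m) = 1"
proof (induction m)
  case 0
  have "tot (\<lambda>x. if x = \<one> then 1 else 0) = (\<Sum>x\<in>{\<one>}. if x = \<one> then 1 else 0)"
    by (rule tot_eq_sum) auto
  then show ?case by simp
next
  case (Suc m)
  then show ?case using assms by (simp add: tot_conv fs_conv_power)
qed

lemma conv_power_add:
  assumes "fs k"
  shows "x \<in> carrier G \<Longrightarrow> conv_power G k (m + n) x = conv G (conv_power G k m) (conv_power G k n) x"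
proof (induction m arbitrary: x)
  case 0
  then show ?case by (simp add: conv_one_left)
next
  case (Suc m)
  have "conv_power G k (Suc m + n) x = conv G k (conv G (conv_power G k m) (conv_power G k n)) x"
    unfolding add_Suc conv_power.simps by (rule conv_cong) (use Suc in auto)
  then show ?case using conv_assoc[of k "conv_power G k m" "conv_power G k n" x] Suc.prems assms
    by (simp add: fs_conv_power)
qed

text \<open>Translating the summation variable puts the shift on \<open>f\<close> and leaves the
  right factor alone, which is why a difference survives further convolution on the right.\<close>

lemma diff_op_conv:
  assumes "fs f" "h \<in> carrier G" "x \<in> carrier G"
  shows "diff_op G h (conv G f g) x = conv G (diff_op G h f) g x"
proof -
  have "conv G f g (inv h \<otimes> x) = tot (\<lambda>y. f (inv h \<otimes> y) * g (inv (inv h \<otimes> y) \<otimes> (inv h \<otimes> x)))"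
    unfolding conv_eq_tot using tot_left[of "inv h" "\<lambda>y. f y * g (inv y \<otimes> (inv h \<otimes> x))"] assms by simp
  also have "\<dots> = tot (\<lambda>y. f (inv h \<otimes> y) * g (inv y \<otimes> x))"
  proof (rule tot_cong)
    fix y assume y: "y \<in> carrier G"
    have "inv (inv h \<otimes> y) \<otimes> (inv h \<otimes> x) = inv y \<otimes> (h \<otimes> (inv h \<otimes> x))"
      using assms y by (simp add: inv_mult_group m_assoc)
    also have "\<dots> = inv y \<otimes> x" using assms y by (simp add: m_assoc[symmetric])
    finally show "f (inv h \<otimes> y) * g (inv (inv h \<otimes> y) \<otimes> (inv h \<otimes> x)) = f (inv h \<otimes> y) * g (inv y \<otimes> x)"
      by simp
  qed
  finally have "conv G f g (inv h \<otimes> x) - conv G f g x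
      = tot (\<lambda>y. f (inv h \<otimes> y) * g (inv y \<otimes> x)) - tot (\<lambda>y. f y * g (inv y \<otimes> x))"
    by (simp add: conv_eq_tot[of f g x])
  also have "\<dots> = tot (\<lambda>y. f (inv h \<otimes> y) * g (inv y \<otimes> x) - f y * g (inv y \<otimes> x))"
    by (rule tot_diff[symmetric]) (use assms in \<open>auto intro!: fs_intros\<close>)
  finally show ?thesis by (simp add: diff_op_def conv_eq_tot left_diff_distrib)
qed

lemma fs_diff_op: "h \<in> carrier G \<Longrightarrow> fs f \<Longrightarrow> fs (diff_op G h f)"
  using fs_diff[OF fs_left[of "inv h" f], of f] by (simp add: diff_op_def[abs_def])

subsection \<open>Word length\<close>

abbreviation rho :: "'a \<Rightarrow> real" where "rho g \<equiv> real (word_length G W g)"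

lemma foldr_mult_append:
  assumes "set us \<subseteq> carrier G" "set ws \<subseteq> carrier G"
  shows "foldr (\<otimes>) (us @ ws) \<one> = foldr (\<otimes>) us \<one> \<otimes> foldr (\<otimes>) ws \<one>"
    and "foldr (\<otimes>) us \<one> \<in> carrier G"
proof -
  have c: "set vs \<subseteq> carrier G \<Longrightarrow> foldr (\<otimes>) vs \<one> \<in> carrier G" for vs
    by (induction vs) auto
  show "foldr (\<otimes>) us \<one> \<in> carrier G" using c assms by simp
  show "foldr (\<otimes>) (us @ ws) \<one> = foldr (\<otimes>) us \<one> \<otimes> foldr (\<otimes>) ws \<one>"
    using assms by (induction us) (auto simp: c m_assoc)
qed

lemma W_subset: "W \<subseteq> carrier G" using W_carrier by auto

lemma word_exists:
  assumes "g \<in> carrier G"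
  shows "\<exists>ws. set ws \<subseteq> W \<and> foldr (\<otimes>) ws \<one> = g"
proof -
  have "g \<in> generate G W" using assms generate_W by simp
  then show ?thesis
  proof (induction rule: generate.induct)
    case one
    then show ?case by (intro exI[of _ "[]"]) auto
  next
    case (incl h)
    then show ?case by (intro exI[of _ "[h]"]) (auto simp: W_carrier)
  next
    case (inv h)
    then show ?case by (intro exI[of _ "[inv h]"]) (auto simp: W_carrier inv_W)
  next
    case (eng h1 h2)
    then obtain us ws where "set us \<subseteq> W" "foldr (\<otimes>) us \<one> = h1" "set ws \<subseteq> W" "foldr (\<otimes>) ws \<one> = h2"
      by auto
    then show ?case using foldr_mult_append[of us ws] W_subset by (intro exI[of _ "us @ ws"]) auto
  qed
qed

lemma geodesic_word:
  assumes "g \<in> carrier G"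
  shows "\<exists>ws. length ws = word_length G W g \<and> set ws \<subseteq> W \<and> foldr (\<otimes>) ws \<one> = g"
proof -
  obtain ws where "set ws \<subseteq> W" "foldr (\<otimes>) ws \<one> = g" using word_exists[OF assms] by auto
  then show ?thesis unfolding word_length_def
    by (intro LeastI[of "\<lambda>n. \<exists>ws. length ws = n \<and> set ws \<subseteq> W \<and> foldr (\<otimes>) ws \<one> = g" "length ws"]) auto
qed

lemma word_length_le: "set ws \<subseteq> W \<Longrightarrow> word_length G W (foldr (\<otimes>) ws \<one>) \<le> length ws"
  unfolding word_length_def by (rule Least_le) auto

lemma word_length_one: "word_length G W \<one> = 0"
  using word_length_le[of "[]"] by simp

lemma word_length_W: "w \<in> W \<Longrightarrow> word_length G W w \<le> 1"
  using word_length_le[of "[w]"] W_carrier by simp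

lemma word_length_mult:
  assumes "g \<in> carrier G" "h \<in> carrier G"
  shows "word_length G W (g \<otimes> h) \<le> word_length G W g + word_length G W h"
proof -
  obtain us ws where uw: "length us = word_length G W g" "set us \<subseteq> W" "foldr (\<otimes>) us \<one> = g"
    "length ws = word_length G W h" "set ws \<subseteq> W" "foldr (\<otimes>) ws \<one> = h"
    using geodesic_word assms by metis
  then show ?thesis using word_length_le[of "us @ ws"] foldr_mult_append[of us ws] W_subset by auto
qed

lemma word_length_inv_le: 
  assumes "g \<in> carrier G" shows "word_length G W (inv g) \<le> word_length G W g"
proof -
  have *: "set ws \<subseteq> W \<Longrightarrow> word_length G W (inv (foldr (\<otimes>) ws \<one>)) \<le> length ws" for ws
  proof (induction ws)
    case Nil
    then show ?case by (simp add: word_length_one)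
  next
    case (Cons w ws)
    have c: "w \<in> carrier G" "foldr (\<otimes>) ws \<one> \<in> carrier G"
      using Cons.prems W_subset foldr_mult_append(2)[of ws ws] by auto
    have "word_length G W (inv (foldr (\<otimes>) (w # ws) \<one>))
        \<le> word_length G W (inv (foldr (\<otimes>) ws \<one>)) + word_length G W (inv w)"
      using c by (simp add: inv_mult_group word_length_mult)
    also have "\<dots> \<le> length ws + 1"
      using Cons by (intro add_mono Cons.IH word_length_W inv_W) auto
    finally show ?case by simp
  qed
  show ?thesis using geodesic_word[OF assms] * by metis
qed

lemma word_length_inv: "g \<in> carrier G \<Longrightarrow> word_length G W (inv g) = word_length G W g"
  using word_length_inv_le[of g] word_length_inv_le[of "inv g"] by simp

lemma word_length_mult_ge:
  assumes "g \<in> carrier G" "h \<in> carrier G"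
  shows "word_length G W h \<le> word_length G W g + word_length G W (g \<otimes> h)"
    and "word_length G W g \<le> word_length G W (g \<otimes> h) + word_length G W h"
proof -
  have "inv g \<otimes> (g \<otimes> h) = h" "g \<otimes> h \<otimes> inv h = g" using assms by (simp_all add: m_assoc[symmetric] inv_solve_right')
  then show "word_length G W h \<le> word_length G W g + word_length G W (g \<otimes> h)"
    "word_length G W g \<le> word_length G W (g \<otimes> h) + word_length G W h"
    using word_length_mult[of "inv g" "g \<otimes> h"] word_length_mult[of "g \<otimes> h" "inv h"] assms
    by (simp_all add: word_length_inv)
qed

text \<open>Induction along a geodesic word read from the left. The index counts the letters read
  and merely bounds the length of the prefix, so that no fact about prefixes of geodesics is
  required.\<close>

lemma word_length_induct [consumes 1, case_names one step]:
  assumes "g \<in> carrier G"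
    and "P \<one> 0"
    and "\<And>h w n. h \<in> carrier G \<Longrightarrow> word_length G W h \<le> n \<Longrightarrow> w \<in> W \<Longrightarrow> P h n \<Longrightarrow> P (h \<otimes> w) (Suc n)"
  shows "P g (word_length G W g)"
proof -
  have "set ws \<subseteq> W \<Longrightarrow> P (foldr (\<otimes>) ws \<one>) (length ws)" for ws
  proof (induction ws rule: rev_induct)
    case Nil
    then show ?case using assms by simp
  next
    case (snoc w ws)
    have "foldr (\<otimes>) (ws @ [w]) \<one> = foldr (\<otimes>) ws \<one> \<otimes> w" "foldr (\<otimes>) ws \<one> \<in> carrier G"
      using foldr_mult_append[of ws "[w]"] W_subset W_carrier[of w] snoc.prems by auto
    then show ?case using snoc assms(3)[of "foldr (\<otimes>) ws \<one>" "length ws" w] word_length_le[of ws] by auto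
  qed
  then show ?thesis using geodesic_word[OF assms(1)] by metis
qed

definition ball :: "nat \<Rightarrow> 'a set" where "ball n = {g \<in> carrier G. word_length G W g \<le> n}"

lemma ball_carrier: "ball n \<subseteq> carrier G" by (auto simp: ball_def)

lemma finite_ball: "finite (ball n)"
proof -
  have "ball n \<subseteq> (\<lambda>ws. foldr (\<otimes>) ws \<one>) ` {ws. set ws \<subseteq> W \<and> length ws \<le> n}"
  proof
    fix g assume g: "g \<in> ball n"
    then obtain ws where "length ws = word_length G W g" "set ws \<subseteq> W" "foldr (\<otimes>) ws \<one> = g"
      using geodesic_word[of g] by (auto simp: ball_def)
    then show "g \<in> (\<lambda>ws. foldr (\<otimes>) ws \<one>) ` {ws. set ws \<subseteq> W \<and> length ws \<le> n}"
      using g by (intro image_eqI[of _ _ ws]) (auto simp: ball_def)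
  qed
  then show ?thesis using finite_lists_length_le[OF fin_W, of n] finite_subset by blast
qed

lemma card_ball_pos: "0 < card (ball n)"
  using finite_ball[of n] by (auto simp: card_gt_0_iff ball_def word_length_one intro!: exI[of _ "\<one>"])

end

subsection \<open>Quasi-additive functions\<close>

text \<open>The defect of additivity is split into a fixed function \<open>c\<close> of the two
  elements and a scale \<open>E\<close> that varies with \<open>B\<close>. Constants derived below
  depend on \<open>c\<close> and on group elements alone, hence are uniform over all drifts.\<close>

definition quasi_additive ::
  "('a, 'b) monoid_scheme \<Rightarrow> ('a \<Rightarrow> 'a \<Rightarrow> real) \<Rightarrow> ('a \<Rightarrow> real) \<Rightarrow> real \<Rightarrow> bool" where
  "quasi_additive G c B E \<longleftrightarrow> 0 \<le> E \<and>
     (\<forall>y \<in> carrier G. \<forall>z \<in> carrier G. \<bar>B (y \<otimes>\<^bsub>G\<^esub> z) - B y - B z\<bar> \<le> c y z * E)"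

text \<open>The constant precedes \<open>B\<close> and \<open>E\<close>. For \<open>E = 0\<close>
  the condition says that every homomorphism to the reals vanishes at \<open>t\<close>; this is its
  quantitative form.\<close>

definition quasi_null :: "('a, 'b) monoid_scheme \<Rightarrow> ('a \<Rightarrow> 'a \<Rightarrow> real) \<Rightarrow> 'a \<Rightarrow> bool" where
  "quasi_null G c t \<longleftrightarrow> (\<exists>C. \<forall>B E. quasi_additive G c B E \<longrightarrow> \<bar>B t\<bar> \<le> C * E)"

context group
begin

lemma quasi_additiveD:
  "quasi_additive G c B E \<Longrightarrow> y \<in> carrier G \<Longrightarrow> z \<in> carrier G \<Longrightarrow>
    \<bar>B (y \<otimes> z) - B y - B z\<bar> \<le> c y z * E"
  by (simp add: quasi_additive_def)

lemma quasi_null_one: "quasi_null G c \<one>"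
  unfolding quasi_null_def
proof (intro exI allI impI)
  fix B :: "'a \<Rightarrow> real" and E
  assume "quasi_additive G c B E"
  then have "\<bar>B (\<one> \<otimes> \<one>) - B \<one> - B \<one>\<bar> \<le> c \<one> \<one> * E" by (rule quasi_additiveD) auto
  then show "\<bar>B \<one>\<bar> \<le> c \<one> \<one> * E" by simp
qed

lemma quasi_null_mult:
  assumes "x \<in> carrier G" "y \<in> carrier G" "quasi_null G c x" "quasi_null G c y"
  shows "quasi_null G c (x \<otimes> y)"
proof -
  obtain C1 C2 where C: "\<And>B E. quasi_additive G c B E \<Longrightarrow> \<bar>B x\<bar> \<le> C1 * E"
    "\<And>B E. quasi_additive G c B E \<Longrightarrow> \<bar>B y\<bar> \<le> C2 * E"
    using assms unfolding quasi_null_def by blast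
  show ?thesis unfolding quasi_null_def
  proof (intro exI allI impI)
    fix B :: "'a \<Rightarrow> real" and E
    assume q: "quasi_additive G c B E"
    have "\<bar>B (x \<otimes> y)\<bar> \<le> C1 * E + C2 * E + c x y * E"
      using C[OF q] quasi_additiveD[OF q assms(1,2)] by linarith
    then show "\<bar>B (x \<otimes> y)\<bar> \<le> (C1 + C2 + c x y) * E" by (simp add: algebra_simps)
  qed
qed

lemma quasi_additive_inv:
  assumes "x \<in> carrier G"
  shows "\<exists>C. \<forall>B E. quasi_additive G c B E \<longrightarrow> \<bar>B (inv x) + B x\<bar> \<le> C * E"
proof -
  obtain C1 where C1: "\<And>B E. quasi_additive G c B E \<Longrightarrow> \<bar>B \<one>\<bar> \<le> C1 * E"
    using quasi_null_one unfolding quasi_null_def by blast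
  show ?thesis
  proof (intro exI allI impI)
    fix B :: "'a \<Rightarrow> real" and E
    assume q: "quasi_additive G c B E"
    have "\<bar>B (inv x) + B x\<bar> \<le> C1 * E + c (inv x) x * E"
      using C1[OF q] quasi_additiveD[OF q, of "inv x" x] assms by (simp add: abs_le_iff)
    then show "\<bar>B (inv x) + B x\<bar> \<le> (C1 + c (inv x) x) * E" by (simp add: algebra_simps)
  qed
qed

lemma quasi_null_inv:
  assumes "x \<in> carrier G" "quasi_null G c x"
  shows "quasi_null G c (inv x)"
proof -
  obtain C1 C2 where C: "\<And>B E. quasi_additive G c B E \<Longrightarrow> \<bar>B x\<bar> \<le> C1 * E"
    "\<And>B E. quasi_additive G c B E \<Longrightarrow> \<bar>B (inv x) + B x\<bar> \<le> C2 * E"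
    using assms quasi_additive_inv[OF assms(1), of c] unfolding quasi_null_def by blast
  show ?thesis unfolding quasi_null_def
  proof (intro exI allI impI)
    fix B :: "'a \<Rightarrow> real" and E
    assume q: "quasi_additive G c B E"
    have "\<bar>B (inv x)\<bar> \<le> C1 * E + C2 * E" using C[OF q] by linarith
    then show "\<bar>B (inv x)\<bar> \<le> (C1 + C2) * E" by (simp add: algebra_simps)
  qed
qed

text \<open>The four contributions cancel in pairs, because \<open>B\<close> at an inverse is
  \<open>- B\<close> up to a multiple of \<open>E\<close>.\<close>

lemma quasi_null_commutator:
  assumes x: "x \<in> carrier G" and y: "y \<in> carrier G"
  shows "quasi_null G c (x \<otimes> y \<otimes> inv x \<otimes> inv y)"
proof -
  obtain C1 C2 where C: "\<And>B E. quasi_additive G c B E \<Longrightarrow> \<bar>B (inv x) + B x\<bar> \<le> C1 * E"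
    "\<And>B E. quasi_additive G c B E \<Longrightarrow> \<bar>B (inv y) + B y\<bar> \<le> C2 * E"
    using quasi_additive_inv[OF x, of c] quasi_additive_inv[OF y, of c] by blast
  show ?thesis unfolding quasi_null_def
  proof (intro exI allI impI)
    fix B :: "'a \<Rightarrow> real" and E
    assume q: "quasi_additive G c B E"
    note d = quasi_additiveD[OF q]
    have "\<bar>B (x \<otimes> y \<otimes> inv x \<otimes> inv y)\<bar>
        \<le> C1 * E + C2 * E + c x y * E + c (x \<otimes> y) (inv x) * E + c (x \<otimes> y \<otimes> inv x) (inv y) * E"
      using C[OF q] d[of x y] d[of "x \<otimes> y" "inv x"] d[of "x \<otimes> y \<otimes> inv x" "inv y"] x y
      by (simp add: abs_le_iff)
    then show "\<bar>B (x \<otimes> y \<otimes> inv x \<otimes> inv y)\<bar>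
        \<le> (C1 + C2 + c x y + c (x \<otimes> y) (inv x) + c (x \<otimes> y \<otimes> inv x) (inv y)) * E"
      by (simp add: algebra_simps)
  qed
qed

lemma quasi_null_derived:
  assumes "t \<in> derived G (carrier G)"
  shows "quasi_null G c t"
proof -
  have sub: "derived_set G (carrier G) \<subseteq> carrier G" by auto
  have "t \<in> generate G (derived_set G (carrier G))" using assms by (simp add: derived_def)
  then show ?thesis
  proof (induction rule: generate.induct)
    case one
    then show ?case by (rule quasi_null_one)
  next
    case (incl h)
    then show ?case using quasi_null_commutator by auto
  next
    case (inv h)
    then show ?case using quasi_null_commutator by (auto intro!: quasi_null_inv)
  next
    case (eng h1 h2)
    then show ?case using generate_in_carrier[OF sub] quasi_null_mult by blast
  qed
qed

lemma quasi_additive_nat_pow: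
  assumes x: "x \<in> carrier G"
  shows "\<exists>C. \<forall>B E. quasi_additive G c B E \<longrightarrow> \<bar>B (x [^] (n::nat)) - real n * B x\<bar> \<le> C * E"
proof (induction n)
  case 0
  then show ?case using quasi_null_one[of c] by (simp add: quasi_null_def)
next
  case (Suc n)
  then obtain C where C: "\<And>B E. quasi_additive G c B E \<Longrightarrow> \<bar>B (x [^] n) - real n * B x\<bar> \<le> C * E"
    by blast
  show ?case
  proof (intro exI allI impI)
    fix B :: "'a \<Rightarrow> real" and E
    assume q: "quasi_additive G c B E"
    have "\<bar>B (x [^] Suc n) - real (Suc n) * B x\<bar> \<le> C * E + c (x [^] n) x * E"
      using C[OF q] quasi_additiveD[OF q, of "x [^] n" x] x by (simp add: abs_le_iff algebra_simps)
    then show "\<bar>B (x [^] Suc n) - real (Suc n) * B x\<bar> \<le> (C + c (x [^] n) x) * E"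
      by (simp add: algebra_simps)
  qed
qed

lemma quasi_additive_int_pow:
  assumes x: "x \<in> carrier G"
  shows "\<exists>C. \<forall>B E. quasi_additive G c B E \<longrightarrow> \<bar>B (x [^] (k::int)) - real_of_int k * B x\<bar> \<le> C * E"
proof (cases "k \<ge> 0")
  case True
  then obtain n where "k = int n" using nonneg_int_cases by blast
  then show ?thesis using quasi_additive_nat_pow[OF x, of c n] by (simp add: int_pow_int)
next
  case False
  then obtain n where k: "k = - int n" by (metis int_cases2 of_nat_0_le_iff)
  obtain C1 C2 where C: "\<And>B E. quasi_additive G c B E \<Longrightarrow> \<bar>B (x [^] n) - real n * B x\<bar> \<le> C1 * E"
    "\<And>B E. quasi_additive G c B E \<Longrightarrow> \<bar>B (inv (x [^] n)) + B (x [^] n)\<bar> \<le> C2 * E"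
    using quasi_additive_nat_pow[OF x, of c n] quasi_additive_inv[of "x [^] n" c] x
    by (meson nat_pow_closed)
  show ?thesis
  proof (intro exI allI impI)
    fix B :: "'a \<Rightarrow> real" and E
    assume q: "quasi_additive G c B E"
    have "\<bar>B (x [^] k) - real_of_int k * B x\<bar> \<le> C1 * E + C2 * E"
      using C[OF q] x by (simp add: k int_pow_neg_int abs_le_iff)
    then show "\<bar>B (x [^] k) - real_of_int k * B x\<bar> \<le> (C1 + C2) * E" by (simp add: algebra_simps)
  qed
qed

text \<open>A bound on \<open>n * B x\<close> is a bound on \<open>B x\<close>. This step takes care
  of the torsion of the abelianization.\<close>

lemma quasi_null_root:
  assumes x: "x \<in> carrier G" and n: "n > 0" and null: "quasi_null G c (x [^] (n::nat))"
  shows "quasi_null G c x"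
proof -
  obtain C1 C2 where C: "\<And>B E. quasi_additive G c B E \<Longrightarrow> \<bar>B (x [^] n) - real n * B x\<bar> \<le> C1 * E"
    "\<And>B E. quasi_additive G c B E \<Longrightarrow> \<bar>B (x [^] n)\<bar> \<le> C2 * E"
    using quasi_additive_nat_pow[OF x, of c n] null unfolding quasi_null_def by blast
  show ?thesis unfolding quasi_null_def
  proof (intro exI allI impI)
    fix B :: "'a \<Rightarrow> real" and E
    assume q: "quasi_additive G c B E"
    have "\<bar>B x\<bar> \<le> real n * \<bar>B x\<bar>" using mult_right_mono[of 1 "real n" "\<bar>B x\<bar>"] n by simp
    also have "\<dots> = \<bar>real n * B x\<bar>" by (simp add: abs_mult)
    also have "\<dots> \<le> C1 * E + C2 * E" using C[OF q] by linarith
    finally show "\<bar>B x\<bar> \<le> (C1 + C2) * E" by (simp add: algebra_simps)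
  qed
qed

subsection \<open>The projection onto the free part of the abelianization\<close>

lemma abelianization_comm_group: "comm_group (abelianization G)"
  unfolding abelianization_def by (rule derived_quot_is_comm_group)

lemma derived_normal: "derived G (carrier G) \<lhd> G"
  by (intro derived_is_normal) (rule normal_self)

lemma torsion_part_normal: "torsion_part (abelianization G) \<lhd> abelianization G"
proof -
  interpret A: comm_group "abelianization G" by (rule abelianization_comm_group)
  have "subgroup (torsion_part (abelianization G)) (abelianization G)"
  proof (rule A.subgroupI)
    show "torsion_part (abelianization G) \<subseteq> carrier (abelianization G)"
      by (auto simp: torsion_part_def)
    have "\<one>\<^bsub>abelianization G\<^esub> \<in> torsion_part (abelianization G)"
      by (auto simp: torsion_part_def intro!: exI[of _ 1])
    then show "torsion_part (abelianization G) \<noteq> {}" by auto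
  next
    fix a assume "a \<in> torsion_part (abelianization G)"
    then show "inv\<^bsub>abelianization G\<^esub> a \<in> torsion_part (abelianization G)"
      by (auto simp: torsion_part_def A.nat_pow_inv)
  next
    fix a b assume "a \<in> torsion_part (abelianization G)" "b \<in> torsion_part (abelianization G)"
    then obtain m n :: nat where mn: "a \<in> carrier (abelianization G)" "b \<in> carrier (abelianization G)"
      "m > 0" "n > 0" "a [^]\<^bsub>abelianization G\<^esub> m = \<one>\<^bsub>abelianization G\<^esub>"
      "b [^]\<^bsub>abelianization G\<^esub> n = \<one>\<^bsub>abelianization G\<^esub>"
      by (auto simp: torsion_part_def)
    have "a [^]\<^bsub>abelianization G\<^esub> (m * n) = \<one>\<^bsub>abelianization G\<^esub>"
      using mn by (metis A.nat_pow_one A.nat_pow_pow)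
    moreover have "b [^]\<^bsub>abelianization G\<^esub> (m * n) = \<one>\<^bsub>abelianization G\<^esub>"
      using mn by (metis A.nat_pow_one A.nat_pow_pow mult.commute)
    ultimately have "(a \<otimes>\<^bsub>abelianization G\<^esub> b) [^]\<^bsub>abelianization G\<^esub> (m * n) = \<one>\<^bsub>abelianization G\<^esub>"
      using mn by (simp add: A.nat_pow_distrib)
    then show "a \<otimes>\<^bsub>abelianization G\<^esub> b \<in> torsion_part (abelianization G)"
      using mn unfolding torsion_part_def by (auto intro!: exI[of _ "m * n"])
  qed
  then show ?thesis by (rule A.subgroup_imp_normal)
qed

text \<open>Injectivity of \<open>\<phi>\<close> puts the class of a kernel element into the torsion
  part, so that some power lies in the derived subgroup; surjectivity supplies elements dual to the
  coordinates. Nothing else about \<open>\<pi>\<close> is used later.\<close>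

lemma free_abelian_projection_facts:
  assumes "free_abelian_projection G d \<pi>"
  shows "\<And>x y j. x \<in> carrier G \<Longrightarrow> y \<in> carrier G \<Longrightarrow> j < d \<Longrightarrow> \<pi> (x \<otimes> y) j = \<pi> x j + \<pi> y j"
    and "\<exists>e. \<forall>i<d. e i \<in> carrier G \<and> (\<forall>j<d. \<pi> (e i) j = (if j = i then 1 else 0))"
    and "\<And>t. t \<in> carrier G \<Longrightarrow> (\<And>j. j < d \<Longrightarrow> \<pi> t j = 0) \<Longrightarrow>
      \<exists>n::nat. n > 0 \<and> t [^] n \<in> derived G (carrier G)"
proof -
  let ?A = "abelianization G" let ?D = "derived G (carrier G)" let ?T = "torsion_part ?A"
  let ?q = "\<lambda>g. ?T #>\<^bsub>?A\<^esub> (?D #> g)"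
  interpret A: comm_group ?A by (rule abelianization_comm_group)
  interpret D: normal ?D G by (rule derived_normal)
  interpret T: normal ?T ?A by (rule torsion_part_normal)
  obtain \<phi> where \<phi>: "\<phi> \<in> iso (?A Mod ?T) (int_lattice d)"
    and \<pi>: "\<And>g. g \<in> carrier G \<Longrightarrow> \<pi> g = \<phi> (?q g)"
    using assms unfolding free_abelian_projection_def by blast
  have q1: "(\<lambda>g. ?D #> g) \<in> hom G ?A"
    using D.r_coset_hom_Mod by (simp add: abelianization_def)
  have q2: "(\<lambda>a. ?T #>\<^bsub>?A\<^esub> a) \<in> hom ?A (?A Mod ?T)" by (rule T.r_coset_hom_Mod)
  have q: "?q \<in> hom G (?A Mod ?T)"
    using Group.hom_compose[OF q1 q2] by (simp add: comp_def)
  have \<phi>h: "\<phi> \<in> hom (?A Mod ?T) (int_lattice d)" using \<phi> by (simp add: iso_def)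
  have h: "(\<lambda>g. \<phi> (?q g)) \<in> hom G (int_lattice d)"
    using Group.hom_compose[OF q \<phi>h] by (simp add: comp_def)
  show "\<pi> (x \<otimes> y) j = \<pi> x j + \<pi> y j" if "x \<in> carrier G" "y \<in> carrier G" "j < d" for x y j
    using hom_mult[OF h that(1,2)] that by (simp add: \<pi>)
  have bij: "bij_betw \<phi> (carrier (?A Mod ?T)) (carrier (int_lattice d))"
    using \<phi> by (simp add: iso_def)
  have surj: "\<exists>g \<in> carrier G. ?q g = X" if "X \<in> carrier (?A Mod ?T)" for X
    using that by (auto simp: FactGroup_def RCOSETS_def abelianization_def)
  show "\<exists>e. \<forall>i<d. e i \<in> carrier G \<and> (\<forall>j<d. \<pi> (e i) j = (if j = i then 1 else 0))"
  proof -
    have "\<exists>g \<in> carrier G. \<forall>j<d. \<pi> g j = (if j = i then 1 else 0)" for i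
    proof -
      have "(\<lambda>j\<in>{..<d}. if j = i then 1 else 0) \<in> carrier (int_lattice d)" by auto
      then obtain X where X: "X \<in> carrier (?A Mod ?T)" "\<phi> X = (\<lambda>j\<in>{..<d}. if j = i then 1 else 0)"
        using bij by (metis (no_types, lifting) bij_betw_iff_bijections)
      then obtain g where g: "g \<in> carrier G" "?q g = X" using surj by blast
      then show ?thesis using X by (intro bexI[of _ g]) (auto simp: \<pi>)
    qed
    then show ?thesis by metis
  qed
  show "\<exists>n::nat. n > 0 \<and> t [^] n \<in> ?D" if t: "t \<in> carrier G" and 0: "\<And>j. j < d \<Longrightarrow> \<pi> t j = 0" for t
  proof -
    have Dt: "?D #> t \<in> carrier ?A" using hom_in_carrier[OF q1 t] .
    \<comment> \<open>Elements of the product group have a fixed default value off the index set, so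
      after this membership the coordinates below \<open>d\<close> decide equality.\<close>
    have "\<phi> (?q t) \<in> carrier (int_lattice d)" using hom_in_carrier[OF h t] .
    then have "\<phi> (?q t) = \<one>\<^bsub>int_lattice d\<^esub>"
      using 0 t by (intro ext) (auto simp: \<pi> PiE_def extensional_def restrict_def)
    also have "\<dots> = \<phi> \<one>\<^bsub>?A Mod ?T\<^esub>"
      by (rule hom_one[OF \<phi>h, symmetric]) (auto intro: T.factorgroup_is_group)
    finally have "?q t = \<one>\<^bsub>?A Mod ?T\<^esub>"
      using bij hom_in_carrier[OF q t] T.factorgroup_is_group
      by (metis bij_betw_imp_inj_on group.is_monoid inj_onD monoid.one_closed)
    then have "?T #>\<^bsub>?A\<^esub> (?D #> t) = ?T" by (simp add: FactGroup_def)
    then have "?D #> t \<in> ?T" using A.rcos_self[OF Dt T.subgroup_axioms] by simp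
    then obtain n :: nat where n: "n > 0" "(?D #> t) [^]\<^bsub>?A\<^esub> n = \<one>\<^bsub>?A\<^esub>"
      unfolding torsion_part_def by blast
    have "(?D #> t) [^]\<^bsub>?A\<^esub> n = ?D #> (t [^] n)"
      using D.FactGroup_pow[OF t, of n] by (simp add: abelianization_def)
    then have "?D #> (t [^] n) = ?D" using n by (simp add: abelianization_def FactGroup_def)
    then have "t [^] n \<in> ?D" using rcos_self[of "t [^] n" ?D] t D.subgroup_axioms by simp
    then show ?thesis using n by blast
  qed
qed

text \<open>The elements at which the estimate holds form a subgroup; it contains the \<open>e j\<close> and, by
  \<open>quasi_null_derived\<close> and \<open>quasi_null_root\<close>, the kernel of \<open>\<pi>\<close>.\<close>

lemma quasi_additive_linear:
  assumes \<pi>: "free_abelian_projection G d \<pi>"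
    and e: "\<And>i. i < d \<Longrightarrow> e i \<in> carrier G"
      "\<And>i j. i < d \<Longrightarrow> j < d \<Longrightarrow> \<pi> (e i) j = (if j = i then 1 else 0)"
    and g: "g \<in> carrier G"
  shows "\<exists>C. \<forall>B E. quasi_additive G c B E \<longrightarrow>
    \<bar>B g - (\<Sum>j<d. real_of_int (\<pi> g j) * B (e j))\<bar> \<le> C * E"
proof -
  note hom = free_abelian_projection_facts(1)[OF \<pi>] and ker = free_abelian_projection_facts(3)[OF \<pi>]
  define L where "L = (\<lambda>B g. \<Sum>j<d. real_of_int (\<pi> g j) * (B (e j) :: real))"
  define P where "P = (\<lambda>g. \<exists>C. \<forall>B E. quasi_additive G c B E \<longrightarrow> \<bar>B g - L B g\<bar> \<le> C * E)"
  have L_mult: "L B (x \<otimes> y) = L B x + L B y" if "x \<in> carrier G" "y \<in> carrier G" for B x y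
    using that unfolding L_def sum.distrib[symmetric] by (intro sum.cong) (simp_all add: hom distrib_right)
  have P_mult: "P (x \<otimes> y)" if x: "x \<in> carrier G" "P x" and y: "y \<in> carrier G" "P y" for x y
  proof -
    obtain C1 C2 where C: "\<And>B E. quasi_additive G c B E \<Longrightarrow> \<bar>B x - L B x\<bar> \<le> C1 * E"
      "\<And>B E. quasi_additive G c B E \<Longrightarrow> \<bar>B y - L B y\<bar> \<le> C2 * E"
      using x y unfolding P_def by blast
    show ?thesis unfolding P_def
    proof (intro exI allI impI)
      fix B :: "'a \<Rightarrow> real" and E
      assume q: "quasi_additive G c B E"
      have "\<bar>B (x \<otimes> y) - L B (x \<otimes> y)\<bar> \<le> C1 * E + C2 * E + c x y * E"
        using C[OF q] quasi_additiveD[OF q x(1) y(1)] L_mult[OF x(1) y(1), of B]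
        by (simp add: abs_le_iff)
      then show "\<bar>B (x \<otimes> y) - L B (x \<otimes> y)\<bar> \<le> (C1 + C2 + c x y) * E" by (simp add: algebra_simps)
    qed
  qed
  have \<pi>1: "\<pi> \<one> j = 0" if "j < d" for j using hom[of \<one> \<one> j] that by simp
  have \<pi>_inv: "\<pi> (inv x) j = - \<pi> x j" if "x \<in> carrier G" "j < d" for x j
    using hom[of x "inv x" j] that \<pi>1 by simp
  have \<pi>_pow: "\<pi> (x [^] (n::nat)) j = int n * \<pi> x j" if "x \<in> carrier G" "j < d" for x j n
    using that by (induction n) (auto simp: \<pi>1 hom algebra_simps)
  have \<pi>_int_pow: "\<pi> (x [^] (k::int)) j = k * \<pi> x j" if "x \<in> carrier G" "j < d" for x j k
  proof (cases k rule: int_cases2)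
    case (nonneg n)
    then show ?thesis using that by (simp only: int_pow_int \<pi>_pow)
  next
    case (nonpos n)
    then show ?thesis using that by (simp only: int_pow_neg_int \<pi>_inv \<pi>_pow nat_pow_closed)
  qed
  have P_ker: "P t" if t: "t \<in> carrier G" "\<And>j. j < d \<Longrightarrow> \<pi> t j = 0" for t
  proof -
    obtain n :: nat where "n > 0" "t [^] n \<in> derived G (carrier G)" using ker[OF t] by blast
    then have "quasi_null G c t" using quasi_null_root quasi_null_derived t by blast
    then show ?thesis using t by (simp add: P_def L_def quasi_null_def)
  qed
  have P_e: "P (e i [^] (k::int))" if i: "i < d" for i k
  proof -
    have "L B (e i [^] k) = real_of_int k * B (e i)" for B
    proof -
      have "L B (e i [^] k) = (\<Sum>j<d. if j = i then real_of_int k * B (e j) else 0)"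
        unfolding L_def by (rule sum.cong) (use i e in \<open>auto simp: \<pi>_int_pow\<close>)
      then show ?thesis using i by simp
    qed
    then show ?thesis using quasi_additive_int_pow[OF e(1)[OF i], of c k] by (simp add: P_def)
  qed
  \<comment> \<open>Coordinate by coordinate: a power of \<open>e k\<close> corrects coordinate
    \<open>k\<close>, leaves the earlier ones alone and satisfies \<open>P\<close>.\<close>
  have "\<exists>p. p \<in> carrier G \<and> P p \<and> (\<forall>j<k. \<pi> p j = \<pi> g j)" if "k \<le> d" for k
    using that
  proof (induction k)
    case 0
    then show ?case using P_ker[of \<one>] \<pi>1 by auto
  next
    case (Suc k)
    then obtain p where p: "p \<in> carrier G" "P p" "\<forall>j<k. \<pi> p j = \<pi> g j" by auto
    let ?r = "e k [^] (\<pi> g k - \<pi> p k)"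
    have k: "k < d" using Suc by simp
    have r: "?r \<in> carrier G" using e(1)[OF k] by simp
    have "\<pi> (p \<otimes> ?r) j = \<pi> g j" if "j < Suc k" for j
    proof -
      have "j < d" using that k by simp
      then show ?thesis
        using that p r e k by (auto simp: hom \<pi>_int_pow less_Suc_eq)
    qed
    then show ?case using p r P_mult[OF p(1,2) r P_e[OF k]] by blast
  qed
  then obtain p where p: "p \<in> carrier G" "P p" "\<And>j. j < d \<Longrightarrow> \<pi> p j = \<pi> g j" by blast
  \<comment> \<open>All coordinates of \<open>g\<close> and \<open>p\<close> agree, so
    \<open>g\<close> differs from \<open>p\<close> by an element of the kernel.\<close>
  have "P (g \<otimes> inv p)" by (rule P_ker) (use g p in \<open>auto simp: hom \<pi>_inv\<close>)
  then have "P (g \<otimes> inv p \<otimes> p)" using p g P_mult[of "g \<otimes> inv p" p] by simp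
  then have "P g" using p g by (simp add: m_assoc)
  then show ?thesis by (simp add: P_def L_def)
qed

text \<open>The case \<open>E = 0\<close> of the preceding estimate: the error \<open>C * E\<close>
  vanishes and linearity becomes exact.\<close>

lemma additive_linear:
  assumes \<pi>: "free_abelian_projection G d \<pi>"
    and B: "\<And>x y. x \<in> carrier G \<Longrightarrow> y \<in> carrier G \<Longrightarrow> B (x \<otimes> y) = B x + (B y :: real)"
  shows "\<exists>b. \<forall>g \<in> carrier G. B g = (\<Sum>j<d. real_of_int (\<pi> g j) * b j)"
proof -
  obtain e where e: "\<And>i. i < d \<Longrightarrow> e i \<in> carrier G"
      "\<And>i j. i < d \<Longrightarrow> j < d \<Longrightarrow> \<pi> (e i) j = (if j = i then 1 else 0)"
    using free_abelian_projection_facts(2)[OF \<pi>] by blast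
  have q: "quasi_additive G (\<lambda>_ _. 0) B 0" using B by (simp add: quasi_additive_def)
  have "B g = (\<Sum>j<d. real_of_int (\<pi> g j) * B (e j))" if g: "g \<in> carrier G" for g
  proof -
    obtain C where "\<bar>B g - (\<Sum>j<d. real_of_int (\<pi> g j) * B (e j))\<bar> \<le> C * 0"
      using quasi_additive_linear[OF \<pi> e g, of "\<lambda>_ _. 0"] q by blast
    then show ?thesis by simp
  qed
  then show ?thesis by (intro exI[of _ "\<lambda>j. B (e j)"] ballI)
qed

text \<open>A coordinate of \<open>\<pi>'\<close> is a homomorphism to the reals, hence a linear
  combination of the coordinates of \<open>\<pi>\<close>. This allows constants to be drawn from one
  projection before the projection of the family is given.\<close>

lemma centered_transfer:
  assumes \<pi>: "free_abelian_projection G d \<pi>" and \<pi>': "free_abelian_projection G d' \<pi>'"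
    and K: "finitely_supported_on G K" and c: "centered G d \<pi> K"
  shows "centered G d' \<pi>' K"
  unfolding centered_def
proof (intro allI impI)
  fix j assume j: "j < d'"
  have fin: "finite (set_pmf K)" "set_pmf K \<subseteq> carrier G" 
    using K by (auto simp: finitely_supported_on_def)
  have s: "(\<Sum>\<^sub>\<infinity>g \<in> carrier G. pmf K g * f g) = (\<Sum>g\<in>set_pmf K. pmf K g * f g)" for f :: "'a \<Rightarrow> real"
  proof -
    have "(\<Sum>\<^sub>\<infinity>g \<in> carrier G. pmf K g * f g) = (\<Sum>\<^sub>\<infinity>g \<in> set_pmf K. pmf K g * f g)"
      by (rule infsum_cong_neutral) (use fin in \<open>auto simp: set_pmf_iff\<close>)
    then show ?thesis using fin by simp
  qed
  obtain b where b: "\<And>g. g \<in> carrier G \<Longrightarrow> real_of_int (\<pi>' g j) = (\<Sum>i<d. real_of_int (\<pi> g i) * b i)"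
    using additive_linear[OF \<pi>, of "\<lambda>g. real_of_int (\<pi>' g j)"]
      free_abelian_projection_facts(1)[OF \<pi>' _ _ j] by (metis of_int_add)
  have "(\<Sum>g\<in>set_pmf K. pmf K g * real_of_int (\<pi>' g j))
      = (\<Sum>g\<in>set_pmf K. \<Sum>i<d. b i * (pmf K g * real_of_int (\<pi> g i)))"
    by (rule sum.cong) (use fin b in \<open>auto simp: sum_distrib_left algebra_simps\<close>)
  also have "\<dots> = (\<Sum>i<d. b i * (\<Sum>g\<in>set_pmf K. pmf K g * real_of_int (\<pi> g i)))"
    by (subst sum.swap) (simp add: sum_distrib_left)
  also have "\<dots> = 0"
    using c by (intro sum.neutral) (auto simp: centered_def s)
  finally show "(\<Sum>\<^sub>\<infinity>g \<in> carrier G. pmf K g * real_of_int (\<pi>' g j)) = 0" by (simp add: s)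
qed

end

context word_metric
begin

subsection \<open>The one-step energy inequality\<close>

definition grad2 :: "('a \<Rightarrow> real) \<Rightarrow> 'a \<Rightarrow> real" where
  "grad2 u x = (\<Sum>w\<in>W. (diff_op G w u x)\<^sup>2)"

definition Phi :: "real \<Rightarrow> 'a \<Rightarrow> real" where
  "Phi \<theta> x = exp (\<theta> * rho x)"

lemma Phi_nonneg: "0 \<le> Phi \<theta> x" by (simp add: Phi_def)

lemma grad2_nonneg: "0 \<le> grad2 u x" by (simp add: grad2_def sum_nonneg)

lemma fs_grad2: "fs u \<Longrightarrow> fs (grad2 u)"
  unfolding grad2_def[abs_def] by (intro fs_sum fs_power2 fs_diff_op W_carrier)

lemma card_W_pos: "0 < card W"
  using fin_W one_gen by (auto simp: card_gt_0_iff)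

text \<open>The missing term is the variance of \<open>u (inv y \<otimes> x)\<close> under
  \<open>k\<close>. Its atoms at \<open>\<one>\<close> and \<open>w\<close> have mass at least
  \<open>\<eta>\<close> each, so \<open>(s - t)\<^sup>2 \<le> 2 * s\<^sup>2 + 2 * t\<^sup>2\<close>
  bounds \<open>\<eta> / 2\<close> times a squared difference by the variance; adding over
  \<open>W\<close> costs the factor \<open>card W\<close>.\<close>

lemma variance_bound:
  assumes k: "fs k" "\<And>x. x \<in> carrier G \<Longrightarrow> 0 \<le> k x" "tot k = 1"
    and \<eta>: "0 < \<eta>" "\<And>w. w \<in> W \<Longrightarrow> \<eta> \<le> k w"
    and x: "x \<in> carrier G"
  shows "(conv G k u x)\<^sup>2 + \<eta> / (2 * real (card W)) * grad2 u x \<le> conv G k (\<lambda>x. (u x)\<^sup>2) x"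
proof -
  define m where "m = conv G k u x"
  define f where "f = (\<lambda>y. u (inv y \<otimes> x))"
  have m: "tot (\<lambda>y. k y * f y) = m" by (simp add: m_def conv_eq_tot f_def)
  have "tot (\<lambda>y. k y * (f y - m)\<^sup>2) = tot (\<lambda>y. (k y * (f y)\<^sup>2 - (2 * m) * (k y * f y)) + m\<^sup>2 * k y)"
    by (rule tot_cong) (simp add: power2_eq_square algebra_simps)
  also have "\<dots> = tot (\<lambda>y. k y * (f y)\<^sup>2) - 2 * m * m + m\<^sup>2"
    using k by (simp add: tot_add tot_diff tot_cmult fs_diff fs_mult_left fs_mult_right m)
  finally have var: "tot (\<lambda>y. k y * (f y - m)\<^sup>2) = conv G k (\<lambda>x. (u x)\<^sup>2) x - m\<^sup>2"
    by (simp add: conv_eq_tot f_def power2_eq_square)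
  have each: "\<eta> / 2 * (diff_op G w u x)\<^sup>2 \<le> tot (\<lambda>y. k y * (f y - m)\<^sup>2)" if w: "w \<in> W" for w
  proof (cases "w = \<one>")
    case True
    then have "diff_op G w u x = 0" using x by (simp add: diff_op_def)
    then show ?thesis using k by (simp add: tot_nonneg)
  next
    case False
    let ?g = "\<lambda>y. if y = \<one> \<or> y = w then \<eta> * (f y - m)\<^sup>2 else 0"
    have wG: "w \<in> carrier G" by (rule W_carrier[OF w])
    have "\<eta> / 2 * (diff_op G w u x)\<^sup>2 = \<eta> / 2 * ((f w - m) - (f \<one> - m))\<^sup>2"
      using x by (simp add: diff_op_def f_def)
    also have "\<dots> \<le> \<eta> / 2 * (2 * (f w - m)\<^sup>2 + 2 * (f \<one> - m)\<^sup>2)"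
      using \<eta> sum_squares_bound[of "f w - m" "- (f \<one> - m)"]
      by (intro mult_left_mono) (auto simp: power2_eq_square algebra_simps)
    also have "\<dots> = (\<Sum>y\<in>{\<one>, w}. ?g y)" using False by (simp add: algebra_simps)
    also have "\<dots> = tot ?g" by (rule tot_eq_sum[symmetric]) (use wG in auto)
    also have "\<dots> \<le> tot (\<lambda>y. k y * (f y - m)\<^sup>2)"
    proof (rule tot_mono)
      show "fs ?g" unfolding fs_def by (rule finite_subset[of _ "{\<one>, w}"]) auto
      show "fs (\<lambda>y. k y * (f y - m)\<^sup>2)" using k by (simp add: fs_mult_left)
      show "?g y \<le> k y * (f y - m)\<^sup>2" if "y \<in> carrier G" for y
        using that k(2) \<eta>(2)[OF one_gen] \<eta>(2)[OF w] by (auto intro: mult_right_mono)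
    qed
    finally show ?thesis .
  qed
  have "\<eta> / 2 * grad2 u x = (\<Sum>w\<in>W. \<eta> / 2 * (diff_op G w u x)\<^sup>2)"
    by (simp add: grad2_def sum_distrib_left)
  also have "\<dots> \<le> real (card W) * tot (\<lambda>y. k y * (f y - m)\<^sup>2)"
    by (rule sum_bounded_above) (rule each)
  finally have "\<eta> / (2 * real (card W)) * grad2 u x \<le> tot (\<lambda>y. k y * (f y - m)\<^sup>2)"
    using card_W_pos by (simp add: field_simps)
  then show ?thesis unfolding m_def[symmetric] using var by linarith
qed

lemma Phi_mult_le:
  assumes "0 \<le> \<theta>" "y \<in> carrier G" "x \<in> carrier G"
  shows "Phi \<theta> (y \<otimes> x) \<le> Phi \<theta> y * Phi \<theta> x"
proof -
  have "\<theta> * rho (y \<otimes> x) \<le> \<theta> * (rho y + rho x)"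
    using word_length_mult[OF assms(2,3)] assms(1) by (intro mult_left_mono) auto
  then show ?thesis by (simp add: Phi_def exp_add[symmetric] algebra_simps)
qed

lemma abs_exp_diff_le: "\<bar>exp t - 1\<bar> \<le> \<bar>t\<bar> * exp \<bar>t\<bar>" for t :: real
proof (cases "t \<ge> 0")
  case True
  have "(1 - t) * exp t \<le> exp (- t) * exp t"
    using exp_ge_add_one_self[of "- t"] by (intro mult_right_mono) auto
  then show ?thesis using True by (simp add: exp_minus algebra_simps)
next
  case False
  have "1 - exp t \<le> - t" using exp_ge_add_one_self[of t] by linarith
  also have "\<dots> \<le> - t * exp (- t)" using False by (simp add: mult_le_cancel_left1)
  finally show ?thesis using False by simp
qed

text \<open>Left multiplication by \<open>y\<close> changes the length by at most
  \<open>rho y\<close>, hence the exponent by at most \<open>\<theta> * rho y\<close>.\<close>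

lemma Phi_diff_le:
  assumes "0 \<le> \<theta>" "y \<in> carrier G" "x \<in> carrier G"
  shows "\<bar>Phi \<theta> (y \<otimes> x) - Phi \<theta> x\<bar> \<le> \<theta> * (rho y * Phi \<theta> y) * Phi \<theta> x"
proof -
  define t where "t = \<theta> * (rho (y \<otimes> x) - rho x)"
  have "\<bar>rho (y \<otimes> x) - rho x\<bar> \<le> rho y"
    using word_length_mult[OF assms(2,3)] word_length_mult_ge(1)[OF assms(2,3)] by linarith
  then have t: "\<bar>t\<bar> \<le> \<theta> * rho y"
    using assms(1) by (simp add: t_def abs_mult mult_left_mono)
  have "Phi \<theta> (y \<otimes> x) = exp t * Phi \<theta> x"
    by (simp add: Phi_def t_def exp_add[symmetric] algebra_simps)
  then have "Phi \<theta> (y \<otimes> x) - Phi \<theta> x = (exp t - 1) * Phi \<theta> x" by (simp add: algebra_simps)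
  then have "\<bar>Phi \<theta> (y \<otimes> x) - Phi \<theta> x\<bar> = \<bar>exp t - 1\<bar> * Phi \<theta> x"
    by (simp add: abs_mult Phi_nonneg)
  also have "\<bar>exp t - 1\<bar> \<le> \<theta> * rho y * exp (\<theta> * rho y)"
    using abs_exp_diff_le[of t] t by (meson abs_ge_zero exp_le_cancel_iff mult_mono order_trans exp_ge_zero)
  finally show ?thesis using Phi_nonneg[of \<theta> x] by (simp add: Phi_def mult_right_mono algebra_simps)
qed

section \<open>Weighted first differences and the drift of the weight\<close>

definition grad1 :: "real \<Rightarrow> ('a \<Rightarrow> real) \<Rightarrow> real" where
  "grad1 \<theta> v = tot (\<lambda>x. Phi \<theta> x * (\<Sum>w\<in>W. \<bar>diff_op G w v x\<bar>))"

lemma grad1_nonneg: "0 \<le> grad1 \<theta> v"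
  unfolding grad1_def by (intro tot_nonneg mult_nonneg_nonneg sum_nonneg Phi_nonneg) auto

text \<open>Telescoping along a geodesic word of \<open>z\<close>: the new letter acts at
  \<open>inv h \<otimes> x\<close>, and translating back by the prefix \<open>h\<close> multiplies
  the weight by at most \<open>exp (\<theta> * real n)\<close>.\<close>

lemma Phi_diff_op_le:
  assumes \<theta>: "0 \<le> \<theta>" and v: "fs v" and z: "z \<in> carrier G"
  shows "tot (\<lambda>x. Phi \<theta> x * \<bar>diff_op G z v x\<bar>) \<le> rho z * Phi \<theta> z * grad1 \<theta> v"
proof -
  define P where "P = (\<lambda>z n. tot (\<lambda>x. Phi \<theta> x * \<bar>diff_op G z v x\<bar>)
    \<le> real n * exp (\<theta> * real n) * grad1 \<theta> v)"
  have W: "tot (\<lambda>x. Phi \<theta> x * \<bar>diff_op G w v x\<bar>) \<le> grad1 \<theta> v" if w: "w \<in> W" for w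
    unfolding grad1_def
  proof (rule tot_mono)
    fix x
    show "Phi \<theta> x * \<bar>diff_op G w v x\<bar> \<le> Phi \<theta> x * (\<Sum>w\<in>W. \<bar>diff_op G w v x\<bar>)"
      using fin_W w by (intro mult_left_mono Phi_nonneg member_le_sum) auto
  qed (use v w W_carrier in \<open>auto intro!: fs_mult_right fs_abs fs_sum fs_diff_op\<close>)
  have "P z (word_length G W z)"
    using z
  proof (rule word_length_induct[where P = P])
    have "tot (\<lambda>x. Phi \<theta> x * \<bar>diff_op G \<one> v x\<bar>) = tot (\<lambda>x. 0)"
      by (rule tot_cong) (simp add: diff_op_def)
    then show "P \<one> 0" by (simp add: P_def tot_zero)
  next
    fix h w n
    assume h: "h \<in> carrier G" and n: "word_length G W h \<le> n" and w: "w \<in> W" and IH: "P h n"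
    have wG: "w \<in> carrier G" using W_carrier[OF w] .
    have "tot (\<lambda>x. Phi \<theta> x * \<bar>diff_op G (h \<otimes> w) v x\<bar>)
        \<le> tot (\<lambda>x. Phi \<theta> x * \<bar>diff_op G w v (inv h \<otimes> x)\<bar> + Phi \<theta> x * \<bar>diff_op G h v x\<bar>)"
    proof (rule tot_mono)
      fix x assume x: "x \<in> carrier G"
      have "\<bar>diff_op G (h \<otimes> w) v x\<bar> \<le> \<bar>diff_op G w v (inv h \<otimes> x)\<bar> + \<bar>diff_op G h v x\<bar>"
        using h wG x by (simp add: diff_op_def inv_mult_group m_assoc)
      then show "Phi \<theta> x * \<bar>diff_op G (h \<otimes> w) v x\<bar>
          \<le> Phi \<theta> x * \<bar>diff_op G w v (inv h \<otimes> x)\<bar> + Phi \<theta> x * \<bar>diff_op G h v x\<bar>"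
        unfolding distrib_left[symmetric] by (intro mult_left_mono Phi_nonneg)
    qed (use v h wG in \<open>auto intro!: fs_mult_right fs_abs fs_add fs_diff_op fs_left\<close>)
    also have "\<dots> = tot (\<lambda>x. Phi \<theta> x * \<bar>diff_op G w v (inv h \<otimes> x)\<bar>)
        + tot (\<lambda>x. Phi \<theta> x * \<bar>diff_op G h v x\<bar>)"
      using v h wG by (intro tot_add) (auto intro!: fs_mult_right fs_abs fs_diff_op fs_left)
    also have "tot (\<lambda>x. Phi \<theta> x * \<bar>diff_op G w v (inv h \<otimes> x)\<bar>)
        = tot (\<lambda>x. Phi \<theta> (h \<otimes> x) * \<bar>diff_op G w v (inv h \<otimes> (h \<otimes> x))\<bar>)"
      using tot_left[OF h, of "\<lambda>x. Phi \<theta> x * \<bar>diff_op G w v (inv h \<otimes> x)\<bar>"] by simp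
    also have "\<dots> \<le> tot (\<lambda>x. exp (\<theta> * real n) * (Phi \<theta> x * \<bar>diff_op G w v x\<bar>))"
    proof (rule tot_mono)
      fix x assume x: "x \<in> carrier G"
      have "Phi \<theta> (h \<otimes> x) \<le> Phi \<theta> h * Phi \<theta> x" by (rule Phi_mult_le[OF \<theta> h x])
      also have "\<dots> \<le> exp (\<theta> * real n) * Phi \<theta> x"
        using n \<theta> by (intro mult_right_mono Phi_nonneg) (auto simp: Phi_def mult_left_mono)
      finally show "Phi \<theta> (h \<otimes> x) * \<bar>diff_op G w v (inv h \<otimes> (h \<otimes> x))\<bar>
          \<le> exp (\<theta> * real n) * (Phi \<theta> x * \<bar>diff_op G w v x\<bar>)"
        using h x by (simp add: m_assoc[symmetric] mult_right_mono mult.assoc[symmetric])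
    next
      have "fs (\<lambda>x. \<bar>diff_op G w v (inv h \<otimes> (h \<otimes> x))\<bar>)"
        using fs_left[OF h fs_left[OF inv_closed[OF h] fs_abs[OF fs_diff_op[OF wG v]]]] .
      then show "fs (\<lambda>x. Phi \<theta> (h \<otimes> x) * \<bar>diff_op G w v (inv h \<otimes> (h \<otimes> x))\<bar>)"
        by (rule fs_mult_right)
    qed (use v wG in \<open>auto intro!: fs_mult_right fs_abs fs_diff_op\<close>)
    also have "\<dots> \<le> exp (\<theta> * real n) * grad1 \<theta> v"
      unfolding tot_cmult by (intro mult_left_mono W w) auto
    finally have "tot (\<lambda>x. Phi \<theta> x * \<bar>diff_op G (h \<otimes> w) v x\<bar>)
        \<le> exp (\<theta> * real n) * grad1 \<theta> v + real n * exp (\<theta> * real n) * grad1 \<theta> v"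
      using IH by (simp add: P_def)
    also have "\<dots> = real (Suc n) * exp (\<theta> * real n) * grad1 \<theta> v" by (simp add: algebra_simps)
    also have "\<dots> \<le> real (Suc n) * exp (\<theta> * real (Suc n)) * grad1 \<theta> v"
      using \<theta> by (intro mult_right_mono mult_left_mono grad1_nonneg) (auto simp: mult_left_mono)
    finally show "P (h \<otimes> w) (Suc n)" by (simp add: P_def)
  qed
  then show ?thesis by (simp add: P_def Phi_def)
qed

text \<open>Averaged with \<open>k\<close>, this is the change of the \<open>Phi\<close>-weighted
  mass of \<open>v\<close> under convolution with \<open>k\<close>. It is applied with
  \<open>v\<close> the square of \<open>u\<close>.\<close>

definition drift :: "real \<Rightarrow> ('a \<Rightarrow> real) \<Rightarrow> 'a \<Rightarrow> real" where
  "drift \<theta> v y = tot (\<lambda>x. v x * (Phi \<theta> (y \<otimes> x) - Phi \<theta> x))"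

lemma drift_one: "drift \<theta> v \<one> = 0"
proof -
  have "drift \<theta> v \<one> = tot (\<lambda>x. 0)"
    unfolding drift_def by (rule tot_cong) simp
  then show ?thesis by (simp add: tot_zero)
qed

text \<open>Summation by parts turns the second difference of the weight into a product of first
  differences, so the word metric need not be smoothed.\<close>

lemma drift_mult:
  assumes \<theta>: "0 \<le> \<theta>" and v: "fs v" and y: "y \<in> carrier G" and z: "z \<in> carrier G"
  shows "\<bar>drift \<theta> v (y \<otimes> z) - drift \<theta> v y - drift \<theta> v z\<bar>
    \<le> (rho y * Phi \<theta> y) * (rho z * Phi \<theta> z) * (\<theta> * grad1 \<theta> v)"
proof -
  define D where "D = (\<lambda>x. Phi \<theta> (y \<otimes> x) - Phi \<theta> x)"
  have "drift \<theta> v (y \<otimes> z) = tot (\<lambda>x. v x * D (z \<otimes> x) + v x * (Phi \<theta> (z \<otimes> x) - Phi \<theta> x))"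
    unfolding drift_def D_def by (rule tot_cong) (use y z in \<open>simp add: m_assoc algebra_simps\<close>)
  also have "\<dots> = tot (\<lambda>x. v x * D (z \<otimes> x)) + drift \<theta> v z"
    unfolding drift_def using v by (intro tot_add fs_mult_left)
  also have "tot (\<lambda>x. v x * D (z \<otimes> x)) = tot (\<lambda>x. v (inv z \<otimes> x) * D (z \<otimes> (inv z \<otimes> x)))"
    using tot_left[of "inv z" "\<lambda>x. v x * D (z \<otimes> x)"] z by simp
  also have "\<dots> = tot (\<lambda>x. v (inv z \<otimes> x) * D x)"
    by (rule tot_cong) (use z in \<open>simp add: m_assoc[symmetric]\<close>)
  finally have "drift \<theta> v (y \<otimes> z) - drift \<theta> v y - drift \<theta> v z
      = tot (\<lambda>x. v (inv z \<otimes> x) * D x) - tot (\<lambda>x. v x * D x)"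
    by (simp add: drift_def D_def)
  also have "\<dots> = tot (\<lambda>x. v (inv z \<otimes> x) * D x - v x * D x)"
    using v z by (intro tot_diff[symmetric] fs_mult_left fs_left) auto
  also have "\<dots> = tot (\<lambda>x. diff_op G z v x * D x)" by (simp add: diff_op_def left_diff_distrib)
  also have "\<bar>\<dots>\<bar> \<le> tot (\<lambda>x. \<bar>diff_op G z v x * D x\<bar>)"
    using v z by (intro abs_tot_le fs_mult_left fs_diff_op)
  also have "\<dots> \<le> tot (\<lambda>x. (\<theta> * (rho y * Phi \<theta> y)) * (Phi \<theta> x * \<bar>diff_op G z v x\<bar>))"
  proof (rule tot_mono)
    fix x assume x: "x \<in> carrier G"
    have "\<bar>diff_op G z v x\<bar> * \<bar>D x\<bar> \<le> \<bar>diff_op G z v x\<bar> * (\<theta> * (rho y * Phi \<theta> y) * Phi \<theta> x)"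
      unfolding D_def by (intro mult_left_mono Phi_diff_le \<theta> y x) auto
    then show "\<bar>diff_op G z v x * D x\<bar> \<le> (\<theta> * (rho y * Phi \<theta> y)) * (Phi \<theta> x * \<bar>diff_op G z v x\<bar>)"
      by (simp add: abs_mult algebra_simps)
  next
    show "fs (\<lambda>x. \<bar>diff_op G z v x * D x\<bar>)" by (intro fs_abs fs_mult_left fs_diff_op v z)
    show "fs (\<lambda>x. (\<theta> * (rho y * Phi \<theta> y)) * (Phi \<theta> x * \<bar>diff_op G z v x\<bar>))"
      by (intro fs_mult_right fs_abs fs_diff_op v z)
  qed
  also have "\<dots> \<le> (\<theta> * (rho y * Phi \<theta> y)) * (rho z * Phi \<theta> z * grad1 \<theta> v)"
    unfolding tot_cmult using \<theta> by (intro mult_left_mono Phi_diff_op_le v z) (auto simp: Phi_nonneg)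
  finally show ?thesis by (simp add: algebra_simps)
qed

text \<open>A bound \<open>M\<close> in place of the exact moment makes this a class of kernels;
  later constants are chosen before \<open>k\<close> and so hold along the whole family.\<close>

definition good_kernel ::
  "nat \<Rightarrow> ('a \<Rightarrow> nat \<Rightarrow> int) \<Rightarrow> real \<Rightarrow> real \<Rightarrow> real \<Rightarrow> ('a \<Rightarrow> real) \<Rightarrow> bool" where
  "good_kernel d \<pi> \<eta> \<beta> M k \<longleftrightarrow> fs k \<and> (\<forall>x \<in> carrier G. 0 \<le> k x) \<and> tot k = 1 \<and>
     (\<forall>w \<in> W. \<eta> \<le> k w) \<and> tot (\<lambda>x. exp (\<beta> * rho x) * k x) \<le> M \<and>
     (\<forall>j<d. tot (\<lambda>g. k g * real_of_int (\<pi> g j)) = 0)"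

text \<open>The constant of \<open>quasi_additive_linear\<close> depends on the group element, so
  that lemma is used at the finitely many generators only. Induction along geodesics extends the
  linearity to all \<open>y\<close>, and the accumulated error is absorbed by
  \<open>exp (\<beta> * rho y)\<close>.\<close>

lemma drift_linear:
  assumes \<pi>: "free_abelian_projection G d \<pi>" and \<beta>: "0 < \<beta>"
  shows "\<exists>C\<ge>0. \<forall>\<theta> v. 0 \<le> \<theta> \<longrightarrow> \<theta> \<le> 1 \<longrightarrow> \<theta> \<le> \<beta> / 2 \<longrightarrow> fs v \<longrightarrow> (\<exists>b. \<forall>y \<in> carrier G.
    \<bar>drift \<theta> v y - (\<Sum>j<d. real_of_int (\<pi> y j) * b j)\<bar> \<le> C * exp (\<beta> * rho y) * (\<theta> * grad1 \<theta> v))"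
proof -
  note hom = free_abelian_projection_facts(1)[OF \<pi>]
  obtain e where e: "\<And>i. i < d \<Longrightarrow> e i \<in> carrier G"
      "\<And>i j. i < d \<Longrightarrow> j < d \<Longrightarrow> \<pi> (e i) j = (if j = i then 1 else 0)"
    using free_abelian_projection_facts(2)[OF \<pi>] by blast
  \<comment> \<open>\<open>Phi 1\<close> instead of \<open>Phi \<theta>\<close> makes
    \<open>c\<close>, and every constant extracted from it, independent of
    \<open>\<theta> \<le> 1\<close>.\<close>
  define c where "c = (\<lambda>y z. (rho y * Phi 1 y) * (rho z * Phi 1 z))"
  define L where "L = (\<lambda>B g. \<Sum>j<d. real_of_int (\<pi> g j) * (B (e j) :: real))"
  have "\<exists>C. \<forall>B E. quasi_additive G c B E \<longrightarrow> \<bar>B w - L B w\<bar> \<le> C * E" if "w \<in> W" for w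
    unfolding L_def by (rule quasi_additive_linear[OF \<pi> e W_carrier[OF that]])
  then obtain Cw where Cw: "\<And>w B E. w \<in> W \<Longrightarrow> quasi_additive G c B E \<Longrightarrow> \<bar>B w - L B w\<bar> \<le> Cw w * E"
    by metis
  define C1 where "C1 = (\<Sum>w\<in>W. \<bar>Cw w\<bar>)"
  have C1: "0 \<le> C1" by (simp add: C1_def sum_nonneg)
  have CW: "\<bar>B w - L B w\<bar> \<le> C1 * E" if "w \<in> W" "quasi_additive G c B E" for w B E
  proof -
    have "\<bar>Cw w\<bar> \<le> C1" unfolding C1_def using fin_W that by (intro member_le_sum) auto
    then have "Cw w * E \<le> C1 * E" using that by (intro mult_right_mono) (auto simp: quasi_additive_def)
    then show ?thesis using Cw[OF that] by linarith
  qed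
  \<comment> \<open>Uses \<open>m \<le> exp (\<beta> * m) / \<beta>\<close> once and
    \<open>m\<^sup>2 * exp (\<theta> * m) \<le> 16 / \<beta>\<^sup>2 * exp (\<beta> * m)\<close>
    three times. As \<open>\<theta> \<le> \<beta> / 2\<close>, half of the exponent is left for the
    factor \<open>m\<^sup>2\<close>.\<close>
  define C where "C = C1 / \<beta> + 48 / \<beta>\<^sup>2"
  show ?thesis
  proof (intro exI[of _ C] conjI allI impI)
    show "0 \<le> C" using C1 \<beta> by (simp add: C_def)
    fix \<theta> v
    assume \<theta>: "0 \<le> \<theta>" "\<theta> \<le> 1" "\<theta> \<le> \<beta> / 2" and v: "fs v"
    define B where "B = drift \<theta> v"
    define E where "E = \<theta> * grad1 \<theta> v"
    have E: "0 \<le> E" using \<theta> grad1_nonneg by (simp add: E_def)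
    have quasi: "quasi_additive G c B E"
      unfolding quasi_additive_def
    proof (intro conjI ballI E)
      fix y z assume yz: "y \<in> carrier G" "z \<in> carrier G"
      have "Phi \<theta> x \<le> Phi 1 x" for x using \<theta> by (simp add: Phi_def mult_left_le_one_le)
      then have "(rho y * Phi \<theta> y) * (rho z * Phi \<theta> z) * E \<le> c y z * E"
        unfolding c_def by (intro mult_right_mono mult_mono mult_left_mono E mult_nonneg_nonneg Phi_nonneg) auto
      then show "\<bar>B (y \<otimes> z) - B y - B z\<bar> \<le> c y z * E"
        using drift_mult[OF \<theta>(1) v yz] by (simp add: B_def E_def)
    qed
    \<comment> \<open>Each letter adds the error \<open>C1\<close> at a generator and the additivity
      defect against the prefix; the 3 is an upper bound of \<open>exp 1\<close>, hence of
      \<open>rho w * Phi \<theta> w\<close>.\<close>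
    define P where "P = (\<lambda>y n. \<bar>B y - L B y\<bar> \<le> real n * (C1 + 3 * real n * exp (\<theta> * real n)) * E)"
    have P: "P y (word_length G W y)" if "y \<in> carrier G" for y
      using that
    proof (rule word_length_induct[where P = P])
      have "\<pi> \<one> j = 0" if "j < d" for j using hom[of \<one> \<one> j] that by simp
      then show "P \<one> 0" by (simp add: P_def L_def B_def drift_one)
    next
      fix h w n
      assume h: "h \<in> carrier G" and n: "word_length G W h \<le> n" and w: "w \<in> W" and IH: "P h n"
      have wG: "w \<in> carrier G" using W_carrier[OF w] .
      have "L B (h \<otimes> w) = L B h + L B w"
        unfolding L_def sum.distrib[symmetric]
        by (intro sum.cong) (simp_all add: hom h wG distrib_right)
      moreover have "\<bar>B (h \<otimes> w) - B h - B w\<bar> \<le> 3 * real n * exp (\<theta> * real n) * E"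
      proof -
        have "rho w * Phi \<theta> w \<le> 1 * exp 1"
        proof (rule mult_mono)
          have "\<theta> * rho w \<le> 1 * 1" using \<theta> word_length_W[OF w] by (intro mult_mono) auto
          then show "Phi \<theta> w \<le> exp 1" by (simp add: Phi_def)
        qed (use word_length_W[OF w] in \<open>auto simp: Phi_nonneg\<close>)
        then have 1: "rho w * Phi \<theta> w \<le> 3" using exp_le by simp
        have 2: "rho h * Phi \<theta> h \<le> real n * exp (\<theta> * real n)"
          using n \<theta> by (intro mult_mono) (auto simp: Phi_def mult_left_mono)
        have "(rho h * Phi \<theta> h) * (rho w * Phi \<theta> w) * E \<le> (real n * exp (\<theta> * real n)) * 3 * E"
          by (intro mult_right_mono mult_mono 1 2 E) (auto simp: Phi_nonneg)
        then show ?thesis using drift_mult[OF \<theta>(1) v h wG] by (simp add: B_def E_def mult_ac)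
      qed
      moreover have "\<bar>B w - L B w\<bar> \<le> C1 * E" by (rule CW[OF w quasi])
      ultimately have "\<bar>B (h \<otimes> w) - L B (h \<otimes> w)\<bar>
          \<le> real n * (C1 + 3 * real n * exp (\<theta> * real n)) * E + C1 * E + 3 * real n * exp (\<theta> * real n) * E"
        using IH unfolding P_def by linarith
      also have "\<dots> = (real (Suc n) * C1 + real (Suc n) * (3 * real n * exp (\<theta> * real n))) * E"
        by (simp add: algebra_simps)
      also have "\<dots> \<le> (real (Suc n) * C1 + real (Suc n) * (3 * real (Suc n) * exp (\<theta> * real (Suc n)))) * E"
        using \<theta> by (intro mult_right_mono add_left_mono mult_left_mono mult_mono E) (auto simp: mult_left_mono)
      also have "\<dots> = real (Suc n) * (C1 + 3 * real (Suc n) * exp (\<theta> * real (Suc n))) * E"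
        by (simp add: distrib_left)
      finally show "P (h \<otimes> w) (Suc n)" by (simp add: P_def)
    qed
    have final: "\<bar>B y - L B y\<bar> \<le> C * exp (\<beta> * rho y) * E" if y: "y \<in> carrier G" for y
    proof -
      define m where "m = rho y"
      have m: "0 \<le> m" by (simp add: m_def)
      have "\<beta> * m \<le> exp (\<beta> * m)" using exp_ge_add_one_self[of "\<beta> * m"] by linarith
      then have 1: "m \<le> exp (\<beta> * m) / \<beta>" using \<beta> by (simp add: field_simps)
      have "\<beta> * m / 4 \<le> exp (\<beta> * m / 4)" using exp_ge_add_one_self[of "\<beta> * m / 4"] by linarith
      then have "(\<beta> * m / 4)\<^sup>2 \<le> (exp (\<beta> * m / 4))\<^sup>2" using \<beta> m by (intro power_mono) auto
      also have "\<dots> = exp (\<beta> * m / 2)" by (simp add: power2_eq_square exp_add[symmetric])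
      finally have "m\<^sup>2 \<le> 16 / \<beta>\<^sup>2 * exp (\<beta> * m / 2)"
        using \<beta> by (simp add: field_simps power_mult_distrib power_divide)
      moreover have "exp (\<theta> * m) \<le> exp (\<beta> / 2 * m)" using mult_right_mono[OF \<theta>(3) m] by simp
      ultimately have "m\<^sup>2 * exp (\<theta> * m) \<le> 16 / \<beta>\<^sup>2 * exp (\<beta> * m / 2) * exp (\<beta> / 2 * m)"
        by (intro mult_mono) auto
      also have "\<dots> = 16 / \<beta>\<^sup>2 * exp (\<beta> * m)" by (simp add: exp_add[symmetric])
      finally have 2: "m\<^sup>2 * exp (\<theta> * m) \<le> 16 / \<beta>\<^sup>2 * exp (\<beta> * m)" .
      have "m * (C1 + 3 * m * exp (\<theta> * m)) = C1 * m + 3 * (m\<^sup>2 * exp (\<theta> * m))"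
        by (simp add: algebra_simps power2_eq_square)
      also have "\<dots> \<le> C1 * (exp (\<beta> * m) / \<beta>) + 3 * (16 / \<beta>\<^sup>2 * exp (\<beta> * m))"
        using 1 2 C1 by (intro add_mono mult_left_mono) auto
      also have "\<dots> = C * exp (\<beta> * m)" by (simp add: C_def algebra_simps)
      finally have "m * (C1 + 3 * m * exp (\<theta> * m)) * E \<le> C * exp (\<beta> * m) * E"
        by (rule mult_right_mono[OF _ E])
      then show ?thesis using P[OF y] by (simp add: P_def m_def)
    qed
    show "\<exists>b. \<forall>y \<in> carrier G. \<bar>drift \<theta> v y - (\<Sum>j<d. real_of_int (\<pi> y j) * b j)\<bar>
        \<le> C * exp (\<beta> * rho y) * (\<theta> * grad1 \<theta> v)"
      using final unfolding L_def B_def E_def by (intro exI[of _ "\<lambda>j. drift \<theta> v (e j)"]) blast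
  qed
qed

text \<open>If \<open>a\<close> is a difference of \<open>u\<close>, that of the square is
  \<open>a\<^sup>2 + 2 * a * u x\<close>, and the cross term is split by means of
  \<open>(\<epsilon> * |a| - \<theta> * |u x|)\<^sup>2 \<ge> 0\<close>. The free
  \<open>\<epsilon>\<close> is later taken so small that the gradient can be absorbed.\<close>

lemma theta_grad1_square_le:
  assumes \<theta>: "0 \<le> \<theta>" and u: "fs u" and \<epsilon>: "0 < \<epsilon>"
  shows "\<theta> * grad1 \<theta> (\<lambda>x. (u x)\<^sup>2) \<le> (\<theta> + \<epsilon>) * tot (\<lambda>x. Phi \<theta> x * grad2 u x)
    + \<theta>\<^sup>2 / \<epsilon> * real (card W) * tot (\<lambda>x. Phi \<theta> x * (u x)\<^sup>2)"
proof -
  have pt: "\<theta> * (\<Sum>w\<in>W. \<bar>diff_op G w (\<lambda>x. (u x)\<^sup>2) x\<bar>)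
      \<le> (\<theta> + \<epsilon>) * grad2 u x + \<theta>\<^sup>2 / \<epsilon> * real (card W) * (u x)\<^sup>2" for x
  proof -
    have "\<theta> * \<bar>diff_op G w (\<lambda>x. (u x)\<^sup>2) x\<bar> \<le> (\<theta> + \<epsilon>) * (diff_op G w u x)\<^sup>2 + \<theta>\<^sup>2 / \<epsilon> * (u x)\<^sup>2" for w
    proof -
      define a where "a = diff_op G w u x"
      have "diff_op G w (\<lambda>x. (u x)\<^sup>2) x = a\<^sup>2 + 2 * a * u x"
        by (simp add: diff_op_def a_def power2_eq_square algebra_simps)
      then have "\<bar>diff_op G w (\<lambda>x. (u x)\<^sup>2) x\<bar> \<le> a\<^sup>2 + 2 * (\<bar>a\<bar> * \<bar>u x\<bar>)"
        using abs_triangle_ineq[of "a\<^sup>2" "2 * a * u x"] by (simp add: abs_mult)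
      then have 1: "\<theta> * \<bar>diff_op G w (\<lambda>x. (u x)\<^sup>2) x\<bar> \<le> \<theta> * (a\<^sup>2 + 2 * (\<bar>a\<bar> * \<bar>u x\<bar>))"
        using \<theta> by (rule mult_left_mono)
      have "0 \<le> (\<epsilon> * \<bar>a\<bar> - \<theta> * \<bar>u x\<bar>)\<^sup>2 / \<epsilon>" using \<epsilon> by simp
      also have "\<dots> = \<epsilon> * a\<^sup>2 - 2 * \<theta> * (\<bar>a\<bar> * \<bar>u x\<bar>) + \<theta>\<^sup>2 / \<epsilon> * (u x)\<^sup>2"
        using \<epsilon> by (simp add: power2_diff power_mult_distrib field_simps power2_eq_square)
      finally show ?thesis using 1 by (simp add: a_def[symmetric] algebra_simps)
    qed
    then have "(\<Sum>w\<in>W. \<theta> * \<bar>diff_op G w (\<lambda>x. (u x)\<^sup>2) x\<bar>)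
        \<le> (\<Sum>w\<in>W. (\<theta> + \<epsilon>) * (diff_op G w u x)\<^sup>2 + \<theta>\<^sup>2 / \<epsilon> * (u x)\<^sup>2)"
      by (intro sum_mono)
    then show ?thesis by (simp add: grad2_def sum_distrib_left sum.distrib mult_ac)
  qed
  have "\<theta> * grad1 \<theta> (\<lambda>x. (u x)\<^sup>2)
      = tot (\<lambda>x. \<theta> * (Phi \<theta> x * (\<Sum>w\<in>W. \<bar>diff_op G w (\<lambda>x. (u x)\<^sup>2) x\<bar>)))"
    by (simp add: grad1_def tot_cmult)
  also have "\<dots> \<le> tot (\<lambda>x. (\<theta> + \<epsilon>) * (Phi \<theta> x * grad2 u x)
      + \<theta>\<^sup>2 / \<epsilon> * real (card W) * (Phi \<theta> x * (u x)\<^sup>2))"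
  proof (rule tot_mono)
    fix x
    show "\<theta> * (Phi \<theta> x * (\<Sum>w\<in>W. \<bar>diff_op G w (\<lambda>x. (u x)\<^sup>2) x\<bar>))
        \<le> (\<theta> + \<epsilon>) * (Phi \<theta> x * grad2 u x) + \<theta>\<^sup>2 / \<epsilon> * real (card W) * (Phi \<theta> x * (u x)\<^sup>2)"
      using mult_left_mono[OF pt[of x] Phi_nonneg[of \<theta> x]] by (simp add: algebra_simps)
  next
    show "fs (\<lambda>x. \<theta> * (Phi \<theta> x * (\<Sum>w\<in>W. \<bar>diff_op G w (\<lambda>x. (u x)\<^sup>2) x\<bar>)))"
      by (intro fs_mult_right fs_sum fs_abs fs_diff_op fs_power2 u W_carrier)
    show "fs (\<lambda>x. (\<theta> + \<epsilon>) * (Phi \<theta> x * grad2 u x)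
        + \<theta>\<^sup>2 / \<epsilon> * real (card W) * (Phi \<theta> x * (u x)\<^sup>2))"
      by (intro fs_add fs_mult_right fs_grad2 fs_power2 u)
  qed
  also have "\<dots> = (\<theta> + \<epsilon>) * tot (\<lambda>x. Phi \<theta> x * grad2 u x)
      + \<theta>\<^sup>2 / \<epsilon> * real (card W) * tot (\<lambda>x. Phi \<theta> x * (u x)\<^sup>2)"
    unfolding tot_cmult[symmetric] by (intro tot_add fs_mult_right fs_power2 fs_grad2 u)
  finally show ?thesis .
qed

text \<open>The linear part averages to 0, and the exponential moment of \<open>k\<close> pays for
  the growth of the error in \<open>y\<close>.\<close>

lemma tot_drift_le:
  assumes C: "0 \<le> C" and k: "good_kernel d \<pi> \<eta> \<beta> M k" and E: "0 \<le> E"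
    and b: "\<And>y. y \<in> carrier G \<Longrightarrow>
      \<bar>B y - (\<Sum>j<d. real_of_int (\<pi> y j) * b j)\<bar> \<le> C * exp (\<beta> * rho y) * E"
  shows "tot (\<lambda>y. k y * B y) \<le> C * M * E"
proof -
  have fsk: "fs k" and k0: "\<And>x. x \<in> carrier G \<Longrightarrow> 0 \<le> k x"
    and M: "tot (\<lambda>x. exp (\<beta> * rho x) * k x) \<le> M"
    and cent: "\<And>j. j < d \<Longrightarrow> tot (\<lambda>g. k g * real_of_int (\<pi> g j)) = 0"
    using k by (auto simp: good_kernel_def)
  have "tot (\<lambda>y. k y * (\<Sum>j<d. real_of_int (\<pi> y j) * b j))
      = tot (\<lambda>y. \<Sum>j<d. b j * (k y * real_of_int (\<pi> y j)))"
    by (rule tot_cong) (simp add: sum_distrib_left mult_ac)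
  also have "\<dots> = (\<Sum>j<d. tot (\<lambda>y. b j * (k y * real_of_int (\<pi> y j))))"
    by (intro tot_sum fs_mult_right[OF fs_mult_left[OF fsk]]) auto
  also have "\<dots> = 0" by (simp add: tot_cmult cent)
  finally have 0: "tot (\<lambda>y. k y * (\<Sum>j<d. real_of_int (\<pi> y j) * b j)) = 0" .
  have "tot (\<lambda>y. k y * B y) = tot (\<lambda>y. k y * B y) - tot (\<lambda>y. k y * (\<Sum>j<d. real_of_int (\<pi> y j) * b j))"
    using 0 by simp
  also have "\<dots> = tot (\<lambda>y. k y * B y - k y * (\<Sum>j<d. real_of_int (\<pi> y j) * b j))"
    using fsk by (intro tot_diff[symmetric] fs_mult_left)
  also have "\<dots> \<le> tot (\<lambda>y. (C * E) * (exp (\<beta> * rho y) * k y))"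
  proof (rule tot_mono)
    fix y assume y: "y \<in> carrier G"
    have "k y * (B y - (\<Sum>j<d. real_of_int (\<pi> y j) * b j)) \<le> k y * (C * exp (\<beta> * rho y) * E)"
      using b[OF y] by (intro mult_left_mono k0 y) auto
    then show "k y * B y - k y * (\<Sum>j<d. real_of_int (\<pi> y j) * b j) \<le> (C * E) * (exp (\<beta> * rho y) * k y)"
      by (simp add: algebra_simps)
  next
    show "fs (\<lambda>y. k y * B y - k y * (\<Sum>j<d. real_of_int (\<pi> y j) * b j))"
      by (intro fs_diff fs_mult_left fsk)
    show "fs (\<lambda>y. (C * E) * (exp (\<beta> * rho y) * k y))" by (intro fs_mult_right fsk)
  qed
  also have "\<dots> = (C * E) * tot (\<lambda>y. exp (\<beta> * rho y) * k y)" by (rule tot_cmult)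
  also have "\<dots> \<le> (C * E) * M" using C E M by (intro mult_left_mono) auto
  finally show ?thesis by (simp add: mult_ac)
qed

lemma energy_step:
  assumes \<pi>: "free_abelian_projection G d \<pi>" and \<eta>: "0 < \<eta>" and \<beta>: "0 < \<beta>"
  shows "\<exists>\<theta>0>0. \<exists>c>0. \<exists>A\<ge>0. \<forall>k \<theta> u. good_kernel d \<pi> \<eta> \<beta> M k \<longrightarrow> 0 \<le> \<theta> \<longrightarrow> \<theta> \<le> \<theta>0 \<longrightarrow> fs u \<longrightarrow>
    tot (\<lambda>x. Phi \<theta> x * (conv G k u x)\<^sup>2) + c * tot (\<lambda>x. Phi \<theta> x * grad2 u x)
      \<le> (1 + A * \<theta>\<^sup>2) * tot (\<lambda>x. Phi \<theta> x * (u x)\<^sup>2)"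
proof -
  obtain C where C: "0 \<le> C" and lin: "\<And>\<theta> v. 0 \<le> \<theta> \<Longrightarrow> \<theta> \<le> 1 \<Longrightarrow> \<theta> \<le> \<beta> / 2 \<Longrightarrow> fs v \<Longrightarrow>
      \<exists>b. \<forall>y \<in> carrier G. \<bar>drift \<theta> v y - (\<Sum>j<d. real_of_int (\<pi> y j) * b j)\<bar>
        \<le> C * exp (\<beta> * rho y) * (\<theta> * grad1 \<theta> v)"
    using drift_linear[OF \<pi> \<beta>] by blast
  \<comment> \<open>\<open>M\<close> is an arbitrary real here, hence the absolute value; the added
    1 keeps the divisor in \<open>\<epsilon>\<close> positive.\<close>
  define C3 where "C3 = C * \<bar>M\<bar> + 1"
  define c0 where "c0 = \<eta> / (2 * real (card W))"
  \<comment> \<open>For \<open>\<theta> \<le> \<epsilon>\<close> the gradient coefficient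
    \<open>C3 * (\<theta> + \<epsilon>)\<close> is at most \<open>c0 / 2\<close>, half of the
    variance gain; the other half is the \<open>c\<close> of the claim.\<close>
  define \<epsilon> where "\<epsilon> = c0 / (4 * C3)"
  define A where "A = C3 / \<epsilon> * real (card W)"
  have C3: "0 < C3" using C by (simp add: C3_def add_nonneg_pos)
  have c0: "0 < c0" using \<eta> card_W_pos by (simp add: c0_def)
  have \<epsilon>: "0 < \<epsilon>" using C3 c0 by (simp add: \<epsilon>_def)
  show ?thesis
  proof (rule exI[of _ "min \<epsilon> (min 1 (\<beta> / 2))"], intro conjI, use \<epsilon> \<beta> in simp,
      rule exI[of _ "c0 / 2"], intro conjI, use c0 in simp, rule exI[of _ A], intro conjI allI impI)
    show "0 \<le> A" using C3 \<epsilon> by (simp add: A_def)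
    fix k \<theta> u
    assume k: "good_kernel d \<pi> \<eta> \<beta> M k" and \<theta>: "0 \<le> \<theta>" "\<theta> \<le> min \<epsilon> (min 1 (\<beta> / 2))" and u: "fs u"
    define v where "v = (\<lambda>x. (u x)\<^sup>2)"
    define S where "S = tot (\<lambda>x. Phi \<theta> x * v x)"
    define Dd where "Dd = tot (\<lambda>x. Phi \<theta> x * grad2 u x)"
    define E where "E = \<theta> * grad1 \<theta> v"
    have v: "fs v" using u by (simp add: v_def fs_power2)
    have fsk: "fs k" and k0: "\<And>x. x \<in> carrier G \<Longrightarrow> 0 \<le> k x" and k1: "tot k = 1"
      and k\<eta>: "\<And>w. w \<in> W \<Longrightarrow> \<eta> \<le> k w"
      using k by (auto simp: good_kernel_def)
    have E0: "0 \<le> E" using \<theta> grad1_nonneg by (simp add: E_def)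
    obtain b where b: "\<And>y. y \<in> carrier G \<Longrightarrow>
        \<bar>drift \<theta> v y - (\<Sum>j<d. real_of_int (\<pi> y j) * b j)\<bar> \<le> C * exp (\<beta> * rho y) * E"
      using lin[of \<theta> v] \<theta> v unfolding E_def by auto
    have "tot (\<lambda>y. k y * drift \<theta> v y) \<le> C * M * E" by (rule tot_drift_le[OF C k E0 b])
    also have "\<dots> \<le> C3 * E"
      using C by (intro mult_right_mono E0) (auto simp: C3_def intro!: add_increasing2 mult_left_mono)
    also have "\<dots> \<le> C3 * ((\<theta> + \<epsilon>) * Dd + \<theta>\<^sup>2 / \<epsilon> * real (card W) * S)"
      using theta_grad1_square_le[OF \<theta>(1) u \<epsilon>] C3 unfolding E_def v_def Dd_def S_def
      by (intro mult_left_mono) auto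
    also have "\<dots> \<le> C3 * ((2 * \<epsilon>) * Dd + \<theta>\<^sup>2 / \<epsilon> * real (card W) * S)"
      using C3 \<theta> unfolding Dd_def
      by (intro mult_left_mono add_right_mono mult_right_mono tot_nonneg mult_nonneg_nonneg
          Phi_nonneg grad2_nonneg) auto
    also have "\<dots> = c0 / 2 * Dd + A * \<theta>\<^sup>2 * S"
      using C3 by (simp add: \<epsilon>_def A_def field_simps)
    finally have drift: "tot (\<lambda>y. k y * drift \<theta> v y) \<le> c0 / 2 * Dd + A * \<theta>\<^sup>2 * S" .
    have "tot (\<lambda>x. Phi \<theta> x * (conv G k u x)\<^sup>2) + c0 * Dd
        = tot (\<lambda>x. Phi \<theta> x * (conv G k u x)\<^sup>2 + c0 * (Phi \<theta> x * grad2 u x))"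
      using u fsk unfolding Dd_def tot_cmult[symmetric]
      by (intro tot_add[symmetric] fs_mult_right fs_power2 fs_conv fs_grad2)
    also have "\<dots> \<le> tot (\<lambda>x. Phi \<theta> x * conv G k v x)"
    proof (rule tot_mono)
      fix x assume x: "x \<in> carrier G"
      have "(conv G k u x)\<^sup>2 + c0 * grad2 u x \<le> conv G k v x"
        unfolding c0_def v_def by (rule variance_bound[OF fsk k0 k1 \<eta> k\<eta> x])
      from mult_left_mono[OF this Phi_nonneg[of \<theta> x]]
      show "Phi \<theta> x * (conv G k u x)\<^sup>2 + c0 * (Phi \<theta> x * grad2 u x) \<le> Phi \<theta> x * conv G k v x"
        by (simp add: algebra_simps)
    qed (use u v fsk in \<open>auto intro!: fs_mult_right fs_add fs_power2 fs_conv fs_grad2\<close>)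
    also have "\<dots> = tot (\<lambda>y. k y * tot (\<lambda>x. Phi \<theta> (y \<otimes> x) * v x))"
      by (rule tot_conv_weighted[OF fsk v])
    also have "\<dots> = tot (\<lambda>y. k y * drift \<theta> v y + S * k y)"
    proof (rule tot_cong)
      fix y
      have "drift \<theta> v y = tot (\<lambda>x. Phi \<theta> (y \<otimes> x) * v x - Phi \<theta> x * v x)"
        unfolding drift_def by (rule tot_cong) (simp add: algebra_simps)
      also have "\<dots> = tot (\<lambda>x. Phi \<theta> (y \<otimes> x) * v x) - S"
        unfolding S_def using v by (intro tot_diff fs_mult_right)
      finally have "tot (\<lambda>x. Phi \<theta> (y \<otimes> x) * v x) = drift \<theta> v y + S" by simp
      then show "k y * tot (\<lambda>x. Phi \<theta> (y \<otimes> x) * v x) = k y * drift \<theta> v y + S * k y"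
        by (simp only: distrib_left mult.commute[of S])
    qed
    also have "\<dots> = tot (\<lambda>y. k y * drift \<theta> v y) + S"
      using tot_add[OF fs_mult_left[OF fsk] fs_mult_right[OF fsk], of "drift \<theta> v" "\<lambda>_. S"]
      by (simp add: tot_cmult k1)
    finally have "tot (\<lambda>x. Phi \<theta> x * (conv G k u x)\<^sup>2) + c0 / 2 * Dd \<le> (1 + A * \<theta>\<^sup>2) * S"
      using drift by (simp add: algebra_simps)
    then show "tot (\<lambda>x. Phi \<theta> x * (conv G k u x)\<^sup>2) + c0 / 2 * tot (\<lambda>x. Phi \<theta> x * grad2 u x)
        \<le> (1 + A * \<theta>\<^sup>2) * tot (\<lambda>x. Phi \<theta> x * (u x)\<^sup>2)"
      by (simp add: Dd_def S_def v_def)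
  qed
qed

end

section \<open>Elementary estimates at integer scales\<close>

lemma bigo_nat_bound:
  fixes f g :: "nat \<Rightarrow> real"
  assumes "f \<in> O(g)" and f: "\<And>n. n \<ge> 1 \<Longrightarrow> 0 \<le> f n" and g: "\<And>n. n \<ge> 1 \<Longrightarrow> 0 < g n"
  shows "\<exists>c>0. \<forall>n\<ge>1. f n \<le> c * g n"
proof -
  obtain c where c: "c > 0" "eventually (\<lambda>n. norm (f n) \<le> c * norm (g n)) at_top"
    using assms(1) by (elim landau_o.bigE)
  then obtain N where N: "\<And>n. n \<ge> N \<Longrightarrow> norm (f n) \<le> c * norm (g n)"
    by (auto simp: eventually_at_top_linorder)
  \<comment> \<open>The ratios over the finite initial segment are all added to the constant. The
    index 0 stays excluded because \<open>0 powr D\<close> is 0 for every \<open>D\<close>.\<close>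
  define c' where "c' = c + (\<Sum>n\<in>{1..N}. f n / g n)"
  have s: "0 \<le> (\<Sum>n\<in>{1..N}. f n / g n)" using f g by (intro sum_nonneg divide_nonneg_pos) auto
  have "f n \<le> c' * g n" if n: "n \<ge> 1" for n
  proof (cases "n \<le> N")
    case True
    have "f n / g n \<le> (\<Sum>n\<in>{1..N}. f n / g n)"
      using True n f g by (intro member_le_sum divide_nonneg_pos) auto
    then have "f n / g n \<le> c'" using c by (simp add: c'_def)
    then show ?thesis using g[OF n] by (simp add: field_simps)
  next
    case False
    then have "f n \<le> c * g n" using N[of n] f[OF n] g[OF n] by simp
    also have "\<dots> \<le> c' * g n" using s g[OF n] by (intro mult_right_mono) (auto simp: c'_def)
    finally show ?thesis .
  qed
  then show ?thesis using c s by (intro exI[of _ c']) (auto simp: c'_def)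
qed

lemma sqrt_ceiling_bounds:
  assumes "q \<ge> (1::nat)"
  defines "n \<equiv> nat \<lceil>sqrt (real q)\<rceil>"
  shows "n \<ge> 1" "sqrt (real q) \<le> real n" "real n \<le> 2 * sqrt (real q)"
proof -
  have s: "1 \<le> sqrt (real q)" using assms by simp
  have n: "real n = of_int \<lceil>sqrt (real q)\<rceil>" using s by (simp add: n_def)
  show 1: "sqrt (real q) \<le> real n" unfolding n by (rule le_of_int_ceiling)
  show "n \<ge> 1" using 1 s by linarith
  show "real n \<le> 2 * sqrt (real q)" unfolding n using s of_int_ceiling_le_add_one[of "sqrt (real q)"] by linarith
qed

lemma sqrt_powr: "q \<ge> (1::nat) \<Longrightarrow> sqrt (real q) powr D = real q powr (D / 2)"
  by (simp add: powr_half_sqrt[symmetric] powr_powr)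

context word_metric
begin

subsection \<open>Consequences of polynomial growth\<close>

lemma growth_bounds:
  assumes "has_growth_degree G W D"
  shows "\<exists>c>0. \<forall>n\<ge>1. real (card (ball n)) \<le> c * real n powr D"
    and "\<exists>c>0. \<forall>n\<ge>1. c * real n powr D \<le> real (card (ball n))"
    and "0 \<le> D"
proof -
  have \<Theta>: "(\<lambda>n. real (card (ball n))) \<in> \<Theta>(\<lambda>n. real n powr D)"
    using assms by (simp add: has_growth_degree_def ball_def)
  show up: "\<exists>c>0. \<forall>n\<ge>1. real (card (ball n)) \<le> c * real n powr D"
    by (rule bigo_nat_bound) (use \<Theta> in auto)
  have "(\<lambda>n. real n powr D) \<in> O(\<lambda>n. real (card (ball n)))"
    using \<Theta> by (simp add: bigtheta_sym bigthetaD1)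
  then have "\<exists>c>0. \<forall>n\<ge>1. real n powr D \<le> c * real (card (ball n))"
    by (rule bigo_nat_bound) (use card_ball_pos in auto)
  then obtain c where c: "c > 0" "\<And>n. n \<ge> 1 \<Longrightarrow> real n powr D \<le> c * real (card (ball n))" by blast
  show "\<exists>c>0. \<forall>n\<ge>1. c * real n powr D \<le> real (card (ball n))"
    using c by (intro exI[of _ "1 / c"]) (auto simp: field_simps)
  \<comment> \<open>Balls contain the identity, so their cardinality cannot tend to 0.\<close>
  show "0 \<le> D"
  proof (rule ccontr)
    assume "\<not> 0 \<le> D"
    obtain c where c: "c > 0" "\<And>n. n \<ge> 1 \<Longrightarrow> real (card (ball n)) \<le> c * real n powr D" using up by blast
    have "((\<lambda>n. c * real n powr D) \<longlongrightarrow> c * 0) sequentially"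
      using \<open>\<not> 0 \<le> D\<close> by (intro tendsto_mult_left tendsto_neg_powr filterlim_real_sequentially) auto
    then have "eventually (\<lambda>n. c * real n powr D < 1) sequentially"
      by (intro order_tendstoD(2)[of _ 0]) auto
    then obtain N where N: "\<And>n. n \<ge> N \<Longrightarrow> c * real n powr D < 1"
      by (auto simp: eventually_sequentially)
    have "real (card (ball (max N 1))) < 1" using N[of "max N 1"] c(2)[of "max N 1"] by simp
    then show False using card_ball_pos[of "max N 1"] by simp
  qed
qed

text \<open>Shells of width \<open>n\<close>, about \<open>sqrt q\<close>: shell \<open>j\<close>
  has at most \<open>c * ((j + 1) * n) powr D\<close> points of weight at most
  \<open>exp (- a * j)\<close>. Apart from \<open>n powr D\<close>, what remains is a convergent
  series free of \<open>q\<close>.\<close>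

lemma exp_weight_sum:
  assumes growth: "has_growth_degree G W D" and a: "0 < a"
  shows "\<exists>C>0. \<forall>q::nat. \<forall>A. q \<ge> 1 \<longrightarrow> finite A \<longrightarrow> A \<subseteq> carrier G \<longrightarrow>
    (\<Sum>x\<in>A. Phi (- (a / sqrt (real q))) x) \<le> C * real q powr (D / 2)"
proof -
  obtain c where c: "c > 0" "\<And>n. n \<ge> 1 \<Longrightarrow> real (card (ball n)) \<le> c * real n powr D"
    using growth_bounds(1)[OF growth] by blast
  have D: "0 \<le> D" by (rule growth_bounds(3)[OF growth])
  define t where "t = (\<lambda>j. (real j + 1) powr D * exp (- a * real j))"
  have t0: "0 \<le> t j" for j by (simp add: t_def)
  have t_bigo: "t \<in> O(\<lambda>j. exp (- a / 2 * real j))" unfolding t_def using a by real_asymp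
  have "summable (\<lambda>j. norm (exp (- a / 2 * real j)))"
  proof -
    have "norm (exp (- a / 2 * real j)) = exp (- a / 2) ^ j" for j
      using exp_of_nat_mult[of j "- a / 2"] by (simp add: mult.commute)
    moreover have "summable (\<lambda>j. exp (- a / 2) ^ j)" using a by (intro summable_geometric) auto
    ultimately show ?thesis by presburger
  qed
  then have sum_t: "summable t" using t_bigo by (rule summable_comparison_test_bigo)
  define T where "T = suminf t"
  \<comment> \<open>\<open>2 powr D\<close> comes from \<open>n \<le> 2 * sqrt q\<close>; the added
    1 keeps \<open>C\<close> positive.\<close>
  define C where "C = c * 2 powr D * (T + 1)"
  have T: "0 \<le> T" unfolding T_def by (rule suminf_nonneg[OF sum_t t0])
  show ?thesis
  proof (intro exI[of _ C] conjI allI impI)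
    show "0 < C" using c T by (simp add: C_def)
    fix q :: nat and A
    assume q: "q \<ge> 1" and A: "finite A" "A \<subseteq> carrier G"
    define n where "n = nat \<lceil>sqrt (real q)\<rceil>"
    note n = sqrt_ceiling_bounds[OF q, folded n_def]
    have s: "0 < sqrt (real q)" using q by simp
    define J where "J = (\<lambda>x. word_length G W x div n)"
    have "(\<Sum>x\<in>A. Phi (- (a / sqrt (real q))) x) \<le> (\<Sum>x\<in>A. exp (- a * real (J x)))"
    proof (rule sum_mono)
      fix x
      have "real (J x) * sqrt (real q) \<le> real (J x) * real n" using n by (intro mult_left_mono) auto
      also have "\<dots> \<le> rho x" unfolding J_def of_nat_mult[symmetric] of_nat_le_iff by simp
      finally have "a * real (J x) \<le> a * (rho x / sqrt (real q))"
        using a s by (intro mult_left_mono) (auto simp: field_simps)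
      then show "Phi (- (a / sqrt (real q))) x \<le> exp (- a * real (J x))" by (simp add: Phi_def)
    qed
    also have "\<dots> = (\<Sum>j\<in>J ` A. \<Sum>x\<in>{x\<in>A. J x = j}. exp (- a * real (J x)))"
      by (rule sum.image_gen[OF A(1)])
    also have "\<dots> \<le> (\<Sum>j\<in>J ` A. c * real n powr D * t j)"
    proof (rule sum_mono)
      fix j
      have sub: "{x\<in>A. J x = j} \<subseteq> ball ((j + 1) * n)"
      proof
        fix x assume x: "x \<in> {x\<in>A. J x = j}"
        have "word_length G W x < (j + 1) * n"
          using x n(1) dividend_less_div_times[of n "word_length G W x"] by (auto simp: J_def mult.commute)
        then show "x \<in> ball ((j + 1) * n)" using x A by (auto simp: ball_def)
      qed
      have "(\<Sum>x\<in>{x\<in>A. J x = j}. exp (- a * real (J x))) = real (card {x\<in>A. J x = j}) * exp (- a * real j)"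
        by simp
      also have "\<dots> \<le> real (card (ball ((j + 1) * n))) * exp (- a * real j)"
        using card_mono[OF finite_ball sub] by (intro mult_right_mono) auto
      also have "\<dots> \<le> (c * real ((j + 1) * n) powr D) * exp (- a * real j)"
        using n by (intro mult_right_mono c) auto
      also have "\<dots> = c * real n powr D * t j"
        using powr_mult[of "real j + 1" "real n" D] by (simp add: t_def distrib_right add.commute)
      finally show "(\<Sum>x\<in>{x\<in>A. J x = j}. exp (- a * real (J x))) \<le> c * real n powr D * t j" .
    qed
    also have "\<dots> = c * real n powr D * sum t (J ` A)" by (simp add: sum_distrib_left)
    also have "\<dots> \<le> c * (2 * sqrt (real q)) powr D * (T + 1)"
    proof (intro mult_mono)
      show "sum t (J ` A) \<le> T + 1"
        unfolding T_def using sum_le_suminf[OF sum_t, of "J ` A"] A t0 by fastforce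
      show "real n powr D \<le> (2 * sqrt (real q)) powr D" using n D by (intro powr_mono2) auto
    qed (use c T t0 in \<open>auto intro: sum_nonneg\<close>)
    also have "\<dots> = C * real q powr (D / 2)"
      using q by (simp add: C_def powr_mult sqrt_powr)
    finally show "(\<Sum>x\<in>A. Phi (- (a / sqrt (real q))) x) \<le> C * real q powr (D / 2)" .
  qed
qed

lemma Phi_mult: "Phi s x * Phi t x = Phi (s + t) x"
  by (simp add: Phi_def exp_add[symmetric] distrib_right)

lemma Phi_power2: "(Phi s x)\<^sup>2 = Phi (2 * s) x"
  by (simp add: power2_eq_square Phi_mult)

text \<open>Cauchy-Schwarz after moving the weight \<open>Phi (b / 2)\<close> onto \<open>g\<close>
  and its inverse onto the other factor, whose squares are summed by \<open>exp_weight_sum\<close>.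
  The power of \<open>q\<close> is the order of the volume of a ball of radius
  \<open>sqrt q\<close>.\<close>

lemma weighted_l1_le_l2:
  assumes growth: "has_growth_degree G W D" and a: "0 < a"
  shows "\<exists>C>0. \<forall>q::nat. \<forall>s g. q \<ge> 1 \<longrightarrow> fs g \<longrightarrow>
    (tot (\<lambda>x. Phi s x * \<bar>g x\<bar>))\<^sup>2
      \<le> C * real q powr (D / 2) * tot (\<lambda>x. Phi (2 * s + a / sqrt (real q)) x * (g x)\<^sup>2)"
proof -
  obtain C where C: "C > 0" "\<And>q A. (q::nat) \<ge> 1 \<Longrightarrow> finite A \<Longrightarrow> A \<subseteq> carrier G \<Longrightarrow>
    (\<Sum>x\<in>A. Phi (- (a / sqrt (real q))) x) \<le> C * real q powr (D / 2)"
    using exp_weight_sum[OF growth a] by metis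
  show ?thesis
  proof (intro exI[of _ C] conjI allI impI C(1))
    fix q :: nat and s g
    assume q: "q \<ge> 1" and g: "fs g"
    define b where "b = a / sqrt (real q)"
    define A where "A = {x \<in> carrier G. g x \<noteq> 0}"
    have A: "finite A" "A \<subseteq> carrier G" using g by (auto simp: A_def fs_def)
    define G1 where "G1 = (\<lambda>x. Phi (s + b / 2) x * \<bar>g x\<bar>)"
    \<comment> \<open>Cut off at the support of \<open>g\<close>, since the bare weight need not be
      finitely supported.\<close>
    define G2 where "G2 = (\<lambda>x. if x \<in> A then Phi (- b / 2) x else 0)"
    have fsG: "fs G1" "fs G2"
      unfolding G1_def G2_def using fs_mult_right[OF fs_abs[OF g]] A(1)
      by (auto simp: fs_def intro: finite_subset)
    have "tot (\<lambda>x. Phi s x * \<bar>g x\<bar>) = tot (\<lambda>x. G1 x * G2 x)"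
    proof (rule tot_cong)
      fix x assume "x \<in> carrier G"
      then show "Phi s x * \<bar>g x\<bar> = G1 x * G2 x"
        using Phi_mult[of "s + b / 2" x "- b / 2"] by (auto simp: G1_def G2_def A_def)
    qed
    then have "(tot (\<lambda>x. Phi s x * \<bar>g x\<bar>))\<^sup>2 \<le> tot (\<lambda>x. (G1 x)\<^sup>2) * tot (\<lambda>x. (G2 x)\<^sup>2)"
      using tot_Cauchy_Schwarz[OF fsG] by simp
    also have "tot (\<lambda>x. (G2 x)\<^sup>2) = (\<Sum>x\<in>A. (G2 x)\<^sup>2)"
      using A by (intro tot_eq_sum) (auto simp: G2_def)
    also have "\<dots> = (\<Sum>x\<in>A. Phi (- b) x)" by (rule sum.cong) (auto simp: G2_def Phi_power2)
    also have "tot (\<lambda>x. (G1 x)\<^sup>2) = tot (\<lambda>x. Phi (2 * s + b) x * (g x)\<^sup>2)"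
      by (rule tot_cong) (simp add: G1_def power_mult_distrib Phi_power2 distrib_left)
    also have "\<dots> * (\<Sum>x\<in>A. Phi (- b) x) \<le> \<dots> * (C * real q powr (D / 2))"
      using C(2)[OF q A] unfolding b_def
      by (intro mult_left_mono tot_nonneg mult_nonneg_nonneg Phi_nonneg) auto
    finally show "(tot (\<lambda>x. Phi s x * \<bar>g x\<bar>))\<^sup>2
        \<le> C * real q powr (D / 2) * tot (\<lambda>x. Phi (2 * s + a / sqrt (real q)) x * (g x)\<^sup>2)"
      by (simp add: b_def mult_ac)
  qed
qed

subsection \<open>Exponential moments\<close>

lemma energy_iterate:
  assumes step: "\<And>u. fs u \<Longrightarrow> tot (\<lambda>x. Phi \<theta> x * (conv G k u x)\<^sup>2)
      \<le> (1 + r) * tot (\<lambda>x. Phi \<theta> x * (u x)\<^sup>2)"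
    and r: "0 \<le> r" and k: "fs k" and f: "fs f"
  shows "tot (\<lambda>x. Phi \<theta> x * (conv G (conv_power G k m) f x)\<^sup>2)
    \<le> exp (r * real m) * tot (\<lambda>x. Phi \<theta> x * (f x)\<^sup>2)"
proof (induction m)
  case 0
  have "tot (\<lambda>x. Phi \<theta> x * (conv G (conv_power G k 0) f x)\<^sup>2) = tot (\<lambda>x. Phi \<theta> x * (f x)\<^sup>2)"
    by (rule tot_cong) (simp add: conv_one_left)
  then show ?case by simp
next
  case (Suc m)
  let ?g = "conv G (conv_power G k m) f"
  have "tot (\<lambda>x. Phi \<theta> x * (conv G (conv_power G k (Suc m)) f x)\<^sup>2) = tot (\<lambda>x. Phi \<theta> x * (conv G k ?g x)\<^sup>2)"
    by (rule tot_cong) (simp add: conv_assoc k f fs_conv_power)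
  also have "\<dots> \<le> (1 + r) * tot (\<lambda>x. Phi \<theta> x * (?g x)\<^sup>2)"
    by (intro step fs_conv fs_conv_power k f)
  also have "\<dots> \<le> exp r * (exp (r * real m) * tot (\<lambda>x. Phi \<theta> x * (f x)\<^sup>2))"
    using exp_ge_add_one_self[of r] Suc by (intro mult_mono) (auto intro!: tot_nonneg mult_nonneg_nonneg Phi_nonneg)
  also have "\<dots> = exp (r * real (Suc m)) * tot (\<lambda>x. Phi \<theta> x * (f x)\<^sup>2)"
    by (simp add: exp_add[symmetric] algebra_simps)
  finally show ?case .
qed

text \<open>The weighted \<open>\<ell>\<^sup>2\<close> bound is applied to the indicator of a ball of radius about \<open>sqrt q\<close>
  rather than to a point mass: the volume gained compensates the loss from \<open>\<ell>\<^sup>2\<close> to \<open>\<ell>\<^sup>1\<close>,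
  and smearing over this ball changes \<open>\<rho> / sqrt q\<close> by a bounded amount only.\<close>

lemma exp_moment_bound:
  assumes growth: "has_growth_degree G W D" and A: "0 \<le> A"
    and step: "\<And>k \<theta> u. good_kernel d \<pi> \<eta> \<beta> M k \<Longrightarrow> 0 \<le> \<theta> \<Longrightarrow> \<theta> \<le> \<theta>0 \<Longrightarrow> fs u \<Longrightarrow>
      tot (\<lambda>x. Phi \<theta> x * (conv G k u x)\<^sup>2) \<le> (1 + A * \<theta>\<^sup>2) * tot (\<lambda>x. Phi \<theta> x * (u x)\<^sup>2)"
    and a: "0 < a" "4 * a \<le> \<theta>0"
  shows "\<exists>C>0. \<forall>k (q::nat) m. good_kernel d \<pi> \<eta> \<beta> M k \<longrightarrow> q \<ge> 1 \<longrightarrow> m \<le> q \<longrightarrow>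
    tot (\<lambda>x. Phi (a / sqrt (real q)) x * conv_power G k m x) \<le> C"
proof -
  obtain C1 where C1: "C1 > 0" "\<And>q s g. (q::nat) \<ge> 1 \<Longrightarrow> fs g \<Longrightarrow>
    (tot (\<lambda>x. Phi s x * \<bar>g x\<bar>))\<^sup>2
      \<le> C1 * real q powr (D / 2) * tot (\<lambda>x. Phi (2 * s + 2 * a / sqrt (real q)) x * (g x)\<^sup>2)"
    using weighted_l1_le_l2[OF growth, of "2 * a"] a by auto
  obtain c where c: "c > 0" "\<And>n. n \<ge> 1 \<Longrightarrow> c * real n powr D \<le> real (card (ball n))"
    using growth_bounds(2)[OF growth] by blast
  have D: "0 \<le> D" by (rule growth_bounds(3)[OF growth])
  \<comment> \<open>\<open>exp (4 * a)\<close> undoes the square of the smearing loss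
    \<open>exp (- l * real n)\<close>, where \<open>l * real n \<le> 2 * a\<close>;
    \<open>16 * A * a\<^sup>2\<close> is \<open>A * \<theta>\<^sup>2 * real q\<close>;
    \<open>8 * a\<close> bounds the exponent \<open>\<theta> * real n\<close> on the ball; the
    division by \<open>c\<close> comes from the lower volume bound.\<close>
  define C2 where "C2 = exp (4 * a) * (C1 * (exp (16 * A * a\<^sup>2) * exp (8 * a))) / c"
  have C2: "0 < C2" using C1 c by (simp add: C2_def)
  show ?thesis
  proof (intro exI[of _ "sqrt C2"] conjI allI impI)
    show "0 < sqrt C2" using C2 by simp
    fix k and q m :: nat
    assume k: "good_kernel d \<pi> \<eta> \<beta> M k" and q: "q \<ge> 1" and m: "m \<le> q"
    have fsk: "fs k" and k0: "\<And>x. x \<in> carrier G \<Longrightarrow> 0 \<le> k x"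
      using k by (auto simp: good_kernel_def)
    define n where "n = nat \<lceil>sqrt (real q)\<rceil>"
    note n = sqrt_ceiling_bounds[OF q, folded n_def]
    define l where "l = a / sqrt (real q)"
    have sq: "1 \<le> sqrt (real q)" using q by simp
    have l: "0 < l" "l * real n \<le> 2 * a"
      using a sq mult_left_mono[OF n(3), of a] by (auto simp: l_def field_simps)
    \<comment> \<open>Squaring the weighted sum doubles \<open>l\<close>, and Cauchy-Schwarz against
      the exponential weight adds another \<open>2 * l\<close>.\<close>
    define \<theta> where "\<theta> = 4 * l"
    have "l \<le> a" using a sq by (simp add: l_def field_simps)
    then have \<theta>: "0 \<le> \<theta>" "\<theta> \<le> \<theta>0" using a l by (auto simp: \<theta>_def)
    define f where "f = (\<lambda>x. if x \<in> ball n then 1 else 0 :: real)"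
    define V where "V = real (card (ball n))"
    have V: "0 < V" using card_ball_pos by (simp add: V_def)
    have fsf: "fs f" unfolding fs_def f_def using finite_ball[of n] by (auto intro: finite_subset)
    define u where "u = conv_power G k m"
    have fsu: "fs u" and u0: "\<And>x. x \<in> carrier G \<Longrightarrow> 0 \<le> u x"
      using fsk k0 by (auto simp: u_def fs_conv_power conv_power_nonneg)
    define Z where "Z = tot (\<lambda>x. Phi l x * u x)"
    have Z0: "0 \<le> Z" unfolding Z_def by (intro tot_nonneg mult_nonneg_nonneg Phi_nonneg u0)
    \<comment> \<open>Right multiplication by a point of the ball lowers the length of
      \<open>y\<close> by at most \<open>n\<close>, so smearing \<open>u\<close> over the ball loses
      at most the factor \<open>exp (l * real n)\<close>.\<close>
    have "V * exp (- l * real n) * Z = tot (\<lambda>y. V * exp (- l * real n) * (Phi l y * u y))"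
      by (simp add: Z_def tot_cmult)
    also have "\<dots> \<le> tot (\<lambda>y. u y * tot (\<lambda>x. Phi l (y \<otimes> x) * f x))"
    proof (rule tot_mono)
      fix y assume y: "y \<in> carrier G"
      have "V * (exp (- l * real n) * Phi l y) = (\<Sum>x\<in>ball n. exp (- l * real n) * Phi l y)"
        by (simp add: V_def)
      also have "\<dots> \<le> (\<Sum>x\<in>ball n. Phi l (y \<otimes> x))"
      proof (rule sum_mono)
        fix x assume "x \<in> ball n"
        then have x: "x \<in> carrier G" "rho x \<le> real n" by (auto simp: ball_def)
        have "rho y - real n \<le> rho (y \<otimes> x)" using word_length_mult_ge(2)[OF y x(1)] x by linarith
        then have "l * (rho y - real n) \<le> l * rho (y \<otimes> x)" using l by (intro mult_left_mono) auto
        then show "exp (- l * real n) * Phi l y \<le> Phi l (y \<otimes> x)"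
          by (simp add: Phi_def exp_add[symmetric] algebra_simps)
      qed
      also have "\<dots> = (\<Sum>x\<in>ball n. Phi l (y \<otimes> x) * f x)" by (simp add: f_def)
      also have "\<dots> = tot (\<lambda>x. Phi l (y \<otimes> x) * f x)"
        using finite_ball ball_carrier by (intro tot_eq_sum[symmetric]) (auto simp: f_def)
      finally have "u y * (V * (exp (- l * real n) * Phi l y)) \<le> u y * tot (\<lambda>x. Phi l (y \<otimes> x) * f x)"
        by (rule mult_left_mono) (rule u0[OF y])
      then show "V * exp (- l * real n) * (Phi l y * u y) \<le> u y * tot (\<lambda>x. Phi l (y \<otimes> x) * f x)"
        by (simp add: mult_ac)
    next
      show "fs (\<lambda>y. V * exp (- l * real n) * (Phi l y * u y))" by (intro fs_mult_right fsu)
      show "fs (\<lambda>y. u y * tot (\<lambda>x. Phi l (y \<otimes> x) * f x))" by (intro fs_mult_left fsu)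
    qed
    also have "\<dots> = tot (\<lambda>x. Phi l x * conv G u f x)"
      by (rule tot_conv_weighted[OF fsu fsf, symmetric])
    also have "\<dots> = tot (\<lambda>x. Phi l x * \<bar>conv G u f x\<bar>)"
    proof (rule tot_cong)
      fix x assume "x \<in> carrier G"
      then have "0 \<le> conv G u f x" using u0 by (intro conv_nonneg) (auto simp: f_def)
      then show "Phi l x * conv G u f x = Phi l x * \<bar>conv G u f x\<bar>" by simp
    qed
    finally have "(V * exp (- l * real n) * Z)\<^sup>2 \<le> (tot (\<lambda>x. Phi l x * \<bar>conv G u f x\<bar>))\<^sup>2"
      using V Z0 by (intro power_mono) auto
    also have "\<dots> \<le> C1 * real q powr (D / 2) * tot (\<lambda>x. Phi (2 * l + 2 * a / sqrt (real q)) x * (conv G u f x)\<^sup>2)"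
      by (intro C1 q fs_conv fsu fsf)
    also have "2 * l + 2 * a / sqrt (real q) = \<theta>" by (simp add: \<theta>_def l_def)
    also have "tot (\<lambda>x. Phi \<theta> x * (conv G u f x)\<^sup>2) \<le> exp (A * \<theta>\<^sup>2 * real m) * tot (\<lambda>x. Phi \<theta> x * (f x)\<^sup>2)"
      unfolding u_def using A by (intro energy_iterate step[OF k \<theta>] fsk fsf) auto
    also have "\<dots> \<le> exp (16 * A * a\<^sup>2) * (exp (8 * a) * V)"
    proof (rule mult_mono)
      have "\<theta>\<^sup>2 * real m \<le> \<theta>\<^sup>2 * real q" using m by (intro mult_left_mono) auto
      also have "\<dots> = 16 * a\<^sup>2" using q by (simp add: \<theta>_def l_def power_mult_distrib power_divide)
      finally have "A * (\<theta>\<^sup>2 * real m) \<le> A * (16 * a\<^sup>2)" using A by (rule mult_left_mono)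
      then show "exp (A * \<theta>\<^sup>2 * real m) \<le> exp (16 * A * a\<^sup>2)" by (simp add: mult_ac)
      have "tot (\<lambda>x. Phi \<theta> x * (f x)\<^sup>2) = (\<Sum>x\<in>ball n. Phi \<theta> x * (f x)\<^sup>2)"
        using finite_ball ball_carrier by (intro tot_eq_sum) (auto simp: f_def)
      also have "\<dots> \<le> (\<Sum>x\<in>ball n. exp (8 * a))"
      proof (rule sum_mono)
        fix x assume x: "x \<in> ball n"
        have "\<theta> * rho x \<le> \<theta> * real n" using x \<theta> by (intro mult_left_mono) (auto simp: ball_def)
        also have "\<dots> \<le> 8 * a" using l by (simp add: \<theta>_def)
        finally show "Phi \<theta> x * (f x)\<^sup>2 \<le> exp (8 * a)" using x by (simp add: Phi_def f_def)
      qed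
      finally show "tot (\<lambda>x. Phi \<theta> x * (f x)\<^sup>2) \<le> exp (8 * a) * V" by (simp add: V_def mult_ac)
    qed (auto intro!: tot_nonneg mult_nonneg_nonneg Phi_nonneg)
    finally have "(V * exp (- l * real n) * Z)\<^sup>2
        \<le> C1 * real q powr (D / 2) * (exp (16 * A * a\<^sup>2) * (exp (8 * a) * V))"
      using C1 by (simp add: mult_left_mono)
    \<comment> \<open>The lower volume bound turns the Cauchy-Schwarz factor
      \<open>q powr (D / 2)\<close> into a multiple of \<open>V\<close>. The other \<open>V\<close>
      is the initial energy of the indicator, and the resulting \<open>V\<^sup>2\<close> cancels
      against the left-hand side.\<close>
    also have "\<dots> \<le> C1 * (V / c) * (exp (16 * A * a\<^sup>2) * (exp (8 * a) * V))"
    proof -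
      have "real q powr (D / 2) \<le> real n powr D"
        unfolding sqrt_powr[OF q, symmetric] using n D by (intro powr_mono2) auto
      then have "real q powr (D / 2) \<le> V / c"
        using c(1) order_trans[OF mult_left_mono c(2)[OF n(1)], of "real q powr (D / 2)"]
        by (simp add: V_def pos_le_divide_eq mult.commute)
      then show ?thesis using C1 V by (intro mult_right_mono mult_left_mono) auto
    qed
    finally have "V\<^sup>2 * (exp (- l * real n) * Z)\<^sup>2
        \<le> V\<^sup>2 * (C1 * (exp (16 * A * a\<^sup>2) * exp (8 * a)) / c)"
      by (simp add: power2_eq_square mult_ac)
    then have "(exp (- l * real n) * Z)\<^sup>2 \<le> C1 * (exp (16 * A * a\<^sup>2) * exp (8 * a)) / c"
      by (rule mult_left_le_imp_le) (use V in simp)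
    then have "(exp (2 * a))\<^sup>2 * (exp (- l * real n) * Z)\<^sup>2 \<le> (exp (2 * a))\<^sup>2 * (C1 * (exp (16 * A * a\<^sup>2) * exp (8 * a)) / c)"
      by (intro mult_left_mono) auto
    also have "\<dots> = C2" by (simp add: C2_def power2_eq_square exp_add[symmetric])
    finally have 1: "(exp (2 * a) * (exp (- l * real n) * Z))\<^sup>2 \<le> C2" by (simp add: power_mult_distrib)
    have "1 * Z \<le> (exp (2 * a) * exp (- l * real n)) * Z"
      using l by (intro mult_right_mono Z0) (simp add: exp_add[symmetric])
    also have "\<dots> \<le> sqrt C2" using 1 by (intro real_le_rsqrt) (simp add: mult_ac)
    finally show "tot (\<lambda>x. Phi (a / sqrt (real q)) x * conv_power G k m x) \<le> sqrt C2"
      by (simp add: Z_def l_def u_def)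
  qed
qed


subsection \<open>Decay of the convolution powers\<close>

text \<open>Telescoping along a geodesic as for the weighted gradient; without a weight the
  translations preserve the sums, and no exponential factor arises.\<close>

lemma pseudo_Poincare:
  assumes u: "fs u" and y: "y \<in> carrier G"
  shows "tot (\<lambda>x. (diff_op G y u x)\<^sup>2) \<le> 2 * (rho y)\<^sup>2 * tot (grad2 u)"
proof -
  define E where "E = tot (grad2 u)"
  define P where "P = (\<lambda>y n. tot (\<lambda>x. (diff_op G y u x)\<^sup>2) \<le> 2 * (real n)\<^sup>2 * E)"
  have W: "tot (\<lambda>x. (diff_op G w u x)\<^sup>2) \<le> E" if w: "w \<in> W" for w
    unfolding E_def
  proof (rule tot_mono)
    fix x
    show "(diff_op G w u x)\<^sup>2 \<le> grad2 u x"
      unfolding grad2_def using fin_W w by (intro member_le_sum) auto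
  next
    show "fs (\<lambda>x. (diff_op G w u x)\<^sup>2)" by (intro fs_power2 fs_diff_op u W_carrier w)
    show "fs (grad2 u)" by (intro fs_grad2 u)
  qed
  have E0: "0 \<le> E" unfolding E_def by (intro tot_nonneg grad2_nonneg)
  have "P y (word_length G W y)"
    using y
  proof (rule word_length_induct[where P = P])
    have "tot (\<lambda>x. (diff_op G \<one> u x)\<^sup>2) = tot (\<lambda>x. 0)"
      by (rule tot_cong) (simp add: diff_op_def)
    then show "P \<one> 0" by (simp add: P_def tot_zero)
  next
    fix h w n
    assume h: "h \<in> carrier G" and n: "word_length G W h \<le> n" and w: "w \<in> W" and IH: "P h n"
    have wG: "w \<in> carrier G" using W_carrier[OF w] .
    \<comment> \<open>The choice \<open>t = n\<close> balances the two squares: \<open>(1 + n) + (1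
      + 1 / n) * 2 * n\<^sup>2 = 2 * n\<^sup>2 + 3 * n + 1\<close>, below
      \<open>2 * (n + 1)\<^sup>2\<close>. For \<open>n = 0\<close> the second square contributes
      nothing and \<open>t = 1\<close> is admissible.\<close>
    define t where "t = (if n = 0 then 1 else real n)"
    have t: "0 < t" by (simp add: t_def)
    have "tot (\<lambda>x. (diff_op G (h \<otimes> w) u x)\<^sup>2)
        \<le> tot (\<lambda>x. (1 + t) * (diff_op G w u (inv h \<otimes> x))\<^sup>2 + (1 + 1 / t) * (diff_op G h u x)\<^sup>2)"
    proof (rule tot_mono)
      fix x assume x: "x \<in> carrier G"
      define a b where "a = diff_op G w u (inv h \<otimes> x)" and "b = diff_op G h u x"
      have ab: "diff_op G (h \<otimes> w) u x = a + b"
        using h wG x by (simp add: diff_op_def inv_mult_group m_assoc a_def b_def)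
      have "0 \<le> (t * a - b)\<^sup>2 / t" using t by simp
      also have "\<dots> = t * a\<^sup>2 - 2 * a * b + b\<^sup>2 / t"
        using t by (simp add: power2_eq_square field_simps)
      finally have "(a + b)\<^sup>2 \<le> (1 + t) * a\<^sup>2 + (1 + 1 / t) * b\<^sup>2"
        by (simp add: power2_eq_square algebra_simps)
      then show "(diff_op G (h \<otimes> w) u x)\<^sup>2
          \<le> (1 + t) * (diff_op G w u (inv h \<otimes> x))\<^sup>2 + (1 + 1 / t) * (diff_op G h u x)\<^sup>2"
        by (simp add: ab a_def b_def)
    next
      show "fs (\<lambda>x. (diff_op G (h \<otimes> w) u x)\<^sup>2)" using h wG by (intro fs_power2 fs_diff_op u) auto
      show "fs (\<lambda>x. (1 + t) * (diff_op G w u (inv h \<otimes> x))\<^sup>2 + (1 + 1 / t) * (diff_op G h u x)\<^sup>2)"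
        using h wG by (intro fs_add fs_mult_right fs_power2 fs_left fs_diff_op u) auto
    qed
    also have "\<dots> = (1 + t) * tot (\<lambda>x. (diff_op G w u (inv h \<otimes> x))\<^sup>2)
        + (1 + 1 / t) * tot (\<lambda>x. (diff_op G h u x)\<^sup>2)"
      unfolding tot_cmult[symmetric]
      using h wG by (intro tot_add fs_mult_right fs_power2 fs_left fs_diff_op u) auto
    also have "tot (\<lambda>x. (diff_op G w u (inv h \<otimes> x))\<^sup>2) = tot (\<lambda>x. (diff_op G w u x)\<^sup>2)"
      using tot_left[of "inv h" "\<lambda>x. (diff_op G w u x)\<^sup>2"] h by simp
    also have "(1 + t) * tot (\<lambda>x. (diff_op G w u x)\<^sup>2) + (1 + 1 / t) * tot (\<lambda>x. (diff_op G h u x)\<^sup>2)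
        \<le> (1 + t) * E + (1 + 1 / t) * (2 * (real n)\<^sup>2 * E)"
      using t IH W[OF w] unfolding P_def by (intro add_mono mult_left_mono) auto
    also have "\<dots> = ((1 + t) + (1 + 1 / t) * (2 * (real n)\<^sup>2)) * E" by (simp add: algebra_simps)
    also have "\<dots> \<le> (2 * (real (Suc n))\<^sup>2) * E"
      by (intro mult_right_mono E0) (auto simp: t_def field_simps power2_eq_square)
    finally show "P (h \<otimes> w) (Suc n)" by (simp add: P_def)
  qed
  then show ?thesis by (simp add: P_def E_def)
qed

text \<open>A Nash-type inequality at scale \<open>n\<close>: \<open>u\<close> is compared with its
  average \<open>g\<close> over left translates by the ball. The pseudo-Poincare inequality controls
  \<open>u - g\<close>. As \<open>y\<close> varies, \<open>inv y \<otimes> x\<close> takes each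
  value once, so mass 1 gives \<open>g \<le> 1 / V\<close>; then expand
  \<open>u\<^sup>2 = (u - g)\<^sup>2 + 2 * u * g - g\<^sup>2\<close>.\<close>

lemma l2_le_grad_plus_volume:
  assumes u: "fs u" and u0: "\<And>x. x \<in> carrier G \<Longrightarrow> 0 \<le> u x" and u1: "tot u = 1"
  shows "tot (\<lambda>x. (u x)\<^sup>2) \<le> 2 * (real n)\<^sup>2 * tot (grad2 u) + 2 / real (card (ball n))"
proof -
  define V where "V = real (card (ball n))"
  have V: "0 < V" using card_ball_pos by (simp add: V_def)
  define g where "g = (\<lambda>x. (\<Sum>y\<in>ball n. u (inv y \<otimes> x)) / V)"
  have fsg: "fs g" unfolding g_def using ball_carrier[of n] by (intro fs_divide fs_sum fs_left u) auto
  have g_le: "g x \<le> 1 / V" if x: "x \<in> carrier G" for x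
  proof -
    let ?h = "\<lambda>y. u (inv y \<otimes> x)"
    have fsh: "fs ?h"
      by (rule fs_subset[OF fs_left[OF inv_closed[OF x] fs_inverse[OF u]]])
        (use x in \<open>simp add: inv_mult_group\<close>)
    have "(\<Sum>y\<in>ball n. ?h y) = tot (\<lambda>y. if y \<in> ball n then ?h y else 0)"
      using finite_ball[of n] ball_carrier[of n] by (subst tot_eq_sum[of "ball n"]) auto
    also have "\<dots> \<le> tot ?h"
      by (rule tot_mono) (use fsh u0 x in \<open>auto elim: fs_subset\<close>)
    also have "\<dots> = tot (\<lambda>y. u (inv (inv x \<otimes> y)))"
      by (rule tot_cong) (use x in \<open>simp add: inv_mult_group\<close>)
    also have "\<dots> = tot u"
      using tot_left[of "inv x" "\<lambda>y. u (inv y)"] tot_inverse[of u] x by simp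
    finally show ?thesis using V u1 by (simp add: g_def divide_right_mono)
  qed
  have diff: "tot (\<lambda>x. (u x - g x)\<^sup>2) \<le> 2 * (real n)\<^sup>2 * tot (grad2 u)"
  proof -
    have "tot (\<lambda>x. (u x - g x)\<^sup>2) \<le> tot (\<lambda>x. (1 / V) * (\<Sum>y\<in>ball n. (diff_op G y u x)\<^sup>2))"
    proof (rule tot_mono)
      fix x
      have "u x - g x = - (\<Sum>y\<in>ball n. diff_op G y u x) / V"
        using V by (simp add: g_def diff_op_def sum_subtractf V_def field_simps)
      then have "(u x - g x)\<^sup>2 = (\<Sum>y\<in>ball n. diff_op G y u x)\<^sup>2 / V\<^sup>2" by (simp add: power_divide)
      also have "\<dots> \<le> (V * (\<Sum>y\<in>ball n. (diff_op G y u x)\<^sup>2)) / V\<^sup>2"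
        using sum_squared_le_sum_of_squares[of "\<lambda>y. diff_op G y u x" "ball n"] finite_ball
        by (intro divide_right_mono) (auto simp: V_def mult.commute)
      also have "\<dots> = (1 / V) * (\<Sum>y\<in>ball n. (diff_op G y u x)\<^sup>2)"
        using V by (simp add: power2_eq_square)
      finally show "(u x - g x)\<^sup>2 \<le> (1 / V) * (\<Sum>y\<in>ball n. (diff_op G y u x)\<^sup>2)" .
    next
      show "fs (\<lambda>x. (u x - g x)\<^sup>2)" by (intro fs_power2 fs_diff u fsg)
      show "fs (\<lambda>x. (1 / V) * (\<Sum>y\<in>ball n. (diff_op G y u x)\<^sup>2))"
        using ball_carrier by (intro fs_mult_right fs_sum fs_power2 fs_diff_op u) auto
    qed
    also have "\<dots> = (1 / V) * (\<Sum>y\<in>ball n. tot (\<lambda>x. (diff_op G y u x)\<^sup>2))"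
      unfolding tot_cmult using ball_carrier
      by (subst tot_sum[OF finite_ball]) (auto intro!: fs_power2 fs_diff_op u)
    also have "\<dots> \<le> (1 / V) * (\<Sum>y\<in>ball n. 2 * (real n)\<^sup>2 * tot (grad2 u))"
    proof (intro mult_left_mono sum_mono)
      fix y assume y: "y \<in> ball n"
      have "tot (\<lambda>x. (diff_op G y u x)\<^sup>2) \<le> 2 * (rho y)\<^sup>2 * tot (grad2 u)"
        using y by (intro pseudo_Poincare u) (auto simp: ball_def)
      also have "\<dots> \<le> 2 * (real n)\<^sup>2 * tot (grad2 u)"
        using y by (intro mult_right_mono mult_left_mono power_mono tot_nonneg grad2_nonneg)
          (auto simp: ball_def)
      finally show "tot (\<lambda>x. (diff_op G y u x)\<^sup>2) \<le> 2 * (real n)\<^sup>2 * tot (grad2 u)" .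
    qed (use V in auto)
    also have "\<dots> = 2 * (real n)\<^sup>2 * tot (grad2 u)" using V by (simp add: V_def)
    finally show ?thesis .
  qed
  have "tot (\<lambda>x. 2 * (u x)\<^sup>2) \<le> tot (\<lambda>x. ((u x)\<^sup>2 + (u x - g x)\<^sup>2) + (2 / V) * u x)"
  proof (rule tot_mono)
    fix x assume x: "x \<in> carrier G"
    have "u x * g x \<le> u x * (1 / V)" by (intro mult_left_mono g_le u0 x)
    then have "0 \<le> (g x)\<^sup>2 + 2 * (u x * (1 / V) - u x * g x)" by simp
    also have "\<dots> = ((u x)\<^sup>2 + (u x - g x)\<^sup>2) + (2 / V) * u x - 2 * (u x)\<^sup>2"
      by (simp add: power2_eq_square algebra_simps)
    finally show "2 * (u x)\<^sup>2 \<le> ((u x)\<^sup>2 + (u x - g x)\<^sup>2) + (2 / V) * u x" by simp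
  next
    show "fs (\<lambda>x. 2 * (u x)\<^sup>2)" by (intro fs_mult_right fs_power2 u)
    show "fs (\<lambda>x. ((u x)\<^sup>2 + (u x - g x)\<^sup>2) + (2 / V) * u x)"
      by (intro fs_add fs_mult_right fs_power2 fs_diff u fsg)
  qed
  also have "\<dots> = tot (\<lambda>x. (u x)\<^sup>2) + tot (\<lambda>x. (u x - g x)\<^sup>2) + (2 / V) * tot u"
    unfolding tot_cmult[symmetric]
    by (subst tot_add | intro refl fs_add fs_mult_right fs_power2 fs_diff u fsg)+
  finally show ?thesis using diff by (simp add: tot_cmult u1 V_def)
qed

text \<open>At scale \<open>n\<close> the energy step and the Nash-type inequality shrink
  \<open>s m - b\<close> by \<open>1 - r\<close> per step, with \<open>b\<close> of order
  \<open>n powr (- D)\<close> and \<open>r\<close> of order \<open>1 / n\<^sup>2\<close>. Doubling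
  the scale whenever time quadruples gives every dyadic block the same contraction.\<close>

lemma conv_power_l2_decay:
  assumes growth: "has_growth_degree G W D" and c: "0 < c"
    and step: "\<And>k u. good_kernel d \<pi> \<eta> \<beta> M k \<Longrightarrow> fs u \<Longrightarrow>
      tot (\<lambda>x. (conv G k u x)\<^sup>2) + c * tot (grad2 u) \<le> tot (\<lambda>x. (u x)\<^sup>2)"
  shows "\<exists>C>0. \<forall>k m. good_kernel d \<pi> \<eta> \<beta> M k \<longrightarrow>
    tot (\<lambda>x. (conv_power G k m x)\<^sup>2) \<le> C * (real m + 1) powr (- D / 2)"
proof -
  obtain c1 where c1: "c1 > 0" "\<And>n. n \<ge> 1 \<Longrightarrow> c1 * real n powr D \<le> real (card (ball n))"
    using growth_bounds(2)[OF growth] by blast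
  have D: "0 \<le> D" by (rule growth_bounds(3)[OF growth])
  \<comment> \<open>The cap at 1 keeps \<open>r \<le> 1\<close>, so that \<open>1 - r\<close> and
    its powers are nonnegative.\<close>
  define c' where "c' = min c 1"
  have c': "0 < c'" "c' \<le> 1" "c' \<le> c" using c by (auto simp: c'_def)
  \<comment> \<open>The block after \<open>L * 4 ^ i\<close> has \<open>3 * L * 4 ^ i\<close> steps
    at scale \<open>n = 2 ^ Suc i\<close> and contracts by \<open>exp (- (3 * c' * L / 8))\<close>.
    This \<open>L\<close> makes that factor at most \<open>2 powr (- D) / 2\<close>, which outweighs
    the loss \<open>2 powr D\<close> from doubling the scale.\<close>
  define L :: nat where "L = nat \<lceil>8 * (D + 1) / (3 * c')\<rceil>"
  have L': "8 * (D + 1) / (3 * c') \<le> real L" unfolding L_def by linarith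
  moreover have "0 < 8 * (D + 1) / (3 * c')" using D c' by simp
  ultimately have L1: "L \<ge> 1" by linarith
  have L2: "exp (- (3 * c' * real L / 8)) * 2 powr D \<le> 1 / 2"
  proof -
    have "(D + 1) * ln 2 \<le> (D + 1) * 1" using D ln_2_less_1 by (intro mult_left_mono) auto
    also have "\<dots> \<le> 3 * c' * real L / 8" using L' c' by (simp add: field_simps)
    finally have "exp (- (3 * c' * real L / 8)) \<le> exp (- ((D + 1) * ln 2))" by simp
    also have "\<dots> = 2 powr (- (D + 1))" by (simp add: powr_def algebra_simps)
    finally have "exp (- (3 * c' * real L / 8)) * 2 powr D \<le> 2 powr (- (D + 1)) * 2 powr D"
      by (intro mult_right_mono) auto
    also have "\<dots> = 2 powr (- 1)" by (simp add: powr_add[symmetric])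
    finally show ?thesis by (simp add: powr_minus)
  qed
  \<comment> \<open>1 covers the start \<open>s 0 = 1\<close>, and \<open>4 / c1\<close> makes the
    volume term \<open>2 / c1\<close> at most \<open>C' / 2\<close>.\<close>
  define C' where "C' = max 1 (4 / c1)"
  have C': "1 \<le> C'" "4 / c1 \<le> C'" by (auto simp: C'_def)
  \<comment> \<open>The last factor pays for the gap between a dyadic time and \<open>m\<close>,
    where \<open>m + 1 \<le> 4 * L * 4 ^ i\<close>.\<close>
  define C where "C = C' * (4 * real L) powr (D / 2)"
  show ?thesis
  proof (intro exI[of _ C] conjI allI impI)
    show "0 < C" using C' L1 by (simp add: C_def)
    fix k and m :: nat
    assume k: "good_kernel d \<pi> \<eta> \<beta> M k"
    have fsk: "fs k" and k0: "\<And>x. x \<in> carrier G \<Longrightarrow> 0 \<le> k x" and k1: "tot k = 1"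
      using k by (auto simp: good_kernel_def)
    note pow = fs_conv_power[OF fsk] conv_power_nonneg[OF k0] tot_conv_power[OF fsk k1]
    define s where "s = (\<lambda>m. tot (\<lambda>x. (conv_power G k m x)\<^sup>2))"
    have s0: "0 \<le> s m" for m unfolding s_def by (intro tot_nonneg) auto
    have s_step: "s (Suc m) + c * tot (grad2 (conv_power G k m)) \<le> s m" for m
      unfolding s_def conv_power.simps by (intro step k pow)
    have grad0: "0 \<le> tot (grad2 u)" for u by (intro tot_nonneg grad2_nonneg)
    have s_Suc: "s (Suc m) \<le> s m" for m
      using s_step[of m] mult_nonneg_nonneg[of c, OF _ grad0[of "conv_power G k m"]] c by linarith
    have mono: "s n \<le> s m" if "m \<le> n" for m n
      using that by (rule lift_Suc_antimono_le[of s, OF s_Suc])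
    have s_0: "s 0 = 1"
    proof -
      have "s 0 = (\<Sum>x\<in>{\<one>}. (conv_power G k 0 x)\<^sup>2)" unfolding s_def by (rule tot_eq_sum) auto
      then show ?thesis by simp
    qed
    \<comment> \<open>\<open>s m - b\<close> may have either sign: the recursion is linear with
      nonnegative factor, and \<open>b\<close> is dropped only after the iteration.\<close>
    have contract: "s (m + j) \<le> 2 / (c1 * real n powr D) + exp (- (c' / (2 * (real n)\<^sup>2) * real j)) * s m"
      if n: "n \<ge> 1" for m j n
    proof -
      define b where "b = 2 / (c1 * real n powr D)"
      define r where "r = c' / (2 * (real n)\<^sup>2)"
      have b: "0 \<le> b" using c1 by (simp add: b_def)
      have n2: "1 \<le> (real n)\<^sup>2" using n by simp
      have "0 < 2 * (real n)\<^sup>2" "c' \<le> 2 * (real n)\<^sup>2" using c' n2 by linarith+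
      then have r: "0 < r" "r \<le> 1" using c' by (simp_all add: r_def)
      have one: "s (Suc m) - b \<le> (1 - r) * (s m - b)" for m
      proof -
        have "2 / real (card (ball n)) \<le> b"
          unfolding b_def using c1 n card_ball_pos[of n] by (intro divide_left_mono mult_pos_pos) auto
        then have "s m - b \<le> 2 * (real n)\<^sup>2 * tot (grad2 (conv_power G k m))"
          using l2_le_grad_plus_volume[OF pow(1) pow(2) pow(3), of m n] unfolding s_def by linarith
        then have "r * (s m - b) \<le> r * (2 * (real n)\<^sup>2 * tot (grad2 (conv_power G k m)))"
          using r by (intro mult_left_mono) auto
        also have "\<dots> = c' * tot (grad2 (conv_power G k m))" using n by (simp add: r_def)
        also have "\<dots> \<le> c * tot (grad2 (conv_power G k m))" using c' grad0 by (intro mult_right_mono) auto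
        finally show ?thesis using s_step[of m] by (simp add: algebra_simps)
      qed
      have "s (m + j) - b \<le> (1 - r) ^ j * (s m - b)"
      proof (induction j)
        case (Suc j)
        have "s (m + Suc j) - b \<le> (1 - r) * (s (m + j) - b)" using one[of "m + j"] by simp
        also have "\<dots> \<le> (1 - r) * ((1 - r) ^ j * (s m - b))" using r Suc by (intro mult_left_mono) auto
        finally show ?case by simp
      qed simp
      also have "\<dots> \<le> (1 - r) ^ j * s m" using r b by (intro mult_left_mono) auto
      also have "\<dots> \<le> exp (- r) ^ j * s m"
        using r exp_ge_add_one_self[of "- r"] by (intro mult_right_mono power_mono s0) auto
      also have "exp (- r) ^ j = exp (- (r * real j))"
        by (simp add: exp_of_nat_mult[symmetric] mult.commute)
      finally show ?thesis by (simp add: b_def r_def)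
    qed
    have dyadic: "s (L * 4 ^ i) \<le> C' * (2 ^ i) powr (- D)" for i :: nat
    proof (induction i)
      case 0
      then show ?case using mono[of 0 L] C' s_0 by simp
    next
      case (Suc i)
      define n :: nat where "n = 2 ^ Suc i"
      define j where "j = 3 * (L * 4 ^ i)"
      have n: "n \<ge> 1" by (simp add: n_def)
      have n2: "(real n)\<^sup>2 = 4 * 4 ^ i"
        by (simp add: n_def power2_eq_square power_mult_distrib[symmetric])
      have Lj: "L * 4 ^ Suc i = L * 4 ^ i + j" by (simp add: j_def)
      have e: "c' / (2 * (real n)\<^sup>2) * real j = 3 * c' * real L / 8"
        unfolding n2 j_def by simp
      have p: "(2 ^ i :: real) powr (- D) = 2 powr D * real n powr (- D)"
        by (simp add: n_def powr_mult powr_minus field_simps)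
      have "s (L * 4 ^ Suc i) \<le> 2 / (c1 * real n powr D) + exp (- (3 * c' * real L / 8)) * s (L * 4 ^ i)"
        unfolding Lj e[symmetric] by (rule contract[OF n])
      also have "\<dots> \<le> 2 / (c1 * real n powr D) + exp (- (3 * c' * real L / 8)) * (C' * (2 ^ i) powr (- D))"
        using Suc by (intro add_left_mono mult_left_mono) auto
      also have "\<dots> = 2 / c1 * real n powr (- D)
          + (exp (- (3 * c' * real L / 8)) * 2 powr D) * (C' * real n powr (- D))"
        unfolding p by (simp add: powr_minus field_simps)
      also have "\<dots> \<le> C' / 2 * real n powr (- D) + 1 / 2 * (C' * real n powr (- D))"
        using C' L2 by (intro add_mono mult_right_mono) auto
      also have "\<dots> = C' * real n powr (- D)" by simp
      finally show ?case by (simp add: n_def)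
    qed
    show "tot (\<lambda>x. (conv_power G k m x)\<^sup>2) \<le> C * (real m + 1) powr (- D / 2)"
    proof -
      \<comment> \<open>\<open>i\<close> belongs to the last dyadic time before \<open>m\<close>;
        times below \<open>L\<close> use \<open>i = 0\<close> and
        \<open>s m \<le> 1\<close>.\<close>
      have key: "s m \<le> C * (real m + 1) powr (- D / 2)"
        if "s m \<le> C' * (4 ^ i) powr (- D / 2)" and "m + 1 \<le> 4 * L * 4 ^ i" for i :: nat
      proof -
        have "real (m + 1) \<le> real (4 * L * 4 ^ i)" using that(2) unfolding of_nat_le_iff .
        then have "(real m + 1) / (4 * real L) \<le> 4 ^ i" using L1 by (simp add: field_simps)
        then have "(4 ^ i :: real) powr (- D / 2) \<le> ((real m + 1) / (4 * real L)) powr (- D / 2)"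
          using D L1 by (intro powr_mono2') auto
        also have "\<dots> = (4 * real L) powr (D / 2) * (real m + 1) powr (- D / 2)"
          using L1 by (simp add: powr_divide powr_minus field_simps)
        finally have "C' * (4 ^ i) powr (- D / 2) \<le> C' * ((4 * real L) powr (D / 2) * (real m + 1) powr (- D / 2))"
          using C' by (intro mult_left_mono) auto
        then show ?thesis using that(1) by (simp add: C_def)
      qed
      have "s m \<le> C * (real m + 1) powr (- D / 2)"
      proof (cases "m < L")
        case True
        then show ?thesis using key[of 0] mono[of 0 m] s_0 C' L1 by simp
      next
        case False
        then have "m div L \<ge> 1" using L1 by (simp add: div_greater_zero_iff Suc_le_eq)
        then obtain i where i: "4 ^ i \<le> m div L" "m div L < 4 ^ (i + 1)"
          using ex_power_ivl1[of 4 "m div L"] by auto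
        have "L * 4 ^ i \<le> m"
          using i(1) L1 by (metis less_eq_div_iff_mult_less_eq mult.commute zero_less_one order_less_le_trans)
        moreover have "m < 4 ^ (i + 1) * L" using i(2) L1 by (simp add: div_less_iff_less_mult)
        moreover have "(2 ^ i :: real) powr (- D) = (4 ^ i) powr (- D / 2)"
        proof -
          have "(4 ^ i :: real) = (2 ^ i)\<^sup>2" by (simp add: power2_eq_square power_mult_distrib[symmetric])
          also have "\<dots> = (2 ^ i) powr 2" by simp
          finally have "(4 ^ i :: real) powr (- D / 2) = ((2 ^ i) powr 2) powr (- D / 2)" by (rule arg_cong)
          also have "\<dots> = (2 ^ i) powr (- D)" unfolding powr_powr by simp
          finally show ?thesis by simp
        qed
        ultimately show ?thesis using key[of i] dyadic[of i] mono[of "L * 4 ^ i" m] by (simp add: mult_ac)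
      qed
      then show ?thesis by (simp add: s_def)
    qed
  qed
qed

text \<open>Cauchy-Schwarz for the convolution of two halves. Inversion and translation preserve
  sums of squares, so the right half is controlled without symmetry of \<open>k\<close>. Thanks to
  the shift in \<open>real m + 1\<close> both halves of \<open>q\<close>, odd or even, satisfy
  \<open>(q + 1) / 2 \<le> m + 1\<close>.\<close>

lemma conv_power_sup_decay:
  assumes k: "fs k" "\<And>x. x \<in> carrier G \<Longrightarrow> 0 \<le> k x" and D: "0 \<le> D" and C: "0 < C"
    and decay: "\<And>m. tot (\<lambda>x. (conv_power G k m x)\<^sup>2) \<le> C * (real m + 1) powr (- D / 2)"
    and x: "x \<in> carrier G"
  shows "conv_power G k q x \<le> C * 2 powr (D / 2) * (real q + 1) powr (- D / 2)"
proof -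
  define m where "m = q div 2"
  define n where "n = q - m"
  have q: "q = m + n" by (simp add: m_def n_def)
  have mn: "(real q + 1) / 2 \<le> real m + 1" "(real q + 1) / 2 \<le> real n + 1"
    by (auto simp: m_def n_def)
  define h where "h = (\<lambda>y. conv_power G k n (inv y \<otimes> x))"
  have fsh: "fs h"
    by (rule fs_subset[OF fs_left[OF inv_closed[OF x] fs_inverse[OF fs_conv_power[OF k(1)]]]])
      (use x in \<open>simp add: inv_mult_group h_def\<close>)
  have h2: "tot (\<lambda>y. (h y)\<^sup>2) = tot (\<lambda>y. (conv_power G k n y)\<^sup>2)"
  proof -
    have "tot (\<lambda>y. (h y)\<^sup>2) = tot (\<lambda>y. (conv_power G k n (inv (inv x \<otimes> y)))\<^sup>2)"
      by (rule tot_cong) (use x in \<open>simp add: inv_mult_group h_def\<close>)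
    then show ?thesis
      using tot_left[of "inv x" "\<lambda>y. (conv_power G k n (inv y))\<^sup>2"]
        tot_inverse[of "\<lambda>y. (conv_power G k n y)\<^sup>2"] x by simp
  qed
  define e where "e = C * ((real q + 1) / 2) powr (- D / 2)"
  have le: "tot (\<lambda>y. (conv_power G k j y)\<^sup>2) \<le> e" if "(real q + 1) / 2 \<le> real j + 1" for j
  proof -
    have "(real j + 1) powr (- D / 2) \<le> ((real q + 1) / 2) powr (- D / 2)"
      using D that by (intro powr_mono2') auto
    then show ?thesis unfolding e_def using decay[of j] C by (meson mult_left_mono order_trans less_imp_le)
  qed
  have "conv_power G k q x = tot (\<lambda>y. conv_power G k m y * h y)"
    unfolding q using conv_power_add[OF k(1) x, of m n] by (simp add: conv_eq_tot h_def)
  then have "(conv_power G k q x)\<^sup>2 \<le> tot (\<lambda>y. (conv_power G k m y)\<^sup>2) * tot (\<lambda>y. (h y)\<^sup>2)"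
    using tot_Cauchy_Schwarz[OF fs_conv_power[OF k(1)] fsh] by simp
  also have "\<dots> \<le> e * e"
    unfolding h2 using le[OF mn(1)] le[OF mn(2)] C by (intro mult_mono tot_nonneg) (auto simp: e_def)
  finally have "(conv_power G k q x)\<^sup>2 \<le> e\<^sup>2" by (simp add: power2_eq_square)
  then have "conv_power G k q x \<le> e" by (rule power2_le_imp_le) (use C in \<open>simp add: e_def\<close>)
  also have "e = C * 2 powr (D / 2) * (real q + 1) powr (- D / 2)"
    by (simp add: e_def powr_divide powr_minus field_simps)
  finally show ?thesis .
qed

text \<open>\<open>Phi s\<close> is submultiplicative, so the weight at \<open>x\<close> splits into
  one at \<open>y\<close> and one at \<open>inv y \<otimes> x\<close>, to be taken up by the two
  factors. What remains is the unweighted Young inequality for \<open>F\<close> and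
  \<open>H\<close>.\<close>

lemma Young_l2:
  assumes f: "fs f" and g: "fs g" "\<And>x. x \<in> carrier G \<Longrightarrow> 0 \<le> g x" and s: "0 \<le> s"
  shows "tot (\<lambda>x. Phi (2 * s) x * (conv G f g x)\<^sup>2)
    \<le> (tot (\<lambda>x. Phi s x * g x))\<^sup>2 * tot (\<lambda>x. Phi (2 * s) x * (f x)\<^sup>2)"
proof -
  define F where "F = (\<lambda>x. Phi s x * \<bar>f x\<bar>)"
  define H where "H = (\<lambda>x. Phi s x * g x)"
  have fsF: "fs F" unfolding F_def by (intro fs_mult_right fs_abs f)
  have fsH: "fs H" unfolding H_def by (intro fs_mult_right g)
  have F2: "tot (\<lambda>x. (F x)\<^sup>2) = tot (\<lambda>x. Phi (2 * s) x * (f x)\<^sup>2)"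
    by (rule tot_cong) (simp add: F_def power_mult_distrib Phi_power2)
  have H0: "0 \<le> H x" if "x \<in> carrier G" for x
    unfolding H_def by (intro mult_nonneg_nonneg Phi_nonneg g that)
  have tH: "0 \<le> tot H" by (intro tot_nonneg H0)
  have "tot (\<lambda>x. Phi (2 * s) x * (conv G f g x)\<^sup>2) \<le> tot (\<lambda>x. tot H * conv G (\<lambda>x. (F x)\<^sup>2) H x)"
  proof (rule tot_mono)
    fix x assume x: "x \<in> carrier G"
    define h where "h = (\<lambda>y. H (inv y \<otimes> x))"
    have fsh: "fs h"
      by (rule fs_subset[OF fs_left[OF inv_closed[OF x] fs_inverse[OF fsH]]])
        (use x in \<open>simp add: inv_mult_group h_def\<close>)
    have h0: "0 \<le> h y" if "y \<in> carrier G" for y unfolding h_def using that x by (intro H0) auto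
    have th: "tot h = tot H"
    proof -
      have "tot h = tot (\<lambda>y. H (inv (inv x \<otimes> y)))"
        by (rule tot_cong) (use x in \<open>simp add: inv_mult_group h_def\<close>)
      then show ?thesis using tot_left[of "inv x" "\<lambda>y. H (inv y)"] tot_inverse[of H] x by simp
    qed
    have "\<bar>Phi s x * conv G f g x\<bar> = \<bar>tot (\<lambda>y. Phi s x * (f y * g (inv y \<otimes> x)))\<bar>"
      by (simp add: conv_eq_tot tot_cmult)
    also have "\<dots> \<le> tot (\<lambda>y. \<bar>Phi s x * (f y * g (inv y \<otimes> x))\<bar>)"
      by (intro abs_tot_le fs_mult_right[OF fs_mult_left[OF f]])
    also have "\<dots> \<le> tot (\<lambda>y. F y * h y)"
    proof (rule tot_mono)
      fix y assume y: "y \<in> carrier G"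
      have "y \<otimes> (inv y \<otimes> x) = x" using x y by (simp add: m_assoc[symmetric])
      then have "Phi s x \<le> Phi s y * Phi s (inv y \<otimes> x)"
        using Phi_mult_le[OF s y, of "inv y \<otimes> x"] x y by simp
      then have "Phi s x * (\<bar>f y\<bar> * g (inv y \<otimes> x)) \<le> (Phi s y * Phi s (inv y \<otimes> x)) * (\<bar>f y\<bar> * g (inv y \<otimes> x))"
        using x y by (intro mult_right_mono mult_nonneg_nonneg g) auto
      then show "\<bar>Phi s x * (f y * g (inv y \<otimes> x))\<bar> \<le> F y * h y"
        using g(2)[of "inv y \<otimes> x"] x y by (simp add: abs_mult Phi_nonneg F_def h_def H_def mult_ac)
    next
      show "fs (\<lambda>y. \<bar>Phi s x * (f y * g (inv y \<otimes> x))\<bar>)" by (intro fs_abs fs_mult_right[OF fs_mult_left[OF f]])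
      show "fs (\<lambda>y. F y * h y)" by (intro fs_mult_left fsF)
    qed
    finally have "(Phi s x * conv G f g x)\<^sup>2 \<le> (tot (\<lambda>y. F y * h y))\<^sup>2"
      by (metis abs_ge_zero power2_abs power_mono)
    \<comment> \<open>Cauchy-Schwarz for the measure with density \<open>h\<close>, whose total mass
      is \<open>tot H\<close>.\<close>
    also have "tot (\<lambda>y. F y * h y) = tot (\<lambda>y. (F y * sqrt (h y)) * sqrt (h y))"
      by (rule tot_cong) (simp add: h0 mult.assoc)
    also have "\<dots>\<^sup>2 \<le> tot (\<lambda>y. (F y * sqrt (h y))\<^sup>2) * tot (\<lambda>y. (sqrt (h y))\<^sup>2)"
    proof (rule tot_Cauchy_Schwarz)
      show "fs (\<lambda>y. F y * sqrt (h y))" by (intro fs_mult_left fsF)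
      show "fs (\<lambda>y. sqrt (h y))" by (rule fs_subset[OF fsh]) simp
    qed
    also have "tot (\<lambda>y. (sqrt (h y))\<^sup>2) = tot H"
      unfolding th[symmetric] by (rule tot_cong) (simp add: h0)
    also have "tot (\<lambda>y. (F y * sqrt (h y))\<^sup>2) = conv G (\<lambda>x. (F x)\<^sup>2) H x"
      unfolding conv_eq_tot by (rule tot_cong) (use h0 in \<open>simp add: power_mult_distrib h_def\<close>)
    finally show "Phi (2 * s) x * (conv G f g x)\<^sup>2 \<le> tot H * conv G (\<lambda>x. (F x)\<^sup>2) H x"
      by (simp add: power_mult_distrib Phi_power2 mult.commute)
  next
    show "fs (\<lambda>x. Phi (2 * s) x * (conv G f g x)\<^sup>2)" by (intro fs_mult_right fs_power2 fs_conv f g)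
    show "fs (\<lambda>x. tot H * conv G (\<lambda>x. (F x)\<^sup>2) H x)" by (intro fs_mult_right fs_conv fs_power2 fsF fsH)
  qed
  also have "\<dots> = tot H * (tot (\<lambda>x. (F x)\<^sup>2) * tot H)"
    by (simp add: tot_cmult tot_conv fs_power2 fsF fsH)
  finally show ?thesis unfolding F2 by (simp add: power2_eq_square H_def mult_ac)
qed


subsection \<open>Weighted bounds for the convolution powers and their differences\<close>

text \<open>The energy inequality controls gradients only in sum over time, and no monotonicity in
  time is at hand; hence the detour through one well-chosen time.\<close>

lemma weighted_bounds:
  assumes \<pi>: "free_abelian_projection G d \<pi>" and \<eta>: "0 < \<eta>" and \<beta>: "0 < \<beta>"
    and growth: "has_growth_degree G W D"
  shows "\<exists>a>0. \<exists>C>0. \<forall>k (q::nat) h. good_kernel d \<pi> \<eta> \<beta> M k \<longrightarrow> q \<ge> 1 \<longrightarrow> h \<in> W \<longrightarrow>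
    tot (\<lambda>x. Phi (2 * (a / sqrt (real q))) x * (conv_power G k q x)\<^sup>2) \<le> C * real q powr (- D / 2) \<and>
    tot (\<lambda>x. Phi (2 * (a / sqrt (real q))) x * (diff_op G h (conv_power G k q) x)\<^sup>2)
      \<le> C * real q powr (- 1 - D / 2)"
proof -
  obtain \<theta>0 c A where \<theta>0: "0 < \<theta>0" and c: "0 < c" and A: "0 \<le> A"
    and step': "\<forall>k \<theta> u. good_kernel d \<pi> \<eta> \<beta> M k \<longrightarrow> 0 \<le> \<theta> \<longrightarrow> \<theta> \<le> \<theta>0 \<longrightarrow> fs u \<longrightarrow>
      tot (\<lambda>x. Phi \<theta> x * (conv G k u x)\<^sup>2) + c * tot (\<lambda>x. Phi \<theta> x * grad2 u x)
        \<le> (1 + A * \<theta>\<^sup>2) * tot (\<lambda>x. Phi \<theta> x * (u x)\<^sup>2)"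
    using energy_step[OF \<pi> \<eta> \<beta>, of M] by (elim exE conjE) (rule that)
  note step = step'[rule_format]
  have D: "0 \<le> D" by (rule growth_bounds(3)[OF growth])
  have wgrad0: "0 \<le> tot (\<lambda>x. Phi \<theta> x * grad2 u x)" for \<theta> u
    by (intro tot_nonneg mult_nonneg_nonneg Phi_nonneg grad2_nonneg)
  have step0: "tot (\<lambda>x. (conv G k u x)\<^sup>2) + c * tot (grad2 u) \<le> tot (\<lambda>x. (u x)\<^sup>2)"
    if "good_kernel d \<pi> \<eta> \<beta> M k" "fs u" for k u
    using step[OF that(1), of 0 u] that \<theta>0 by (simp add: Phi_def)
  have step1: "tot (\<lambda>x. Phi \<theta> x * (conv G k u x)\<^sup>2) \<le> (1 + A * \<theta>\<^sup>2) * tot (\<lambda>x. Phi \<theta> x * (u x)\<^sup>2)"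
    if "good_kernel d \<pi> \<eta> \<beta> M k" "0 \<le> \<theta>" "\<theta> \<le> \<theta>0" "fs u" for k \<theta> u
    using step[OF that] mult_nonneg_nonneg[of c, OF _ wgrad0[of \<theta> u]] c by linarith
  have moment: "\<exists>C>0. \<forall>k (q::nat) m. good_kernel d \<pi> \<eta> \<beta> M k \<longrightarrow> q \<ge> 1 \<longrightarrow> m \<le> q \<longrightarrow>
      tot (\<lambda>x. Phi (b / sqrt (real q)) x * conv_power G k m x) \<le> C"
    if b: "0 < b" "4 * b \<le> \<theta>0" for b
    by (rule exp_moment_bound[OF growth A step1 b])
  have decay: "\<exists>C>0. \<forall>k m. good_kernel d \<pi> \<eta> \<beta> M k \<longrightarrow>
      tot (\<lambda>x. (conv_power G k m x)\<^sup>2) \<le> C * (real m + 1) powr (- D / 2)"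
    by (rule conv_power_l2_decay[OF growth c step0])
  \<comment> \<open>The moment bound at rate \<open>b\<close> asks for
    \<open>4 * b \<le> \<theta>0\<close>, and the weighted squares need it at rate
    \<open>2 * a\<close>.\<close>
  define a where "a = \<theta>0 / 8"
  have a: "0 < a" "0 < 2 * a" "4 * (2 * a) \<le> \<theta>0" "4 * a \<le> \<theta>0" "2 * a \<le> \<theta>0" using \<theta>0 by (auto simp: a_def)
  obtain C1 where C1: "0 < C1" and C1': "\<forall>k (q::nat) m. good_kernel d \<pi> \<eta> \<beta> M k \<longrightarrow> q \<ge> 1 \<longrightarrow> m \<le> q \<longrightarrow>
      tot (\<lambda>x. Phi (a / sqrt (real q)) x * conv_power G k m x) \<le> C1"
    using moment[OF a(1,4)] by (elim exE conjE) (rule that)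
  obtain C2 where C2: "0 < C2" and C2': "\<forall>k (q::nat) m. good_kernel d \<pi> \<eta> \<beta> M k \<longrightarrow> q \<ge> 1 \<longrightarrow> m \<le> q \<longrightarrow>
      tot (\<lambda>x. Phi (2 * a / sqrt (real q)) x * conv_power G k m x) \<le> C2"
    using moment[OF a(2,3)] by (elim exE conjE) (rule that)
  obtain C3 where C3: "0 < C3" and C3': "\<forall>k m. good_kernel d \<pi> \<eta> \<beta> M k \<longrightarrow>
      tot (\<lambda>x. (conv_power G k m x)\<^sup>2) \<le> C3 * (real m + 1) powr (- D / 2)"
    using decay by (elim exE conjE) (rule that)
  define C4 where "C4 = C3 * 2 powr (D / 2) * C2"
  have C4: "0 < C4" using C2 C3 by (simp add: C4_def)
  \<comment> \<open>Supremum times weighted mass, for all \<open>m \<le> q\<close> with the weight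
    of the final time \<open>q\<close>.\<close>
  have S: "tot (\<lambda>x. Phi (2 * a / sqrt (real q)) x * (conv_power G k m x)\<^sup>2) \<le> C4 * (real m + 1) powr (- D / 2)"
    if k: "good_kernel d \<pi> \<eta> \<beta> M k" and q: "q \<ge> 1" and m: "m \<le> q" for k and q m :: nat
  proof -
    have fsk: "fs k" and k0: "\<And>x. x \<in> carrier G \<Longrightarrow> 0 \<le> k x"
      using k by (auto simp: good_kernel_def)
    define e where "e = C3 * 2 powr (D / 2) * (real m + 1) powr (- D / 2)"
    have "tot (\<lambda>x. Phi (2 * a / sqrt (real q)) x * (conv_power G k m x)\<^sup>2)
        \<le> tot (\<lambda>x. e * (Phi (2 * a / sqrt (real q)) x * conv_power G k m x))"
    proof (rule tot_mono)
      fix x assume x: "x \<in> carrier G"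
      have "conv_power G k m x \<le> e"
        unfolding e_def by (rule conv_power_sup_decay[OF fsk k0 D C3 C3'[rule_format, OF k] x])
      then have "conv_power G k m x * conv_power G k m x \<le> e * conv_power G k m x"
        using conv_power_nonneg[OF k0 x] by (intro mult_right_mono)
      then have "Phi (2 * a / sqrt (real q)) x * (conv_power G k m x * conv_power G k m x)
          \<le> Phi (2 * a / sqrt (real q)) x * (e * conv_power G k m x)"
        by (intro mult_left_mono Phi_nonneg)
      then show "Phi (2 * a / sqrt (real q)) x * (conv_power G k m x)\<^sup>2
          \<le> e * (Phi (2 * a / sqrt (real q)) x * conv_power G k m x)"
        by (simp add: power2_eq_square mult_ac)
    next
      show "fs (\<lambda>x. Phi (2 * a / sqrt (real q)) x * (conv_power G k m x)\<^sup>2)"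
        by (intro fs_mult_right fs_power2 fs_conv_power fsk)
      show "fs (\<lambda>x. e * (Phi (2 * a / sqrt (real q)) x * conv_power G k m x))"
        by (intro fs_mult_right fs_conv_power fsk)
    qed
    also have "\<dots> \<le> e * C2"
      unfolding tot_cmult using C3 by (intro mult_left_mono C2'[rule_format, OF k q m]) (auto simp: e_def)
    finally show ?thesis by (simp add: C4_def e_def mult_ac)
  qed
  \<comment> \<open>With \<open>\<theta> = 2 * a / sqrt q\<close> the growth
    \<open>A * \<theta>\<^sup>2\<close> per step is \<open>r / q\<close>, in total at most a factor
    \<open>exp r\<close>.\<close>
  define r where "r = 4 * A * a\<^sup>2"
  \<comment> \<open>\<open>(1 + r) * exp r\<close> is the energy supply of the second half in units
    of \<open>s p\<close>, \<open>C4 * 2 powr (D / 2)\<close> bounds \<open>s p\<close> itself, and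
    \<open>2 / c\<close> reflects that at least \<open>q / 2\<close> times share it.\<close>
  define C5 where "C5 = (1 + r) * exp r * C4 * 2 powr (D / 2) * 2 / c"
  have r: "0 \<le> r" using A by (simp add: r_def)
  have C5: "0 < C5" using r C4 c by (simp add: C5_def add_pos_nonneg)
  define C where "C = C4 + C1\<^sup>2 * C5"
  show ?thesis
  proof (rule exI[of _ a], intro conjI a(1), rule exI[of _ C], intro conjI allI impI)
    show "0 < C" using C4 C5 by (simp add: C_def add_pos_nonneg)
    fix k and q :: nat and h
    assume k: "good_kernel d \<pi> \<eta> \<beta> M k" and q: "q \<ge> 1" and h: "h \<in> W"
    have fsk: "fs k" and k0: "\<And>x. x \<in> carrier G \<Longrightarrow> 0 \<le> k x"
      using k by (auto simp: good_kernel_def)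
    note fsu = fs_conv_power[OF fsk]
    have hG: "h \<in> carrier G" by (rule W_carrier[OF h])
    define \<theta> where "\<theta> = 2 * a / sqrt (real q)"
    have \<theta>_eq: "2 * (a / sqrt (real q)) = \<theta>" by (simp add: \<theta>_def)
    have "\<theta> \<le> 2 * a" using a q by (simp add: \<theta>_def field_simps)
    then have \<theta>: "0 \<le> \<theta>" "\<theta> \<le> \<theta>0" using a by (auto simp: \<theta>_def)
    have A\<theta>: "A * \<theta>\<^sup>2 = r / real q" using q by (simp add: \<theta>_def r_def power_divide power_mult_distrib)
    show "tot (\<lambda>x. Phi (2 * (a / sqrt (real q))) x * (conv_power G k q x)\<^sup>2) \<le> C * real q powr (- D / 2)"
    proof -
      have "tot (\<lambda>x. Phi \<theta> x * (conv_power G k q x)\<^sup>2) \<le> C4 * (real q + 1) powr (- D / 2)"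
        unfolding \<theta>_def by (rule S[OF k q]) simp
      also have "\<dots> \<le> C * real q powr (- D / 2)"
        using q D C4 C5 by (intro mult_mono powr_mono2') (auto simp: C_def)
      finally show ?thesis unfolding \<theta>_eq .
    qed
    define s where "s = (\<lambda>m. tot (\<lambda>x. Phi \<theta> x * (conv_power G k m x)\<^sup>2))"
    define g where "g = (\<lambda>m. tot (\<lambda>x. Phi \<theta> x * grad2 (conv_power G k m) x))"
    have s0: "0 \<le> s m" for m unfolding s_def by (intro tot_nonneg mult_nonneg_nonneg Phi_nonneg) auto
    have g0: "0 \<le> g m" for m unfolding g_def by (rule wgrad0)
    have s_step: "s (Suc m) + c * g m \<le> (1 + r / real q) * s m" for m
      using step[OF k \<theta> fsu, of m] unfolding A\<theta> by (simp add: s_def g_def)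
    define p where "p = q div 2"
    have grow: "s (p + j) \<le> exp (r * real j / real q) * s p" for j
    proof (induction j)
      case (Suc j)
      have "s (p + Suc j) \<le> (1 + r / real q) * s (p + j)"
        using s_step[of "p + j"] mult_nonneg_nonneg[of c, OF _ g0[of "p + j"]] c by simp
      also have "\<dots> \<le> exp (r / real q) * (exp (r * real j / real q) * s p)"
        using exp_ge_add_one_self[of "r / real q"] Suc s0 by (intro mult_mono) auto
      also have "\<dots> = exp (r * real (Suc j) / real q) * s p"
        by (simp add: exp_add[symmetric] algebra_simps add_divide_distrib)
      finally show ?case .
    qed simp
    have sum: "s (p + j) + c * (\<Sum>i<j. g (p + i)) \<le> s p + r / real q * (\<Sum>i<j. s (p + i))" for j
    proof (induction j)
      case (Suc j)
      then show ?case using s_step[of "p + j"] by (simp add: algebra_simps)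
    qed simp
    define j where "j = q - p"
    have j: "1 \<le> j" "real q \<le> 2 * real j" "real j \<le> real q" using q by (auto simp: j_def p_def)
    have "c * (\<Sum>i<j. g (p + i)) \<le> s p + r / real q * (\<Sum>i<j. s (p + i))"
      using sum[of j] s0[of "p + j"] by linarith
    also have "\<dots> \<le> s p + r / real q * (\<Sum>i<j. exp r * s p)"
    proof (intro add_left_mono mult_left_mono sum_mono)
      fix i assume "i \<in> {..<j}"
      then have "real i \<le> real q" using j by auto
      then have "r * real i / real q \<le> r" using r q by (simp add: field_simps mult_left_mono)
      then have "exp (r * real i / real q) * s p \<le> exp r * s p" by (intro mult_right_mono s0) auto
      then show "s (p + i) \<le> exp r * s p" using grow[of i] by linarith
    qed (use r in auto)
    also have "\<dots> = s p + (real j / real q) * (r * exp r * s p)" by simp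
    also have "\<dots> \<le> exp r * s p + 1 * (r * exp r * s p)"
      using r j q s0 mult_right_mono[of 1 "exp r" "s p"] by (intro add_mono mult_right_mono) auto
    also have "\<dots> = (1 + r) * exp r * s p" by (simp add: algebra_simps)
    finally have total: "c * (\<Sum>i<j. g (p + i)) \<le> (1 + r) * exp r * s p" .
    \<comment> \<open>Some gradient is at most the average over the \<open>j\<close> times, and
      \<open>j \<ge> 1\<close> even for \<open>q = 1\<close>.\<close>
    obtain i where i: "i < j" "real j * g (p + i) \<le> (\<Sum>i<j. g (p + i))"
    proof (rule ccontr)
      assume "\<not> thesis"
      then have "\<And>i. i < j \<Longrightarrow> (\<Sum>i<j. g (p + i)) / real j < g (p + i)"
        using that j by (force simp: field_simps not_le)
      then have "(\<Sum>i<j. (\<Sum>i<j. g (p + i)) / real j) < (\<Sum>i<j. g (p + i))"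
        using j by (intro sum_strict_mono) (auto simp: lessThan_empty_iff)
      then show False using j by simp
    qed
    define m where "m = p + i"
    have m: "m < q" using i by (simp add: m_def j_def)
    have "real q / 2 * (c * g m) \<le> real j * (c * g m)"
      using j c g0 by (intro mult_right_mono mult_nonneg_nonneg) auto
    also have "\<dots> \<le> c * (\<Sum>i<j. g (p + i))"
      using i c by (simp add: m_def mult.left_commute[of _ c])
    also have "\<dots> \<le> (1 + r) * exp r * s p" by (rule total)
    also have "\<dots> \<le> (1 + r) * exp r * (C4 * (2 powr (D / 2) * real q powr (- D / 2)))"
    proof (intro mult_left_mono)
      have "s p \<le> C4 * (real p + 1) powr (- D / 2)"
        unfolding s_def \<theta>_def by (rule S[OF k q]) (simp add: p_def)
      also have "(real p + 1) powr (- D / 2) \<le> (real q / 2) powr (- D / 2)"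
        using q D by (intro powr_mono2') (auto simp: p_def)
      also have "(real q / 2) powr (- D / 2) = 2 powr (D / 2) * real q powr (- D / 2)"
        by (simp add: powr_divide powr_minus field_simps)
      finally show "s p \<le> C4 * (2 powr (D / 2) * real q powr (- D / 2))" using C4 by simp
    qed (use r in auto)
    finally have "g m \<le> C5 * (real q powr (- D / 2) / real q)"
      using q c by (simp add: C5_def field_simps)
    also have "real q powr (- D / 2) / real q = real q powr (- 1 - D / 2)"
    proof -
      have "- 1 - D / 2 = - D / 2 - 1" by simp
      then show ?thesis using q by (simp only: powr_diff) simp
    qed
    finally have gm: "g m \<le> C5 * real q powr (- 1 - D / 2)" .
    define f where "f = diff_op G h (conv_power G k m)"
    define u where "u = conv_power G k (q - m)"
    have fsf: "fs f" unfolding f_def by (intro fs_diff_op hG fsu)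
    have "tot (\<lambda>x. Phi \<theta> x * (diff_op G h (conv_power G k q) x)\<^sup>2)
        = tot (\<lambda>x. Phi (2 * (a / sqrt (real q))) x * (conv G f u x)\<^sup>2)"
    proof (rule tot_cong)
      fix x assume x: "x \<in> carrier G"
      have "conv_power G k q y = conv G (conv_power G k m) u y" if "y \<in> carrier G" for y
        using conv_power_add[OF fsk that, of m "q - m"] m by (simp add: u_def)
      then have "diff_op G h (conv_power G k q) x = diff_op G h (conv G (conv_power G k m) u) x"
        using x hG by (simp add: diff_op_def)
      also have "\<dots> = conv G f u x" unfolding f_def by (rule diff_op_conv[OF fsu hG x])
      finally show "Phi \<theta> x * (diff_op G h (conv_power G k q) x)\<^sup>2
          = Phi (2 * (a / sqrt (real q))) x * (conv G f u x)\<^sup>2"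
        unfolding \<theta>_eq by simp
    qed
    also have "\<dots> \<le> (tot (\<lambda>x. Phi (a / sqrt (real q)) x * u x))\<^sup>2
        * tot (\<lambda>x. Phi (2 * (a / sqrt (real q))) x * (f x)\<^sup>2)"
      by (rule Young_l2[OF fsf]) (use fsu conv_power_nonneg[OF k0] a in \<open>auto simp: u_def\<close>)
    \<comment> \<open>The late factors cost one moment bound; it applies because it was proved for
      all powers up to \<open>q\<close>, in particular \<open>q - m\<close>.\<close>
    also have "\<dots> \<le> C1\<^sup>2 * g m"
    proof (rule mult_mono)
      have "0 \<le> tot (\<lambda>x. Phi (a / sqrt (real q)) x * u x)"
        unfolding u_def by (intro tot_nonneg mult_nonneg_nonneg Phi_nonneg conv_power_nonneg[OF k0])
      then show "(tot (\<lambda>x. Phi (a / sqrt (real q)) x * u x))\<^sup>2 \<le> C1\<^sup>2"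
        unfolding u_def using C1'[rule_format, OF k q] by (intro power_mono) auto
      show "tot (\<lambda>x. Phi (2 * (a / sqrt (real q))) x * (f x)\<^sup>2) \<le> g m"
        unfolding \<theta>_eq g_def
      proof (rule tot_mono)
        fix x
        have "(f x)\<^sup>2 \<le> grad2 (conv_power G k m) x"
          unfolding grad2_def f_def using fin_W h by (intro member_le_sum) auto
        then show "Phi \<theta> x * (f x)\<^sup>2 \<le> Phi \<theta> x * grad2 (conv_power G k m) x"
          by (intro mult_left_mono Phi_nonneg)
      next
        show "fs (\<lambda>x. Phi \<theta> x * (f x)\<^sup>2)" by (intro fs_mult_right fs_power2 fsf)
        show "fs (\<lambda>x. Phi \<theta> x * grad2 (conv_power G k m) x)" by (intro fs_mult_right fs_grad2 fsu)
      qed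
    qed (auto intro!: tot_nonneg mult_nonneg_nonneg Phi_nonneg)
    also have "\<dots> \<le> C1\<^sup>2 * (C5 * real q powr (- 1 - D / 2))" by (intro mult_left_mono gm) auto
    also have "\<dots> \<le> C * real q powr (- 1 - D / 2)"
      using C4 by (simp add: C_def distrib_right)
    finally show "tot (\<lambda>x. Phi (2 * (a / sqrt (real q))) x * (diff_op G h (conv_power G k q) x)\<^sup>2)
        \<le> C * real q powr (- 1 - D / 2)"
      unfolding \<theta>_eq .
  qed
qed

text \<open>Half of the weight pays for Cauchy-Schwarz, and the other half stays in the sum, where
  \<open>rho x \<le> Phi s x / s\<close>. As \<open>1 / s\<close> is of order \<open>sqrt q\<close>,
  it just uses up the gain \<open>q powr (- 1 / 2)\<close>.\<close>

lemma l1_bounds: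
  assumes growth: "has_growth_degree G W D" and a: "0 < a" and C: "0 < C"
  shows "\<exists>C'>0. \<forall>(q::nat) f. q \<ge> 1 \<longrightarrow> fs f \<longrightarrow>
    tot (\<lambda>x. Phi (2 * (a / sqrt (real q))) x * (f x)\<^sup>2) \<le> C * real q powr (- 1 - D / 2) \<longrightarrow>
    tot (\<lambda>x. \<bar>f x\<bar>) \<le> C' * real q powr (- 1 / 2) \<and> tot (\<lambda>x. rho x * \<bar>f x\<bar>) \<le> C'"
proof -
  obtain C1 where C1: "C1 > 0" "\<And>q s g. (q::nat) \<ge> 1 \<Longrightarrow> fs g \<Longrightarrow>
    (tot (\<lambda>x. Phi s x * \<bar>g x\<bar>))\<^sup>2
      \<le> C1 * real q powr (D / 2) * tot (\<lambda>x. Phi (2 * s + a / sqrt (real q)) x * (g x)\<^sup>2)"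
    using weighted_l1_le_l2[OF growth a] by (elim exE conjE) (rule that, blast+)
  define K where "K = sqrt (C1 * C)"
  have K: "0 < K" using C1 C by (simp add: K_def)
  show ?thesis
  proof (rule exI[of _ "K + 2 / a * K"], intro conjI allI impI)
    show "0 < K + 2 / a * K" using K a by (simp add: add_pos_pos)
    fix q :: nat and f
    assume q: "q \<ge> 1" and f: "fs f"
      and le: "tot (\<lambda>x. Phi (2 * (a / sqrt (real q))) x * (f x)\<^sup>2) \<le> C * real q powr (- 1 - D / 2)"
    define s where "s = a / (2 * sqrt (real q))"
    have s: "0 < s" using a q by (simp add: s_def)
    have seq: "2 * s + a / sqrt (real q) = 2 * (a / sqrt (real q))" by (simp add: s_def field_simps)
    have "(tot (\<lambda>x. Phi s x * \<bar>f x\<bar>))\<^sup>2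
        \<le> C1 * real q powr (D / 2) * tot (\<lambda>x. Phi (2 * (a / sqrt (real q))) x * (f x)\<^sup>2)"
      using C1(2)[OF q f, of s] unfolding seq .
    also have "\<dots> \<le> C1 * real q powr (D / 2) * (C * real q powr (- 1 - D / 2))"
      using C1 by (intro mult_left_mono le) auto
    also have "\<dots> = C1 * C * (real q powr (D / 2) * real q powr (- 1 - D / 2))" by simp
    also have "real q powr (D / 2) * real q powr (- 1 - D / 2) = (real q powr (- 1 / 2))\<^sup>2"
      by (simp add: powr_add[symmetric] power2_eq_square)
    also have "C1 * C * (real q powr (- 1 / 2))\<^sup>2 = (K * real q powr (- 1 / 2))\<^sup>2"
      using C1 C by (simp add: K_def power_mult_distrib)
    finally have main: "tot (\<lambda>x. Phi s x * \<bar>f x\<bar>) \<le> K * real q powr (- 1 / 2)"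
      by (rule power2_le_imp_le) (use K in simp)
    have fsP: "fs (\<lambda>x. Phi s x * \<bar>f x\<bar>)" by (intro fs_mult_right fs_abs f)
    have "tot (\<lambda>x. \<bar>f x\<bar>) \<le> tot (\<lambda>x. Phi s x * \<bar>f x\<bar>)"
    proof (rule tot_mono)
      fix x
      have "1 \<le> Phi s x" using s by (simp add: Phi_def)
      then show "\<bar>f x\<bar> \<le> Phi s x * \<bar>f x\<bar>" using mult_right_mono[of 1 "Phi s x" "\<bar>f x\<bar>"] by simp
    qed (intro fs_abs f fsP)+
    also have "\<dots> \<le> (K + 2 / a * K) * real q powr (- 1 / 2)"
      using main K a by (simp add: distrib_right add_increasing2)
    finally show "tot (\<lambda>x. \<bar>f x\<bar>) \<le> (K + 2 / a * K) * real q powr (- 1 / 2)" .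
    have "tot (\<lambda>x. rho x * \<bar>f x\<bar>) \<le> tot (\<lambda>x. 1 / s * (Phi s x * \<bar>f x\<bar>))"
    proof (rule tot_mono)
      fix x
      have "s * rho x \<le> Phi s x" unfolding Phi_def using exp_ge_add_one_self[of "s * rho x"] by linarith
      then have "rho x \<le> 1 / s * Phi s x" using s by (simp add: field_simps)
      then show "rho x * \<bar>f x\<bar> \<le> 1 / s * (Phi s x * \<bar>f x\<bar>)"
        using mult_right_mono[of "rho x" "1 / s * Phi s x" "\<bar>f x\<bar>"] by simp
    qed (intro fs_mult_right fs_abs f)+
    also have "\<dots> \<le> 1 / s * (K * real q powr (- 1 / 2))"
      unfolding tot_cmult using s by (intro mult_left_mono main) auto
    also have "\<dots> = 2 / a * K * (sqrt (real q) * real q powr (- 1 / 2))" by (simp add: s_def)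
    also have "sqrt (real q) * real q powr (- 1 / 2) = 1"
      using q by (simp add: powr_minus powr_half_sqrt)
    finally show "tot (\<lambda>x. rho x * \<bar>f x\<bar>) \<le> K + 2 / a * K" using K by simp
  qed
qed

section \<open>Passage to norms and probability mass functions\<close>

lemma lp_norm_2: "lp_norm G 2 (\<lambda>g. exp (b * rho g / t) * f g)
    = sqrt (tot (\<lambda>x. Phi (2 * (b / t)) x * (f x)\<^sup>2))"
proof -
  have "(\<Sum>\<^sub>\<infinity>g \<in> carrier G. \<bar>exp (b * rho g / t) * f g\<bar> powr 2) = tot (\<lambda>x. Phi (2 * (b / t)) x * (f x)\<^sup>2)"
    unfolding tot_def
    by (rule infsum_cong) (simp add: Phi_def power_mult_distrib exp_double[symmetric] mult.assoc)
  moreover have "0 \<le> tot (\<lambda>x. Phi (2 * (b / t)) x * (f x)\<^sup>2)"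
    by (intro tot_nonneg mult_nonneg_nonneg Phi_nonneg) auto
  ultimately show ?thesis by (simp add: lp_norm_def powr_half_sqrt)
qed

lemma lp_norm_1: "lp_norm G 1 f = tot (\<lambda>x. \<bar>f x\<bar>)"
  using tot_nonneg[of "\<lambda>x. \<bar>f x\<bar>"] by (simp add: lp_norm_def tot_def)

lemma good_kernel_pmf:
  assumes K: "finitely_supported_on G K" and c: "centered G d \<pi> K"
    and \<eta>: "\<And>w. w \<in> W \<Longrightarrow> \<eta> \<le> pmf K w" and M: "exp_moment G W \<beta> K \<le> M"
  shows "good_kernel d \<pi> \<eta> \<beta> M (pmf K)"
proof -
  have fin: "finite (set_pmf K)" "set_pmf K \<subseteq> carrier G"
    using K by (auto simp: finitely_supported_on_def)
  have "fs (pmf K)"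
    unfolding fs_def by (rule finite_subset[OF _ fin(1)]) (auto simp: set_pmf_iff)
  moreover have "tot (pmf K) = 1"
  proof -
    have "tot (pmf K) = sum (pmf K) (set_pmf K)"
      by (rule tot_eq_sum[OF fin]) (auto simp: set_pmf_iff)
    then show ?thesis using sum_pmf_eq_1[OF fin(1) order_refl] by simp
  qed
  ultimately show ?thesis
    using \<eta> M c by (simp add: good_kernel_def tot_def exp_moment_def centered_def)
qed

end

theorem propositionB12:
  fixes G :: "('a, 'b) monoid_scheme"
    and W :: "'a set"
    and D \<eta> \<beta> M \<kappa> :: real
  assumes "nilpotent_group G"
    and "finite_symmetric_generating_set G W"
    and "\<one>\<^bsub>G\<^esub> \<in> W"
    and "has_growth_degree G W D"
    and "\<eta> > 0" and "\<beta> > 0" and "\<kappa> > 0"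
  shows "\<exists>a>0. \<exists>C>0.
    \<forall>(d :: nat) (\<pi> :: 'a \<Rightarrow> nat \<Rightarrow> int) (R0 :: real) (K :: real \<Rightarrow> 'a pmf).
      free_abelian_projection G d \<pi> \<longrightarrow>
      (\<forall>R\<ge>R0. finitely_supported_on G (K R) \<and> centered G d \<pi> (K R)) \<longrightarrow>
      (INF R\<in>{R0..}. pmf (K R) \<one>\<^bsub>G\<^esub>) \<ge> \<eta> \<longrightarrow>
      (INF R\<in>{R0..}. Min (pmf (K R) ` W)) \<ge> \<eta> \<longrightarrow>
      bdd_above ((\<lambda>R. exp_moment G W \<beta> (K R)) ` {R0..}) \<longrightarrow>
      (SUP R\<in>{R0..}. exp_moment G W \<beta> (K R)) = M \<longrightarrow>
      (\<forall>q::nat. q \<ge> 1 \<longrightarrow> (\<forall>h\<in>W.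
         let \<rho> = (\<lambda>g. real (word_length G W g));
             Rq = max R0 (\<kappa> * ln (real q + 1));
             Kq = conv_power G (pmf (K Rq)) q
         in lp_norm G 2 (\<lambda>g. exp (a * \<rho> g / sqrt (real q)) * Kq g)
              \<le> C * real q powr (- D / 4)
          \<and> lp_norm G 2 (\<lambda>g. exp (a * \<rho> g / sqrt (real q)) * diff_op G h Kq g)
              \<le> C * real q powr (- 1 / 2 - D / 4)
          \<and> lp_norm G 1 (diff_op G h Kq) \<le> C * real q powr (- 1 / 2)
          \<and> (\<Sum>\<^sub>\<infinity>g \<in> carrier G. \<rho> g * \<bar>diff_op G h Kq g\<bar>) \<le> C))"
proof (cases "\<exists>d \<pi>. free_abelian_projection G d (\<pi> :: 'a \<Rightarrow> nat \<Rightarrow> int)")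
  \<comment> \<open>Without any projection the claim is vacuous, whatever the constants.\<close>
  case False
  then show ?thesis
    by (intro exI[of _ "1 :: real"] conjI zero_less_one) simp
next
  case True
  \<comment> \<open>The constants precede \<open>d\<close> and \<open>\<pi>\<close>, so they are
    drawn from one fixed projection, to which centering is transferred later.\<close>
  then obtain d0 and \<pi>0 :: "'a \<Rightarrow> nat \<Rightarrow> int" where \<pi>0: "free_abelian_projection G d0 \<pi>0" by blast
  interpret word_metric G W
    using assms(1-3) by (intro word_metric.intro word_metric_axioms.intro) (auto simp: nilpotent_group_def)
  obtain a C where a: "0 < a" and C: "0 < C"
    and bounds: "\<forall>k (q::nat) h. good_kernel d0 \<pi>0 \<eta> \<beta> M k \<longrightarrow> q \<ge> 1 \<longrightarrow> h \<in> W \<longrightarrow>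
      tot (\<lambda>x. Phi (2 * (a / sqrt (real q))) x * (conv_power G k q x)\<^sup>2) \<le> C * real q powr (- D / 2) \<and>
      tot (\<lambda>x. Phi (2 * (a / sqrt (real q))) x * (diff_op G h (conv_power G k q) x)\<^sup>2)
        \<le> C * real q powr (- 1 - D / 2)"
    using weighted_bounds[OF \<pi>0 assms(5,6,4), of M] by (elim exE conjE) (rule that)
  obtain C' where C': "0 < C'" and l1: "\<forall>(q::nat) f. q \<ge> 1 \<longrightarrow> fs f \<longrightarrow>
    tot (\<lambda>x. Phi (2 * (a / sqrt (real q))) x * (f x)\<^sup>2) \<le> C * real q powr (- 1 - D / 2) \<longrightarrow>
    tot (\<lambda>x. \<bar>f x\<bar>) \<le> C' * real q powr (- 1 / 2) \<and> tot (\<lambda>x. rho x * \<bar>f x\<bar>) \<le> C'"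
    using l1_bounds[OF assms(4) a C] by (elim exE conjE) (rule that)
  define B where "B = sqrt C + C'"
  have B: "0 < B" "sqrt C \<le> B" "C' \<le> B" using C C' by (auto simp: B_def add_pos_pos)
  show ?thesis
  proof (rule exI[of _ a], intro conjI a, rule exI[of _ B], intro conjI B(1) allI impI ballI)
    fix d and \<pi> :: "'a \<Rightarrow> nat \<Rightarrow> int" and R0 and K :: "real \<Rightarrow> 'a pmf" and q :: nat and h
    assume \<pi>: "free_abelian_projection G d \<pi>"
      and K: "\<forall>R\<ge>R0. finitely_supported_on G (K R) \<and> centered G d \<pi> (K R)"
      and inf: "(INF R\<in>{R0..}. Min (pmf (K R) ` W)) \<ge> \<eta>"
      and bdd: "bdd_above ((\<lambda>R. exp_moment G W \<beta> (K R)) ` {R0..})"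
      and sup: "(SUP R\<in>{R0..}. exp_moment G W \<beta> (K R)) = M"
      and q: "1 \<le> q" and h: "h \<in> W"
    define R where "R = max R0 (\<kappa> * ln (real q + 1))"
    define k where "k = pmf (K R)"
    have R: "R0 \<le> R" by (simp add: R_def)
    have "exp_moment G W \<beta> (K R) \<le> M"
      unfolding sup[symmetric] by (rule cSUP_upper[OF _ bdd]) (use R in simp)
    moreover have "\<eta> \<le> pmf (K R) w" if w: "w \<in> W" for w
    proof -
      \<comment> \<open>A real infimum bounds the members only of a set bounded below; here masses
        are nonnegative.\<close>
      have "bdd_below ((\<lambda>R. Min (pmf (K R) ` W)) ` {R0..})"
        by (rule bdd_belowI2[of _ 0]) (use fin_W w in \<open>auto intro!: Min.boundedI\<close>)
      then have "(INF R\<in>{R0..}. Min (pmf (K R) ` W)) \<le> Min (pmf (K R) ` W)"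
        by (rule cINF_lower) (use R in simp)
      also have "\<dots> \<le> pmf (K R) w" using fin_W w by simp
      finally show ?thesis using inf by simp
    qed
    moreover have "finitely_supported_on G (K R)" "centered G d0 \<pi>0 (K R)"
      using K R centered_transfer[OF \<pi> \<pi>0] by auto
    ultimately have k: "good_kernel d0 \<pi>0 \<eta> \<beta> M k"
      unfolding k_def by (intro good_kernel_pmf)
    define u where "u = conv_power G k q"
    have fsu: "fs (diff_op G h u)"
      unfolding u_def using k by (intro fs_diff_op W_carrier h fs_conv_power) (simp add: good_kernel_def)
    have b: "tot (\<lambda>x. Phi (2 * (a / sqrt (real q))) x * (u x)\<^sup>2) \<le> C * real q powr (- D / 2)"
      "tot (\<lambda>x. Phi (2 * (a / sqrt (real q))) x * (diff_op G h u x)\<^sup>2) \<le> C * real q powr (- 1 - D / 2)"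
      using bounds[rule_format, OF k q h] by (auto simp: u_def)
    \<comment> \<open>The bounds concern squared norms; the root halves the exponents to
      \<open>- D / 4\<close> and \<open>- 1 / 2 - D / 4\<close>.\<close>
    have root: "sqrt t \<le> B * real q powr (e / 2)" if "t \<le> C * real q powr e" for t e
    proof -
      have "sqrt t \<le> sqrt (C * real q powr e)" using that by simp
      also have "\<dots> = sqrt C * real q powr (e / 2)"
        by (simp add: real_sqrt_mult powr_half_sqrt[symmetric] powr_powr)
      also have "\<dots> \<le> B * real q powr (e / 2)" using B by (intro mult_right_mono) auto
      finally show ?thesis .
    qed
    have "lp_norm G 2 (\<lambda>g. exp (a * rho g / sqrt (real q)) * u g) \<le> B * real q powr (- D / 4)"
      unfolding lp_norm_2 using root[OF b(1)] by simp
    moreover have "lp_norm G 2 (\<lambda>g. exp (a * rho g / sqrt (real q)) * diff_op G h u g)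
        \<le> B * real q powr (- 1 / 2 - D / 4)"
      unfolding lp_norm_2 using root[OF b(2)] by (simp add: diff_divide_distrib)
    moreover have "lp_norm G 1 (diff_op G h u) \<le> B * real q powr (- 1 / 2)"
      unfolding lp_norm_1 using l1[rule_format, OF q fsu b(2)] mult_right_mono[OF B(3), of "real q powr (- 1 / 2)"]
      by simp
    moreover have "(\<Sum>\<^sub>\<infinity>g \<in> carrier G. rho g * \<bar>diff_op G h u g\<bar>) \<le> B"
      using l1[rule_format, OF q fsu b(2)] B(3) by (simp add: tot_def)
    ultimately show "let \<rho> = (\<lambda>g. real (word_length G W g));
             Rq = max R0 (\<kappa> * ln (real q + 1));
             Kq = conv_power G (pmf (K Rq)) q
         in lp_norm G 2 (\<lambda>g. exp (a * \<rho> g / sqrt (real q)) * Kq g)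
              \<le> B * real q powr (- D / 4)
          \<and> lp_norm G 2 (\<lambda>g. exp (a * \<rho> g / sqrt (real q)) * diff_op G h Kq g)
              \<le> B * real q powr (- 1 / 2 - D / 4)
          \<and> lp_norm G 1 (diff_op G h Kq) \<le> B * real q powr (- 1 / 2)
          \<and> (\<Sum>\<^sub>\<infinity>g \<in> carrier G. \<rho> g * \<bar>diff_op G h Kq g\<bar>) \<le> B"
      by (simp add: Let_def u_def k_def R_def)
  qed
qed

end
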